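(* Let $L$ be a finite distributive lattice with at least two elements and let $K$ be a field. Then the global dimension of the incidence algebra of $L$ over $K$ is equal to the order dimension of $L$.
   Context: The incidence algebra of a finite poset $P$ over a field $K$ is the $K$-algebra with $K$-basis $\{p_y^x \mid x,y\in P,\ x\le y\}$ and multiplication $p_{x_2}^{x_1}p_{y_2}^{y_1}=p_{y_2}^{x_1}$ if $x_2=y_1$ and $0$ otherwise. A linear extension of a partial order $\le$ on a finite set $X$ is a total order $\le^*$ on $X$ such that $x\le y$ implies $x\le^* y$. The order dimension of a finite poset is the minimal number $t$ such that there exist $t$ linear extensions of its order whose intersection (as relations) is equal to the given order. *)

theory Defs
  imports "HOL-Algebra.Module" "HOL-Library.Extended_Nat"
begin

section \<open>Incidence algebras\<close>

text \<open>
  An element is given by its coordinates: \<open>f x y\<close> is the coefficient of the basis element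
  $p_y^x$. For the ring structure on these functions see \<open>ring_incidence_algebra\<close>; for the
  multiplication table of the basis see \<open>incidence_basis_mult\<close>.
\<close>

definition incidence_algebra :: "('a::{finite,order} \<Rightarrow> 'a \<Rightarrow> 'k::field) ring" where
  "incidence_algebra =
     \<lparr>carrier = {f. \<forall>x y. \<not> x \<le> y \<longrightarrow> f x y = 0},
      mult = (\<lambda>f g x y. \<Sum>z\<in>UNIV. f x z * g z y),
      one = (\<lambda>x y. if x = y then 1 else 0),
      zero = (\<lambda>x y. 0),
      add = (\<lambda>f g x y. f x y + g x y)\<rparr>"

definition incidence_basis :: "'a::{finite,order} \<Rightarrow> 'a \<Rightarrow> 'a \<Rightarrow> 'a \<Rightarrow> 'k::field" where
  "incidence_basis x y = (\<lambda>u v. if u = x \<and> v = y then 1 else 0)"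

lemma incidence_basis_mult:
  "incidence_basis x1 x2 \<otimes>\<^bsub>incidence_algebra\<^esub> incidence_basis y1 y2 =
     (if x2 = y1 then incidence_basis x1 y2 else \<zero>\<^bsub>incidence_algebra\<^esub>)"
proof -
  have "(\<Sum>z\<in>UNIV. incidence_basis x1 x2 u z * incidence_basis y1 y2 z v) =
        (\<Sum>z\<in>UNIV. if z = x2 then incidence_basis x1 x2 u x2 * incidence_basis y1 y2 x2 v else (0::'b))"
    for u v
    by (rule sum.cong) (auto simp: incidence_basis_def)
  then show ?thesis
    by (auto simp: incidence_algebra_def incidence_basis_def fun_eq_iff)
qed

lemma ring_incidence_algebra:
  "ring (incidence_algebra :: ('a::{finite,order} \<Rightarrow> 'a \<Rightarrow> 'k::field) ring)" (is "ring ?A")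
proof (rule ringI)
  show "abelian_group ?A"
  proof (rule abelian_groupI)
    fix f assume f: "f \<in> carrier ?A"
    show "\<exists>g\<in>carrier ?A. g \<oplus>\<^bsub>?A\<^esub> f = \<zero>\<^bsub>?A\<^esub>"
      by (rule bexI[of _ "\<lambda>x y. - f x y"]) (use f in \<open>auto simp: incidence_algebra_def\<close>)
  qed (auto simp: incidence_algebra_def fun_eq_iff add_ac)
  show "monoid ?A"
  proof (rule monoidI)
    fix f g assume fg: "f \<in> carrier ?A" "g \<in> carrier ?A"
    have "f x z * g z y = 0" if "\<not> x \<le> y" for x y z
    proof (cases "x \<le> z")
      case True
      with that have "\<not> z \<le> y" by (meson order_trans)
      with fg show ?thesis by (simp add: incidence_algebra_def)
    next
      case False
      with fg show ?thesis by (simp add: incidence_algebra_def)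
    qed
    then show "f \<otimes>\<^bsub>?A\<^esub> g \<in> carrier ?A"
      by (auto simp: incidence_algebra_def intro!: sum.neutral)
  next
    fix f g h assume "f \<in> carrier ?A" "g \<in> carrier ?A" "h \<in> carrier ?A"
    have "(\<Sum>w\<in>UNIV. (\<Sum>z\<in>UNIV. f x z * g z w) * h w y) =
          (\<Sum>z\<in>UNIV. f x z * (\<Sum>w\<in>UNIV. g z w * h w y))" for x y
      unfolding sum_distrib_left sum_distrib_right
      by (subst sum.swap) (simp add: mult.assoc)
    then show "f \<otimes>\<^bsub>?A\<^esub> g \<otimes>\<^bsub>?A\<^esub> h = f \<otimes>\<^bsub>?A\<^esub> (g \<otimes>\<^bsub>?A\<^esub> h)"
      by (simp add: incidence_algebra_def)
  qed (auto simp: incidence_algebra_def fun_eq_iff if_distrib if_distribR cong: if_cong)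
qed (auto simp: incidence_algebra_def fun_eq_iff algebra_simps sum.distrib)

section \<open>Modules and global dimension\<close>

text \<open>
  The library's locale \<open>module\<close> requires a commutative ring; the following one drops
  commutativity, and uses the same records.
\<close>

locale left_module = R?: ring R + M?: abelian_group M
  for R :: "('r, 'x) ring_scheme" (structure) and M :: "('r, 'm) module" (structure) +
  assumes smult_closed:
      "\<lbrakk>a \<in> carrier R; x \<in> carrier M\<rbrakk> \<Longrightarrow> a \<odot>\<^bsub>M\<^esub> x \<in> carrier M"
    and smult_l_distr:
      "\<lbrakk>a \<in> carrier R; b \<in> carrier R; x \<in> carrier M\<rbrakk> \<Longrightarrow>
        (a \<oplus>\<^bsub>R\<^esub> b) \<odot>\<^bsub>M\<^esub> x = a \<odot>\<^bsub>M\<^esub> x \<oplus>\<^bsub>M\<^esub> b \<odot>\<^bsub>M\<^esub> x"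
    and smult_r_distr:
      "\<lbrakk>a \<in> carrier R; x \<in> carrier M; y \<in> carrier M\<rbrakk> \<Longrightarrow>
        a \<odot>\<^bsub>M\<^esub> (x \<oplus>\<^bsub>M\<^esub> y) = a \<odot>\<^bsub>M\<^esub> x \<oplus>\<^bsub>M\<^esub> a \<odot>\<^bsub>M\<^esub> y"
    and smult_assoc:
      "\<lbrakk>a \<in> carrier R; b \<in> carrier R; x \<in> carrier M\<rbrakk> \<Longrightarrow>
        (a \<otimes>\<^bsub>R\<^esub> b) \<odot>\<^bsub>M\<^esub> x = a \<odot>\<^bsub>M\<^esub> (b \<odot>\<^bsub>M\<^esub> x)"
    and smult_one:
      "x \<in> carrier M \<Longrightarrow> \<one>\<^bsub>R\<^esub> \<odot>\<^bsub>M\<^esub> x = x"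

definition left_module_hom ::
    "('r, 'x) ring_scheme \<Rightarrow> ('r, 'm) module \<Rightarrow> ('r, 'n) module \<Rightarrow> ('m \<Rightarrow> 'n) set" where
  "left_module_hom R M N =
     {h \<in> carrier M \<rightarrow> carrier N.
        (\<forall>x\<in>carrier M. \<forall>y\<in>carrier M. h (x \<oplus>\<^bsub>M\<^esub> y) = h x \<oplus>\<^bsub>N\<^esub> h y) \<and>
        (\<forall>a\<in>carrier R. \<forall>x\<in>carrier M. h (a \<odot>\<^bsub>M\<^esub> x) = a \<odot>\<^bsub>N\<^esub> h x)}"

text \<open>
  The modules \<open>M\<close> and \<open>N\<close> of the lifting property range over those whose elements lie in the
  same type \<open>'m\<close> as the elements of \<open>P\<close>, because HOL does not quantify over types. This is the usual
  notion of a projective module as soon as \<open>'m\<close> is infinite and at least as large as the carrier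
  of \<open>R\<close>: then a free module on the set \<open>carrier P\<close> is already available in \<open>'m\<close>.
\<close>

definition projective_module :: "('r, 'x) ring_scheme \<Rightarrow> ('r, 'm) module \<Rightarrow> bool" where
  "projective_module R P \<longleftrightarrow>
     left_module R P \<and>
     (\<forall>(M :: ('r, 'm) module) (N :: ('r, 'm) module) f g.
        left_module R M \<longrightarrow> left_module R N \<longrightarrow>
        f \<in> left_module_hom R M N \<longrightarrow> f ` carrier M = carrier N \<longrightarrow>
        g \<in> left_module_hom R P N \<longrightarrow>
        (\<exists>h\<in>left_module_hom R P M. \<forall>x\<in>carrier P. f (h x) = g x))"

text \<open>
  $0 \to P_n \to \dots \to P_1 \to P_0 \to M \to 0$ is exact with all $P_i$ projective, where the
  indices are shifted by one: \<open>C 0\<close> is $M$, \<open>C (Suc i)\<close> is $P_i$, and \<open>d i\<close> is the map from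
  \<open>C (Suc i)\<close> to \<open>C i\<close>. Values of \<open>C\<close> beyond \<open>Suc n\<close> and of \<open>d\<close> beyond \<open>n\<close> are irrelevant.
\<close>

definition projective_resolution ::
    "('r, 'x) ring_scheme \<Rightarrow> ('r, 'm) module \<Rightarrow> nat \<Rightarrow>
     (nat \<Rightarrow> ('r, 'm) module) \<Rightarrow> (nat \<Rightarrow> 'm \<Rightarrow> 'm) \<Rightarrow> bool" where
  "projective_resolution R M n C d \<longleftrightarrow>
     C 0 = M \<and>
     (\<forall>i\<le>n. projective_module R (C (Suc i))) \<and>
     (\<forall>i\<le>n. d i \<in> left_module_hom R (C (Suc i)) (C i)) \<and>
     d 0 ` carrier (C 1) = carrier M \<and>
     (\<forall>i<n. d (Suc i) ` carrier (C (Suc (Suc i))) =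
              {x \<in> carrier (C (Suc i)). d i x = \<zero>\<^bsub>C i\<^esub>}) \<and>
     {x \<in> carrier (C (Suc n)). d n x = \<zero>\<^bsub>C n\<^esub>} = {\<zero>\<^bsub>C (Suc n)\<^esub>}"

text \<open>The value is \<open>\<infinity>\<close> if there is no finite projective resolution.\<close>

definition projective_dimension :: "('r, 'x) ring_scheme \<Rightarrow> ('r, 'm) module \<Rightarrow> enat" where
  "projective_dimension R M = Inf {enat n | n. \<exists>C d. projective_resolution R M n C d}"

text \<open>
  The type \<open>'m\<close> is the universe of the modules: all modules with elements in \<open>'m\<close> are considered.
  If \<open>'m\<close> is infinite and at least as large as the carrier of \<open>R\<close>, then \<open>'m\<close> contains free covers
  of all its modules, so that \<open>projective_dimension\<close> takes its usual value on them, and a copy of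
  every cyclic \<open>R\<close>-module; for such \<open>'m\<close> the supremum is the usual left global dimension.
\<close>

definition global_dimension :: "'m itself \<Rightarrow> ('r, 'x) ring_scheme \<Rightarrow> enat" where
  "global_dimension _ R =
     Sup {projective_dimension R M | M :: ('r, 'm) module. left_module R M}"

section \<open>Order dimension\<close>

definition linear_extension :: "'a set \<Rightarrow> 'a rel \<Rightarrow> 'a rel \<Rightarrow> bool" where
  "linear_extension X r s \<longleftrightarrow> linear_order_on X s \<and> r \<subseteq> s"

text \<open>The intersection is taken among the relations on \<open>X\<close>, also if \<open>F\<close> is empty.\<close>

definition order_dimension :: "'a set \<Rightarrow> 'a rel \<Rightarrow> nat" where
  "order_dimension X r =
     (LEAST t. \<exists>F. finite F \<and> card F = t \<and> (\<forall>s\<in>F. linear_extension X r s) \<and>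
                   (X \<times> X) \<inter> \<Inter>F = r)"

end

(*
  Both sides equal the largest number n of upper covers of an element of L.

  Order side. If u_1, ..., u_k are the upper covers of x, then u_i is not below the join b_i of the
  others, so some member of a realizer puts b_i below u_i, and no linear extension can do this for
  two indices; hence n is a lower bound. Conversely, an antichain A of join-prime elements gives the
  |A| upper covers x v a of the largest x that is above no a in A. By Dilworth's theorem the join-primes
  are therefore covered by n chains, and each chain C yields a linear extension that first compares
  the sets of elements of C below x and y. Since join-primes separate points, these n linear orders
  intersect in the given one.

  Algebra side. A left module M over the incidence algebra A is a contravariant functor x |-> M_x on L
  with values in vector spaces. For the list us of upper covers of x, the cube of the M_y, where y runs
  through the joins of subsets of us, has a total complex (the complex that computes Tor^A(T, M) for
  the simple right module T at x from the Taylor resolution of T). It is exact in positive degrees on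
  projective modules, and its homology in degree 1 vanishes at all x only if M is projective. By
  dimension shifting, M has projective dimension at most m if and only if the homology vanishes in
  all degrees above m at all x. The complex has length at most n; and if x has n upper covers
  with join y, then distributivity shows that the simple module at y contributes only in degree n,
  so that its homology there does not vanish.
*)

theory Submission
  imports Defs
begin

section \<open>Order dimension of a distributive lattice\<close>

text \<open>The homology is that of an explicit complex, so dimension shifting becomes a direct
  chase along one short exact sequence at a time. Exactness on projectives is proved only for
  modules \<open>induced_module M V\<close>, whose columns are direct summands and can be treated
  one by one; an arbitrary projective module is a retract of a copy of such a module. The cover of
  \<open>M\<close> is built from complements of the radical: if the homology of \<open>M\<close>
  vanishes in degree 1, a Nakayama argument, which on a finite lattice is an induction from the top
  downwards, shows that its kernel is zero. The other obstacle is size, since projectivity only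
  ranges over modules with elements in one type \<open>'m\<close>. Elements of an induced module are
  matrices over \<open>'m\<close>; as \<open>'m\<close> is infinite and the lattice finite, they can
  be encoded in \<open>'m\<close>, while the simple modules enter through \<open>emb\<close>. In a
  general lattice, joins of different sets of upper covers may coincide. Exactness on projectives
  survives this, but the detection of the top degree by a simple module needs a vertex that occurs
  only once.\<close>

definition antichain_on :: "'a::order set \<Rightarrow> bool" where
  "antichain_on A \<longleftrightarrow> (\<forall>x\<in>A. \<forall>y\<in>A. x \<le> y \<longrightarrow> x = y)"

text \<open>Galvin's induction: a maximal element \<open>a\<close> is removed and the rest is
  covered by \<open>k\<close> chains, where \<open>k\<close> is its largest antichain size. Either
  \<open>a\<close> extends an antichain of size \<open>k\<close>, or it tops a chain whose removal
  lowers the antichain size. The chains are the fibres of \<open>f\<close>.\<close>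

lemma dilworth:
  fixes P :: "'a::order set"
  assumes "finite P" and "\<And>A. A \<subseteq> P \<Longrightarrow> antichain_on A \<Longrightarrow> card A \<le> n"
  shows "\<exists>f. f ` P \<subseteq> {..<n} \<and> (\<forall>x\<in>P. \<forall>y\<in>P. f x = f y \<longrightarrow> x \<le> y \<or> y \<le> x)"
  using assms
proof (induction P arbitrary: n rule: finite_psubset_induct)
  case (psubset P)
  show ?case
  proof (cases "P = {}")
    case False
    then obtain a where a: "a \<in> P" and amax: "\<And>x. x \<in> P \<Longrightarrow> a \<le> x \<Longrightarrow> x = a"
      using finite_has_maximal[OF psubset.hyps] by metis
    define P' where "P' = P - {a}"
    have P': "P' \<subset> P" "finite P'" using a psubset.hyps by (auto simp: P'_def)
    define \<A> where "\<A> = {A. A \<subseteq> P' \<and> antichain_on A}"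
    have "\<A> \<subseteq> Pow P'" by (auto simp: \<A>_def)
    then have fin\<A>: "finite \<A>" "{} \<in> \<A>"
      using P'(2) by (auto intro: finite_subset simp: \<A>_def antichain_on_def)
    define k where "k = Max (card ` \<A>)"
    have k_max: "card A \<le> k" if "A \<subseteq> P'" "antichain_on A" for A
    proof -
      have "A \<in> \<A>" using that by (simp add: \<A>_def)
      then show ?thesis unfolding k_def using fin\<A>(1) by (intro Max_ge finite_imageI imageI)
    qed
    have "card ` \<A> \<noteq> {}" using fin\<A>(2) by blast
    then have "k \<in> card ` \<A>" unfolding k_def using fin\<A>(1) by (intro Max_in finite_imageI)
    then obtain A0 where "A0 \<in> \<A>" "card A0 = k" by blast
    then have A0: "A0 \<subseteq> P'" "antichain_on A0" "card A0 = k" by (simp_all add: \<A>_def)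
    have kn: "k \<le> n" using psubset.prems[of A0] A0 P' by auto
    have "\<exists>f. f ` P' \<subseteq> {..<k} \<and> (\<forall>x\<in>P'. \<forall>y\<in>P'. f x = f y \<longrightarrow> x \<le> y \<or> y \<le> x)"
      by (rule psubset.IH[OF P'(1)]) (rule k_max)
    then obtain f where f: "f ` P' \<subseteq> {..<k}"
      and fc: "\<And>x y. x \<in> P' \<Longrightarrow> y \<in> P' \<Longrightarrow> f x = f y \<Longrightarrow> x \<le> y \<or> y \<le> x"
      by blast
    define \<B> where "\<B> = {B. B \<subseteq> P' \<and> antichain_on B \<and> card B = k}"
    \<comment> \<open>An antichain of size \<open>k\<close> has at most one element in each of the
      \<open>k\<close> chains, so by counting it meets every one of them.\<close>
    have hit: "\<exists>z\<in>B. f z = i" if B: "B \<in> \<B>" and i: "i < k" for B i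
    proof -
      have "inj_on f B"
      proof (rule inj_onI)
        fix x y assume "x \<in> B" "y \<in> B" "f x = f y"
        moreover have "x \<in> P'" "y \<in> P'" using B calculation by (auto simp: \<B>_def)
        ultimately show "x = y" using B fc[of x y] by (auto simp: \<B>_def antichain_on_def)
      qed
      then have "card (f ` B) = k" using B by (simp add: card_image \<B>_def)
      moreover have "f ` B \<subseteq> {..<k}" using f B by (auto simp: \<B>_def)
      ultimately have "f ` B = {..<k}" by (simp add: card_subset_eq)
      then have "i \<in> f ` B" using i by simp
      then show ?thesis by auto
    qed
    \<comment> \<open>The elements of chain \<open>i\<close> that lie on some antichain of size
      \<open>k\<close>; the largest of them, \<open>x i\<close>, is the point where the chain will
      be cut.\<close>
    define S where "S i = {x \<in> P'. f x = i \<and> (\<exists>B\<in>\<B>. x \<in> B)}" for i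
    have "\<exists>x\<in>S i. \<forall>z\<in>S i. z \<le> x" if i: "i < k" for i
    proof -
      have "finite (S i)" using P' by (auto simp: S_def)
      moreover have "S i \<noteq> {}"
        using hit[of A0 i] A0 i by (auto simp: S_def \<B>_def)
      ultimately obtain x where x: "x \<in> S i" "\<And>z. z \<in> S i \<Longrightarrow> x \<le> z \<Longrightarrow> z = x"
        using finite_has_maximal[of "S i"] by metis
      then have "z \<le> x" if "z \<in> S i" for z
        using that fc[of x z] x by (auto simp: S_def)
      then show ?thesis using x by blast
    qed
    then obtain x where xS: "\<And>i. i < k \<Longrightarrow> x i \<in> S i"
      and xmax: "\<And>i z. i < k \<Longrightarrow> z \<in> S i \<Longrightarrow> z \<le> x i"
      by metis
    have xP: "x i \<in> P'" "f (x i) = i" if "i < k" for i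
      using xS[OF that] by (auto simp: S_def)
    \<comment> \<open>An antichain of size \<open>k\<close> through \<open>x j\<close> meets chain
      \<open>i\<close> in some \<open>y\<close>, and maximality gives
      \<open>y \<le> x i \<le> x j\<close>; so \<open>y = x j\<close>, and the two chains
      agree.\<close>
    have xanti: "i = j" if ij: "i < k" "j < k" "x i \<le> x j" for i j
    proof -
      obtain B where B: "B \<in> \<B>" "x j \<in> B" using xS[OF ij(2)] by (auto simp: S_def)
      obtain y where y: "y \<in> B" "f y = i" using hit[OF B(1) ij(1)] by auto
      have "y \<in> S i" using y B by (auto simp: S_def \<B>_def)
      then have "y \<le> x j" using xmax[OF ij(1)] ij(3) by (meson order_trans)
      then have "y = x j" using y B by (auto simp: \<B>_def antichain_on_def)
      then show ?thesis using y xP[OF ij(2)] by simp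
    qed
    show ?thesis
    proof (cases "\<exists>i<k. x i \<le> a")
      case False
      have "antichain_on (insert a (x ` {..<k}))"
        unfolding antichain_on_def using False xanti amax xP P' by blast
      moreover have "insert a (x ` {..<k}) \<subseteq> P" using a xP P' by auto
      moreover have "card (insert a (x ` {..<k})) = Suc k"
      proof -
        have "a \<notin> x ` {..<k}" using xP P'_def by force
        moreover have "inj_on x {..<k}" using xP by (metis inj_onI lessThan_iff)
        ultimately show ?thesis by (simp add: card_image)
      qed
      ultimately have kn': "Suc k \<le> n" using psubset.prems by metis
      have "(f(a := k)) ` P \<subseteq> {..<n}" using f kn' by (auto simp: P'_def)
      moreover have "u \<le> v \<or> v \<le> u"
        if "u \<in> P" "v \<in> P" "(f(a := k)) u = (f(a := k)) v" for u v
      proof (cases "u = a \<or> v = a")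
        case True
        moreover have "f z \<noteq> k" if "z \<in> P'" for z using f that by auto
        ultimately have "u = v" using that by (auto simp: P'_def split: if_splits)
        then show ?thesis by simp
      next
        case False
        then show ?thesis using that fc[of u v] by (auto simp: P'_def)
      qed
      ultimately show ?thesis by blast
    next
      case True
      then obtain i where i: "i < k" "x i \<le> a" by blast
      \<comment> \<open>Every antichain of size \<open>k\<close> in \<open>P'\<close> meets chain
        \<open>i\<close> at or below \<open>x i\<close>, hence meets \<open>K\<close>; deleting the
        chain \<open>K\<close> leaves antichains of size at most \<open>k - 1\<close>.\<close>
      define K where "K = insert a {z \<in> P'. f z = i \<and> z \<le> x i}"
      have K: "u \<le> v \<or> v \<le> u" if "u \<in> K" "v \<in> K" for u v
        using that i fc[of u v] unfolding K_def by (auto intro: order_trans)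
      have PK: "P - K \<subset> P" "P - K \<subseteq> P'" using a by (auto simp: K_def P'_def)
      have "card B \<le> k - 1" if B: "B \<subseteq> P - K" "antichain_on B" for B
      proof -
        have "card B \<le> k" using k_max[of B] B PK by auto
        moreover have "card B \<noteq> k"
        proof
          assume "card B = k"
          then have BB: "B \<in> \<B>" using B PK by (auto simp: \<B>_def)
          obtain z where z: "z \<in> B" "f z = i" using hit[OF BB i(1)] by auto
          then have "z \<in> S i" using BB by (auto simp: S_def \<B>_def)
          then have "z \<in> K" using xmax[OF i(1)] by (auto simp: K_def S_def)
          then show False using z B by auto
        qed
        ultimately show ?thesis by simp
      qed
      then have "\<exists>g. g ` (P - K) \<subseteq> {..<k - 1} \<and>
          (\<forall>x\<in>P - K. \<forall>y\<in>P - K. g x = g y \<longrightarrow> x \<le> y \<or> y \<le> x)"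
        by (rule psubset.IH[OF PK(1)])
      then obtain g where g: "g ` (P - K) \<subseteq> {..<k - 1}"
        and gc: "\<And>x y. x \<in> P - K \<Longrightarrow> y \<in> P - K \<Longrightarrow> g x = g y \<Longrightarrow> x \<le> y \<or> y \<le> x"
        by blast
      define h where "h z = (if z \<in> K then k - 1 else g z)" for z
      have "h ` P \<subseteq> {..<n}" using g kn i by (auto simp: h_def)
      moreover have "u \<le> v \<or> v \<le> u" if "u \<in> P" "v \<in> P" "h u = h v" for u v
      proof -
        have *: "g z \<noteq> k - 1" if "z \<in> P - K" for z using g that by auto
        show ?thesis
          using that K[of u v] gc[of u v] *[of u] *[of v] by (auto simp: h_def split: if_splits)
      qed
      ultimately show ?thesis by blast
    qed
  qed auto
qed

section \<open>Upper covers and join-prime elements\<close>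

definition upper_covers :: "'a::order \<Rightarrow> 'a set" where
  "upper_covers x = {u. x < u \<and> (\<forall>z. x < z \<longrightarrow> z \<le> u \<longrightarrow> z = u)}"

lemma upper_covers_inf:
  fixes x :: "'a::lattice"
  assumes u: "u \<in> upper_covers x" and v: "v \<in> upper_covers x" and "u \<noteq> v"
  shows "inf u v = x"
proof -
  have "x \<le> inf u v" using u v by (auto simp: upper_covers_def)
  moreover have "inf u v = u" if "x < inf u v" using u that by (simp add: upper_covers_def)
  moreover have "inf u v = v" if "x < inf u v" using v that by (simp add: upper_covers_def)
  ultimately show ?thesis using \<open>u \<noteq> v\<close> by (auto simp: le_less)
qed

text \<open>The first condition excludes the least element, which satisfies the second one
  trivially.\<close>

definition join_primes :: "'a::lattice set" where
  "join_primes = {p. (\<exists>x. \<not> p \<le> x) \<and> (\<forall>u v. p \<le> sup u v \<longrightarrow> p \<le> u \<or> p \<le> v)}"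

text \<open>A minimal element \<open>p\<close> among those below \<open>x\<close> but not below
  \<open>y\<close> is join-prime: if \<open>p \<le> sup u v\<close> and \<open>p\<close> is below
  neither, then \<open>inf p u\<close> and \<open>inf p v\<close> are strictly below
  \<open>p\<close>, hence below \<open>y\<close>, and by distributivity their join is
  \<open>p\<close>.\<close>

lemma join_prime_separates:
  fixes x y :: "'a::{finite,distrib_lattice}"
  assumes "\<not> x \<le> y"
  obtains p where "p \<in> join_primes" "p \<le> x" "\<not> p \<le> y"
proof -
  have "x \<in> {p. p \<le> x \<and> \<not> p \<le> y}" using assms by simp
  then obtain p where p: "p \<le> x" "\<not> p \<le> y"
    and pmin: "\<And>q. q \<le> x \<Longrightarrow> \<not> q \<le> y \<Longrightarrow> q \<le> p \<Longrightarrow> q = p"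
    using finite_has_minimal[of "{p. p \<le> x \<and> \<not> p \<le> y}"] by (metis (lifting) empty_iff finite mem_Collect_eq)
  have "p \<le> u \<or> p \<le> v" if uv: "p \<le> sup u v" for u v
  proof (rule ccontr)
    assume "\<not> ?thesis"
    then have "inf p u \<le> y" "inf p v \<le> y"
      using pmin[of "inf p u"] pmin[of "inf p v"] p(1) by (auto simp: le_infI1 le_iff_inf[of p])
    then have "sup (inf p u) (inf p v) \<le> y" by simp
    moreover have "sup (inf p u) (inf p v) = p"
      using uv by (simp flip: inf_sup_distrib1 add: inf.absorb1)
    ultimately show False using p by simp
  qed
  then show ?thesis using that p unfolding join_primes_def by blast
qed

lemma join_prime_antichain_upper_covers:
  fixes A :: "'a::{finite,distrib_lattice} set"
  assumes A: "A \<subseteq> join_primes" "antichain_on A"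
  shows "\<exists>x :: 'a. card A \<le> card (upper_covers x)"
proof (cases "A = {}")
  case False
  define D where "D = {x. \<forall>a\<in>A. \<not> a \<le> x}"
  \<comment> \<open>A minimal element of a finite lattice is the least one, because meets exist. It
    lies in \<open>D\<close>, so that \<open>D\<close> has a maximal element.\<close>
  obtain b :: 'a where b: "\<And>x. b \<le> x"
  proof -
    obtain b :: 'a where "\<And>q. q \<le> b \<Longrightarrow> q = b"
      using finite_has_minimal[of "UNIV :: 'a set"] by auto
    then show ?thesis using that[of b] by (metis inf.cobounded1 inf.cobounded2)
  qed
  have "\<not> a \<le> b" if a: "a \<in> A" for a
  proof
    assume "a \<le> b"
    then have "a \<le> z" for z using b[of z] by (rule order_trans)
    then show False using A(1) a by (auto simp: join_primes_def)
  qed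
  then have "b \<in> D" unfolding D_def by blast
  then obtain x where x: "x \<in> D" and xm: "\<And>z. z \<in> D \<Longrightarrow> x \<le> z \<Longrightarrow> z = x"
    using finite_has_maximal[of D] by (metis empty_iff finite)
  have prime: "a \<le> u \<or> a \<le> v" if "a \<in> A" "a \<le> sup u v" for a u v
    using A(1) that by (auto simp: join_primes_def)
  have nle: "\<not> a \<le> x" if "a \<in> A" for a using x that by (auto simp: D_def)
  have "sup x a \<in> upper_covers x" if a: "a \<in> A" for a
  proof -
    have "x < sup x a" using nle[OF a] by (simp add: less_le_not_le)
    \<comment> \<open>By maximality of \<open>x\<close>, some \<open>a'\<close> in \<open>A\<close>
      lies below \<open>z\<close>; being prime and not below \<open>x\<close>, it is below
      \<open>a\<close>, hence equal to \<open>a\<close>.\<close>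
    moreover have "z = sup x a" if z: "x < z" "z \<le> sup x a" for z
    proof -
      have "z \<notin> D" using xm[of z] z by (auto simp: less_le_not_le)
      then obtain a' where a': "a' \<in> A" "a' \<le> z" by (auto simp: D_def)
      then have "a' \<le> a" using prime[of a' x a] nle z by (meson order_trans)
      then have "a' = a" using A a a' by (auto simp: antichain_on_def)
      then show ?thesis using z a' by (simp add: order.antisym less_imp_le)
    qed
    ultimately show ?thesis by (auto simp: upper_covers_def)
  qed
  moreover have "inj_on (sup x) A"
  proof (rule inj_onI)
    fix a a' assume "a \<in> A" "a' \<in> A" "sup x a = sup x a'"
    then have "a \<le> a'" using prime[of a x a'] nle by (metis sup.cobounded2)
    then show "a = a'" using A \<open>a \<in> A\<close> \<open>a' \<in> A\<close> by (auto simp: antichain_on_def)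
  qed
  ultimately have "card A \<le> card (upper_covers x)"
    by (intro card_inj_on_le[of "sup x"]) auto
  then show ?thesis by blast
qed auto

section \<open>Linear extensions and realizers\<close>

lemma linear_extension_exists:
  "\<exists>s. linear_extension UNIV {(x, y :: 'a::{finite,order}). x \<le> y} s"
proof -
  have "\<exists>e :: 'a \<Rightarrow> nat. inj_on e A \<and> (\<forall>x\<in>A. \<forall>y\<in>A. x \<le> y \<longrightarrow> e x \<le> e y)"
    if "finite A" for A :: "'a set"
    using that
  proof (induction A rule: finite_psubset_induct)
    case (psubset A)
    show ?case
    proof (cases "A = {}")
      case False
      then obtain a where a: "a \<in> A" "\<And>x. x \<in> A \<Longrightarrow> a \<le> x \<Longrightarrow> x = a"
        using finite_has_maximal[OF psubset.hyps] by metis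
      then obtain e :: "'a \<Rightarrow> nat" where e: "inj_on e (A - {a})"
        "\<And>x y. x \<in> A - {a} \<Longrightarrow> y \<in> A - {a} \<Longrightarrow> x \<le> y \<Longrightarrow> e x \<le> e y"
        using psubset.IH[of "A - {a}"] by blast
      \<comment> \<open>\<open>N\<close> exceeds all values of \<open>e\<close> on \<open>A\<close>,
        so the maximal element \<open>a\<close> is put last.\<close>
      define N where "N = Suc (Max (insert 0 (e ` A)))"
      have N: "e x < N" if "x \<in> A" for x
        unfolding N_def using psubset.hyps that by (auto simp: less_Suc_eq_le)
      have "inj_on (e(a := N)) A"
      proof (rule inj_onI)
        fix x y assume "x \<in> A" "y \<in> A" "(e(a := N)) x = (e(a := N)) y"
        then show "x = y" using N[of x] N[of y] e(1)
          by (auto simp: inj_on_def split: if_splits)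
      qed
      moreover have "(e(a := N)) x \<le> (e(a := N)) y" if "x \<in> A" "y \<in> A" "x \<le> y" for x y
        using that a(2)[of y] e(2)[of x y] N[of x] by (auto simp: less_imp_le)
      ultimately show ?thesis by blast
    qed auto
  qed
  from this[of UNIV] obtain e :: "'a \<Rightarrow> nat" where e: "inj e" "\<And>x y. x \<le> y \<Longrightarrow> e x \<le> e y"
    by auto
  have "linear_extension UNIV {(x, y :: 'a). x \<le> y} {(x, y). e x \<le> e y}"
    unfolding linear_extension_def linear_order_on_def partial_order_on_def preorder_on_def
      refl_on_def trans_def antisym_def total_on_def
    using e by (auto dest: injD)
  then show ?thesis by blast
qed

lemma linear_extensionD:
  assumes "linear_extension UNIV {(x, y :: 'a::order). x \<le> y} s"
  shows "(x, x) \<in> s" "(x, y) \<in> s \<Longrightarrow> (y, x) \<in> s \<Longrightarrow> x = y"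
    "(x, y) \<in> s \<Longrightarrow> (y, z) \<in> s \<Longrightarrow> (x, z) \<in> s" "(x, y) \<in> s \<or> (y, x) \<in> s"
    "x \<le> y \<Longrightarrow> (x, y) \<in> s"
proof -
  have s: "refl s" "trans s" "antisym s" "total s" "{(x, y). x \<le> y} \<subseteq> s"
    using assms by (auto simp: linear_extension_def order_on_defs)
  show "(x, x) \<in> s" using s(1) by (rule reflD)
  show "(x, y) \<in> s \<Longrightarrow> (y, x) \<in> s \<Longrightarrow> x = y" using s(3) by (rule antisymD)
  show "(x, y) \<in> s \<Longrightarrow> (y, z) \<in> s \<Longrightarrow> (x, z) \<in> s" using s(2) by (rule transD)
  show "(x, y) \<in> s \<or> (y, x) \<in> s" using s(1,4) by (metis reflD total_on_def UNIV_I)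
  show "x \<le> y \<Longrightarrow> (x, y) \<in> s" using s(5) by blast
qed

lemma order_dimension_upper_covers:
  fixes n :: nat
  assumes n: "\<And>x :: 'a::{finite,distrib_lattice}. card (upper_covers x) \<le> n"
    and n_attained: "\<exists>x :: 'a. card (upper_covers x) = n"
  shows "order_dimension UNIV {(x, y :: 'a). x \<le> y} = n"
proof -
  let ?r = "{(x, y :: 'a). x \<le> y}"
  let ?P = "\<lambda>t. \<exists>F. finite F \<and> card F = t \<and> (\<forall>s\<in>F. linear_extension UNIV ?r s) \<and>
                   (UNIV \<times> UNIV) \<inter> \<Inter>F = ?r"
  obtain t0 where t0: "t0 \<le> n" "?P t0"
  proof -
    have "card A \<le> n" if "A \<subseteq> join_primes" "antichain_on A" for A :: "'a set"
      using join_prime_antichain_upper_covers[OF that] n order_trans by blast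
    then obtain f :: "'a \<Rightarrow> nat" where f: "f ` join_primes \<subseteq> {..<n}"
      and fc: "\<And>p q. p \<in> join_primes \<Longrightarrow> q \<in> join_primes \<Longrightarrow> f p = f q \<Longrightarrow> p \<le> q \<or> q \<le> p"
      using dilworth[of "join_primes :: 'a set" n] by (metis finite)
    obtain E where E: "linear_extension UNIV ?r E" using linear_extension_exists by blast
    define D where "D i x = {p \<in> join_primes. f p = i \<and> p \<le> x}" for i and x :: 'a
    have Dmono: "D i x \<subseteq> D i y" if "x \<le> y" for i x y using that by (auto simp: D_def)
    \<comment> \<open>Both sets are initial segments of the same chain of join-primes, hence
      comparable by inclusion.\<close>
    have Dlin: "D i x \<subseteq> D i y \<or> D i y \<subseteq> D i x" for i x y
    proof (rule ccontr)
      assume "\<not> ?thesis"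
      then obtain p q where "p \<in> D i x" "p \<notin> D i y" "q \<in> D i y" "q \<notin> D i x" by blast
      then show False using fc[of p q] by (auto simp: D_def intro: order_trans)
    qed
    \<comment> \<open>Ties between equal traces on the chain are broken by one fixed linear
      extension \<open>E\<close>, which makes \<open>s i\<close> antisymmetric.\<close>
    define s where "s i = {(x, y). D i x \<subset> D i y \<or> D i x = D i y \<and> (x, y) \<in> E}" for i
    note Ep = linear_extensionD[OF E]
    have s: "linear_extension UNIV ?r (s i)" for i
      unfolding linear_extension_def linear_order_on_def partial_order_on_def preorder_on_def
    proof (intro conjI)
      show "refl_on UNIV (s i)" by (auto simp: refl_on_def s_def Ep)
      show "trans (s i)" unfolding trans_def s_def by (auto dest: Ep(3))
      show "antisym (s i)" unfolding antisym_def s_def by (auto dest: Ep(2))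
      show "total_on UNIV (s i)" unfolding total_on_def s_def using Dlin Ep(4) by blast
      show "?r \<subseteq> s i" unfolding s_def using Dmono Ep(5) by blast
    qed auto
    have "(UNIV \<times> UNIV) \<inter> \<Inter>(s ` {..<n}) = ?r"
    proof
      show "?r \<subseteq> (UNIV \<times> UNIV) \<inter> \<Inter>(s ` {..<n})"
        using s by (auto simp: linear_extension_def)
      have "x \<le> y" if xy: "\<And>i. i < n \<Longrightarrow> (x, y) \<in> s i" for x y
      proof (rule ccontr)
        assume "\<not> x \<le> y"
        then obtain p where p: "p \<in> join_primes" "p \<le> x" "\<not> p \<le> y"
          by (rule join_prime_separates)
        then have "f p < n" using f by auto
        from xy[OF this] have "D (f p) x \<subseteq> D (f p) y" by (auto simp: s_def)
        then show False using p by (auto simp: D_def)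
      qed
      then show "(UNIV \<times> UNIV) \<inter> \<Inter>(s ` {..<n}) \<subseteq> ?r" by auto
    qed
    then have realizer: "?P (card (s ` {..<n}))"
      by (intro exI[of _ "s ` {..<n}"] conjI) (simp_all add: s)
    \<comment> \<open>The orders \<open>s i\<close> may coincide, so this realizer has at most
      \<open>n\<close> members; equality comes from the lower bound.\<close>
    have "card (s ` {..<n}) \<le> n" using card_image_le[of "{..<n}" s] by simp
    then show thesis using realizer by (rule that)
  qed
  have lower: "n \<le> t" if t: "?P t" for t
  proof -
    from t obtain F where F: "finite F \<and> card F = t \<and> (\<forall>s\<in>F. linear_extension UNIV ?r s) \<and>
      (UNIV \<times> UNIV) \<inter> \<Inter>F = ?r"
      by (rule exE)
    have finF: "finite F" "card F = t" and F_ext: "\<forall>s\<in>F. linear_extension UNIV ?r s"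
      and F_Int: "\<Inter>F = ?r"
      using F by simp_all
    obtain x :: 'a where x: "card (upper_covers x) = n" using n_attained by blast
    let ?U = "upper_covers x"
    \<comment> \<open>Including \<open>x\<close> keeps the join defined when \<open>u\<close> is the
      only upper cover.\<close>
    define b where "b u = Sup_fin (insert x (?U - {u}))" for u
    have b_ge: "v \<le> b u" if "v \<in> ?U" "v \<noteq> u" for u v
      unfolding b_def by (rule Sup_fin.coboundedI) (use that in auto)
    have not_le: "\<not> u \<le> b u" if u: "u \<in> ?U" for u
    proof
      assume "u \<le> b u"
      have inf_x: "inf u v = x" if "v \<in> insert x (?U - {u})" for v
        using that u upper_covers_inf[of u x v] by (auto simp: upper_covers_def inf.absorb2)
      \<comment> \<open>By distributivity \<open>inf u (b u)\<close> is the join of the meets of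
        \<open>u\<close> with \<open>x\<close> and with the other upper covers; all of these are
        \<open>x\<close>, so \<open>u\<close> would equal \<open>x\<close>.\<close>
      have "u = inf u (b u)" using \<open>u \<le> b u\<close> by (simp add: inf.absorb1)
      also have "\<dots> = Sup_fin {inf u v |v. v \<in> insert x (?U - {u})}"
        unfolding b_def by (rule inf_Sup1_distrib) auto
      also have "{inf u v |v. v \<in> insert x (?U - {u})} = {x}"
      proof (intro equalityI subsetI)
        fix w assume "w \<in> {x}"
        then have "w = inf u x" using inf_x[of x] by simp
        then show "w \<in> {inf u v |v. v \<in> insert x (?U - {u})}" by (intro CollectI exI[of _ x]) simp
      next
        fix w assume "w \<in> {inf u v |v. v \<in> insert x (?U - {u})}"
        then show "w \<in> {x}" using inf_x by (elim CollectE exE conjE) simp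
      qed
      finally show False using u by (simp add: upper_covers_def)
    qed
    have "\<forall>u\<in>?U. \<exists>s. s \<in> F \<and> (u, b u) \<notin> s"
    proof
      fix u assume "u \<in> ?U"
      then have "(u, b u) \<notin> \<Inter>F" unfolding F_Int using not_le by simp
      then show "\<exists>s. s \<in> F \<and> (u, b u) \<notin> s" by (simp only: Inter_iff bex_simps ball_simps) auto
    qed
    then obtain s where "\<forall>u\<in>?U. s u \<in> F \<and> (u, b u) \<notin> s u"
      by (rule bchoice[THEN exE])
    then have s: "\<And>u. u \<in> ?U \<Longrightarrow> s u \<in> F" "\<And>u. u \<in> ?U \<Longrightarrow> (u, b u) \<notin> s u"
      by simp_all
    have "inj_on s ?U"
    proof (rule inj_onI, rule ccontr)
      fix u v assume uv: "u \<in> ?U" "v \<in> ?U" "s u = s v" "u \<noteq> v"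
      let ?s = "s u"
      have "linear_extension UNIV ?r ?s" using s(1) F_ext uv(1) by blast
      note Ep = linear_extensionD[OF this]
      \<comment> \<open>If \<open>u\<close> precedes \<open>v\<close> in \<open>?s\<close>, then
        \<open>u\<close> precedes \<open>b u\<close>, because \<open>v \<le> b u\<close>; the other
        case is symmetric. So \<open>?s\<close> cannot reverse both pairs.\<close>
      have "(v, b u) \<in> ?s" "(u, b v) \<in> ?s" using b_ge uv Ep(5) by auto
      then have "(v, b v) \<in> ?s \<or> (u, b u) \<in> ?s" by (metis Ep(3,4))
      then show False using s(2) uv by auto
    qed
    then have "card ?U \<le> card F" using finF(1) s(1) by (intro card_inj_on_le[of s]) auto
    then show ?thesis using x finF by simp
  qed
  have "order_dimension UNIV ?r = (LEAST t. ?P t)" by (simp add: order_dimension_def)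
  also have "\<dots> = n"
  proof (rule Least_equality)
    have "t0 = n" using t0(1) lower[OF t0(2)] by (rule order.antisym)
    then show "?P n" using t0(2) by (simp only:)
  qed (rule lower)
  finally show ?thesis .
qed

section \<open>Left modules\<close>

lemma (in abelian_group) finsum_swap:
  assumes "finite I" "finite J" "\<And>i j. i \<in> I \<Longrightarrow> j \<in> J \<Longrightarrow> g i j \<in> carrier G"
  shows "(\<Oplus>i\<in>I. \<Oplus>j\<in>J. g i j) = (\<Oplus>j\<in>J. \<Oplus>i\<in>I. g i j)"
  using assms(1,3)
proof (induction I rule: finite_induct)
  case (insert i I)
  have "(\<Oplus>j\<in>J. \<Oplus>i\<in>insert i I. g i j) = (\<Oplus>j\<in>J. g i j \<oplus> (\<Oplus>i\<in>I. g i j))"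
    using insert by (intro finsum_cong') (auto intro!: finsum_insert finsum_closed)
  also have "\<dots> = (\<Oplus>j\<in>J. g i j) \<oplus> (\<Oplus>j\<in>J. \<Oplus>i\<in>I. g i j)"
    using insert by (intro finsum_addf) (auto intro!: finsum_closed)
  finally show ?case
    using insert by (simp add: finsum_insert finsum_closed Pi_iff)
qed simp

lemma (in abelian_group) finsum_delta:
  assumes "g i \<in> carrier G"
  shows "(\<Oplus>j\<in>(UNIV :: 'i::finite set). if j = i then g j else \<zero>) = g i"
proof -
  have "(\<Oplus>j\<in>UNIV. if j = i then g j else \<zero>) = (\<Oplus>j\<in>UNIV. if i = j then g i else \<zero>)"
    using assms by (intro finsum_cong') auto
  then show ?thesis using finsum_singleton[of i UNIV "\<lambda>_. g i"] assms by simp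
qed

lemma left_moduleI:
  assumes "ring R" "abelian_group M"
    and "\<And>a x. a \<in> carrier R \<Longrightarrow> x \<in> carrier M \<Longrightarrow> a \<odot>\<^bsub>M\<^esub> x \<in> carrier M"
    and "\<And>a b x. a \<in> carrier R \<Longrightarrow> b \<in> carrier R \<Longrightarrow> x \<in> carrier M \<Longrightarrow>
      (a \<oplus>\<^bsub>R\<^esub> b) \<odot>\<^bsub>M\<^esub> x = a \<odot>\<^bsub>M\<^esub> x \<oplus>\<^bsub>M\<^esub> b \<odot>\<^bsub>M\<^esub> x"
    and "\<And>a x y. a \<in> carrier R \<Longrightarrow> x \<in> carrier M \<Longrightarrow> y \<in> carrier M \<Longrightarrow>
      a \<odot>\<^bsub>M\<^esub> (x \<oplus>\<^bsub>M\<^esub> y) = a \<odot>\<^bsub>M\<^esub> x \<oplus>\<^bsub>M\<^esub> a \<odot>\<^bsub>M\<^esub> y"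
    and "\<And>a b x. a \<in> carrier R \<Longrightarrow> b \<in> carrier R \<Longrightarrow> x \<in> carrier M \<Longrightarrow>
      (a \<otimes>\<^bsub>R\<^esub> b) \<odot>\<^bsub>M\<^esub> x = a \<odot>\<^bsub>M\<^esub> (b \<odot>\<^bsub>M\<^esub> x)"
    and "\<And>x. x \<in> carrier M \<Longrightarrow> \<one>\<^bsub>R\<^esub> \<odot>\<^bsub>M\<^esub> x = x"
  shows "left_module R M"
  using assms by (intro left_module.intro left_module_axioms.intro)

context left_module
begin

lemma smult_zero_right [simp]:
  assumes "a \<in> carrier R"
  shows "a \<odot>\<^bsub>M\<^esub> \<zero>\<^bsub>M\<^esub> = \<zero>\<^bsub>M\<^esub>"
proof -
  have "a \<odot>\<^bsub>M\<^esub> \<zero>\<^bsub>M\<^esub> \<oplus>\<^bsub>M\<^esub> a \<odot>\<^bsub>M\<^esub> \<zero>\<^bsub>M\<^esub> = a \<odot>\<^bsub>M\<^esub> \<zero>\<^bsub>M\<^esub>"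
    using smult_r_distr[OF assms, of "\<zero>\<^bsub>M\<^esub>" "\<zero>\<^bsub>M\<^esub>"] by simp
  then show ?thesis using smult_closed[OF assms, of "\<zero>\<^bsub>M\<^esub>"] M.add.r_cancel_one by simp
qed

lemma smult_zero_left [simp]:
  assumes "x \<in> carrier M"
  shows "\<zero>\<^bsub>R\<^esub> \<odot>\<^bsub>M\<^esub> x = \<zero>\<^bsub>M\<^esub>"
proof -
  have "\<zero>\<^bsub>R\<^esub> \<odot>\<^bsub>M\<^esub> x \<oplus>\<^bsub>M\<^esub> \<zero>\<^bsub>R\<^esub> \<odot>\<^bsub>M\<^esub> x = \<zero>\<^bsub>R\<^esub> \<odot>\<^bsub>M\<^esub> x"
    using smult_l_distr[of "\<zero>\<^bsub>R\<^esub>" "\<zero>\<^bsub>R\<^esub>" x] assms by simp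
  then show ?thesis using smult_closed[of "\<zero>\<^bsub>R\<^esub>" x] assms M.add.r_cancel_one by simp
qed

lemma smult_minus_right:
  assumes a: "a \<in> carrier R" and x: "x \<in> carrier M"
  shows "a \<odot>\<^bsub>M\<^esub> (\<ominus>\<^bsub>M\<^esub> x) = \<ominus>\<^bsub>M\<^esub> (a \<odot>\<^bsub>M\<^esub> x)"
proof -
  have "a \<odot>\<^bsub>M\<^esub> (\<ominus>\<^bsub>M\<^esub> x) \<oplus>\<^bsub>M\<^esub> a \<odot>\<^bsub>M\<^esub> x = \<zero>\<^bsub>M\<^esub>"
    using smult_r_distr[OF a, of "\<ominus>\<^bsub>M\<^esub> x" x] a x by (simp add: M.l_neg)
  then show ?thesis using a x smult_closed[OF a] by (simp add: M.minus_equality)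
qed

end

lemma left_module_homD:
  assumes "h \<in> left_module_hom R M N"
  shows "x \<in> carrier M \<Longrightarrow> h x \<in> carrier N"
    and "x \<in> carrier M \<Longrightarrow> y \<in> carrier M \<Longrightarrow> h (x \<oplus>\<^bsub>M\<^esub> y) = h x \<oplus>\<^bsub>N\<^esub> h y"
    and "a \<in> carrier R \<Longrightarrow> x \<in> carrier M \<Longrightarrow> h (a \<odot>\<^bsub>M\<^esub> x) = a \<odot>\<^bsub>N\<^esub> h x"
  using assms by (auto simp: left_module_hom_def)

lemma left_module_homI:
  assumes "\<And>x. x \<in> carrier M \<Longrightarrow> h x \<in> carrier N"
    and "\<And>x y. x \<in> carrier M \<Longrightarrow> y \<in> carrier M \<Longrightarrow> h (x \<oplus>\<^bsub>M\<^esub> y) = h x \<oplus>\<^bsub>N\<^esub> h y"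
    and "\<And>a x. a \<in> carrier R \<Longrightarrow> x \<in> carrier M \<Longrightarrow> h (a \<odot>\<^bsub>M\<^esub> x) = a \<odot>\<^bsub>N\<^esub> h x"
  shows "h \<in> left_module_hom R M N"
  using assms by (auto simp: left_module_hom_def)

lemma left_module_hom_id: "(\<lambda>x. x) \<in> left_module_hom R M M"
  by (simp add: left_module_hom_def)

lemma left_module_hom_comp:
  assumes "h \<in> left_module_hom R M N" "g \<in> left_module_hom R N L"
  shows "(\<lambda>x. g (h x)) \<in> left_module_hom R M L"
  using assms by (auto simp: left_module_hom_def Pi_iff)

lemma additive_zero:
  assumes "abelian_group M" "abelian_group N" "h \<in> carrier M \<rightarrow> carrier N"
    and "\<And>x y. x \<in> carrier M \<Longrightarrow> y \<in> carrier M \<Longrightarrow> h (x \<oplus>\<^bsub>M\<^esub> y) = h x \<oplus>\<^bsub>N\<^esub> h y"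
  shows "h \<zero>\<^bsub>M\<^esub> = \<zero>\<^bsub>N\<^esub>"
proof -
  interpret M: abelian_group M by fact
  interpret N: abelian_group N by fact
  have "h \<zero>\<^bsub>M\<^esub> \<in> carrier N" using assms(3) by auto
  moreover have "h \<zero>\<^bsub>M\<^esub> \<oplus>\<^bsub>N\<^esub> h \<zero>\<^bsub>M\<^esub> = h \<zero>\<^bsub>M\<^esub>" using assms(4)[of "\<zero>\<^bsub>M\<^esub>" "\<zero>\<^bsub>M\<^esub>"] by simp
  ultimately show ?thesis using N.add.r_cancel_one by simp
qed

lemma additive_finsum:
  assumes "abelian_group M" "abelian_group N" "h \<in> carrier M \<rightarrow> carrier N"
    and "\<And>x y. x \<in> carrier M \<Longrightarrow> y \<in> carrier M \<Longrightarrow> h (x \<oplus>\<^bsub>M\<^esub> y) = h x \<oplus>\<^bsub>N\<^esub> h y"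
    and "finite I" "\<And>i. i \<in> I \<Longrightarrow> g i \<in> carrier M"
  shows "h (\<Oplus>\<^bsub>M\<^esub>i\<in>I. g i) = (\<Oplus>\<^bsub>N\<^esub>i\<in>I. h (g i))"
proof -
  interpret M: abelian_group M by fact
  interpret N: abelian_group N by fact
  note hM = assms(3)[THEN funcset_mem]
  from assms(5,6) show ?thesis
  proof (induction I rule: finite_induct)
    case empty
    then show ?case using additive_zero[OF assms(1-4)] by simp
  next
    case (insert i I)
    have g: "g i \<in> carrier M" "g \<in> I \<rightarrow> carrier M" using insert.prems by auto
    have "h (finsum M g (insert i I)) = h (g i \<oplus>\<^bsub>M\<^esub> finsum M g I)"
      using insert.hyps g by (simp add: M.finsum_insert)
    also have "\<dots> = h (g i) \<oplus>\<^bsub>N\<^esub> h (finsum M g I)" using g by (simp add: assms(4) M.finsum_closed)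
    also have "\<dots> = (\<Oplus>\<^bsub>N\<^esub>j\<in>insert i I. h (g j))"
      using insert g hM by (subst N.finsum_insert) (auto simp: Pi_iff)
    finally show ?case .
  qed
qed

lemma left_module_hom_zero:
  assumes "left_module R M" "left_module R N" "h \<in> left_module_hom R M N"
  shows "h \<zero>\<^bsub>M\<^esub> = \<zero>\<^bsub>N\<^esub>"
  using assms by (intro additive_zero) (auto simp: left_module_hom_def left_module_def)

lemma left_module_hom_minus:
  assumes "left_module R M" "left_module R N" "h \<in> left_module_hom R M N" "x \<in> carrier M"
  shows "h (\<ominus>\<^bsub>M\<^esub> x) = \<ominus>\<^bsub>N\<^esub> h x"
proof -
  interpret M: left_module R M by fact
  interpret N: left_module R N by fact
  have "h (\<ominus>\<^bsub>M\<^esub> x) \<oplus>\<^bsub>N\<^esub> h x = \<zero>\<^bsub>N\<^esub>"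
    using assms left_module_homD(2)[OF assms(3), of "\<ominus>\<^bsub>M\<^esub> x" x]
    by (simp add: M.M.l_neg left_module_hom_zero)
  then show ?thesis
    using assms left_module_homD(1)[OF assms(3)] by (simp add: N.M.minus_equality)
qed

lemma left_module_hom_inverse:
  assumes "h \<in> left_module_hom R M N" and bij: "bij_betw h (carrier M) (carrier N)"
    and "left_module R M"
  shows "inv_into (carrier M) h \<in> left_module_hom R N M"
proof -
  interpret M: left_module R M by fact
  let ?g = "inv_into (carrier M) h"
  note h = left_module_homD[OF assms(1)]
  have img: "h ` carrier M = carrier N" and inj: "inj_on h (carrier M)"
    using bij by (auto simp: bij_betw_def)
  have g: "?g y \<in> carrier M" "h (?g y) = y" if "y \<in> carrier N" for y
    using that img inv_into_into[of y h "carrier M"] f_inv_into_f[of y h "carrier M"] by auto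
  have gI: "?g y = x" if "x \<in> carrier M" "h x = y" for x y
    using that inj by auto
  show ?thesis
    by (rule left_module_homI) (auto intro!: gI simp: h g M.smult_closed)
qed

text \<open>The operations of \<open>P\<close> are kept, so a syzygy has elements of the same type
  as its cover and the inclusion is the identity function.\<close>

definition kernel_module :: "('r, 'm) module \<Rightarrow> ('r, 'n) module \<Rightarrow> ('m \<Rightarrow> 'n) \<Rightarrow> ('r, 'm) module" where
  "kernel_module P N f = P\<lparr>carrier := {x \<in> carrier P. f x = \<zero>\<^bsub>N\<^esub>}\<rparr>"

lemma carrier_kernel_module: "carrier (kernel_module P N f) = {x \<in> carrier P. f x = \<zero>\<^bsub>N\<^esub>}"
  by (simp add: kernel_module_def)

lemma kernel_module_simps [simp]:
  "x \<oplus>\<^bsub>kernel_module P N f\<^esub> y = x \<oplus>\<^bsub>P\<^esub> y"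
  "\<zero>\<^bsub>kernel_module P N f\<^esub> = \<zero>\<^bsub>P\<^esub>"
  "a \<odot>\<^bsub>kernel_module P N f\<^esub> x = a \<odot>\<^bsub>P\<^esub> x"
  by (simp_all add: kernel_module_def)

lemma left_module_kernel_module:
  assumes "left_module R P" "left_module R N" "f \<in> left_module_hom R P N"
  shows "left_module R (kernel_module P N f)"
proof -
  interpret P: left_module R P by fact
  interpret N: left_module R N by fact
  note f = left_module_homD[OF assms(3)]
  show ?thesis
  proof (rule left_moduleI)
    show "abelian_group (kernel_module P N f)"
    proof (rule abelian_groupI)
      fix x assume x: "x \<in> carrier (kernel_module P N f)"
      show "\<exists>y\<in>carrier (kernel_module P N f). y \<oplus>\<^bsub>kernel_module P N f\<^esub> x = \<zero>\<^bsub>kernel_module P N f\<^esub>"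
        by (rule bexI[of _ "\<ominus>\<^bsub>P\<^esub> x"])
          (use x left_module_hom_minus[OF assms] in \<open>auto simp: carrier_kernel_module P.M.l_neg\<close>)
    qed (auto simp: carrier_kernel_module f left_module_hom_zero[OF assms] P.M.a_ac)
  qed (auto simp: carrier_kernel_module f P.smult_closed P.smult_l_distr P.smult_r_distr
      P.smult_assoc P.smult_one P.R.ring_axioms)
qed

lemma kernel_module_incl: "(\<lambda>x. x) \<in> left_module_hom R (kernel_module P N f) P"
  by (rule left_module_homI) (auto simp: carrier_kernel_module)

text \<open>An isomorphic copy along an injection. It brings induced modules, whose elements are
  matrices, and simple modules, whose elements are scalars, into the universe
  \<open>'m\<close>.\<close>

definition transport_module :: "('n \<Rightarrow> 'm) \<Rightarrow> ('r, 'n) module \<Rightarrow> ('r, 'm) module" where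
  "transport_module \<phi> N =
     \<lparr>carrier = \<phi> ` carrier N, mult = undefined, one = undefined, zero = \<phi> \<zero>\<^bsub>N\<^esub>,
      add = (\<lambda>x y. \<phi> (inv_into (carrier N) \<phi> x \<oplus>\<^bsub>N\<^esub> inv_into (carrier N) \<phi> y)),
      smult = (\<lambda>a x. \<phi> (a \<odot>\<^bsub>N\<^esub> inv_into (carrier N) \<phi> x))\<rparr>"

lemma transport_module:
  assumes "left_module R N" "inj_on \<phi> (carrier N)"
  shows "left_module R (transport_module \<phi> N)"
    and "\<phi> \<in> left_module_hom R N (transport_module \<phi> N)"
    and "bij_betw \<phi> (carrier N) (carrier (transport_module \<phi> N))"
proof -
  interpret N: left_module R N by fact
  have [simp]: "inv_into (carrier N) \<phi> (\<phi> x) = x" if "x \<in> carrier N" for x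
    using assms that by simp
  show "left_module R (transport_module \<phi> N)"
  proof (rule left_moduleI)
    show "abelian_group (transport_module \<phi> N)"
    proof (rule abelian_groupI)
      fix x assume "x \<in> carrier (transport_module \<phi> N)"
      then obtain y where y: "x = \<phi> y" "y \<in> carrier N" by (auto simp: transport_module_def)
      show "\<exists>y\<in>carrier (transport_module \<phi> N).
          y \<oplus>\<^bsub>transport_module \<phi> N\<^esub> x = \<zero>\<^bsub>transport_module \<phi> N\<^esub>"
        by (rule bexI[of _ "\<phi> (\<ominus>\<^bsub>N\<^esub> y)"]) (use y in \<open>auto simp: transport_module_def N.M.l_neg\<close>)
    qed (auto simp: transport_module_def N.M.a_ac)
  qed (auto simp: transport_module_def N.R.ring_axioms N.smult_closed N.smult_l_distr
      N.smult_r_distr N.smult_assoc N.smult_one)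
  show "\<phi> \<in> left_module_hom R N (transport_module \<phi> N)"
    by (rule left_module_homI) (auto simp: transport_module_def)
  show "bij_betw \<phi> (carrier N) (carrier (transport_module \<phi> N))"
    using assms by (simp add: bij_betw_def transport_module_def)
qed

section \<open>Splicing and cutting projective resolutions\<close>

lemma projective_resolution_of_projective:
  fixes P M :: "('r, 'm) module"
  assumes "projective_module R P" "left_module R M" "f \<in> left_module_hom R P M"
    and "bij_betw f (carrier P) (carrier M)"
  shows "\<exists>C d. projective_resolution R M 0 C d"
proof (intro exI)
  interpret P: left_module R P using assms(1) by (simp add: projective_module_def)
  have "left_module R P" ..
  then have f0: "f \<zero>\<^bsub>P\<^esub> = \<zero>\<^bsub>M\<^esub>" using assms(2,3) by (rule left_module_hom_zero)
  have "{x \<in> carrier P. f x = \<zero>\<^bsub>M\<^esub>} = {\<zero>\<^bsub>P\<^esub>}"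
  proof (intro equalityI subsetI)
    fix x assume "x \<in> {x \<in> carrier P. f x = \<zero>\<^bsub>M\<^esub>}"
    then have "x \<in> carrier P" "f x = f \<zero>\<^bsub>P\<^esub>" by (simp_all add: f0)
    then show "x \<in> {\<zero>\<^bsub>P\<^esub>}"
      using inj_onD[OF bij_betw_imp_inj_on[OF assms(4)]] by simp
  qed (simp add: f0)
  then show "projective_resolution R M 0 (case_nat M (\<lambda>_. P)) (\<lambda>_. f)"
    using assms by (simp add: projective_resolution_def bij_betw_def)
qed

text \<open>A cover of \<open>M\<close> is spliced with a resolution of its kernel: the term
  \<open>C 0\<close>, which is the kernel, is replaced by \<open>P\<close>, and \<open>d 0\<close>
  is read as a map into \<open>P\<close>.\<close>

lemma projective_resolution_Suc:
  fixes P M :: "('r, 'm) module"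
  assumes "projective_module R P" "f \<in> left_module_hom R P M" "f ` carrier P = carrier M"
    and "projective_resolution R (kernel_module P M f) n C d"
  shows "\<exists>C d. projective_resolution R M (Suc n) C d"
proof (intro exI)
  let ?C = "case_nat M (case_nat P (\<lambda>i. C (Suc i)))"
  let ?d = "case_nat f d"
  have C0: "C 0 = kernel_module P M f" using assms(4) by (simp add: projective_resolution_def)
  have d0: "d 0 \<in> left_module_hom R (C (Suc 0)) P"
    using assms(4) left_module_hom_comp[OF _ kernel_module_incl, of "d 0" R "C (Suc 0)" P M f]
    by (auto simp: projective_resolution_def)
  have im: "d 0 ` carrier (C (Suc 0)) = {x \<in> carrier P. f x = \<zero>\<^bsub>M\<^esub>}"
    using assms(4) by (simp add: projective_resolution_def carrier_kernel_module)
  \<comment> \<open>Replacing \<open>C 0\<close> by \<open>P\<close> changes no kernel of a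
    differential, because \<open>P\<close> and its submodule share their zero.\<close>
  have z: "d i x = \<zero>\<^bsub>?C (Suc i)\<^esub> \<longleftrightarrow> d i x = \<zero>\<^bsub>C i\<^esub>" for i x by (cases i) (simp_all add: C0)
  show "projective_resolution R M (Suc n) ?C ?d"
    unfolding projective_resolution_def
  proof (intro conjI allI impI)
    fix i assume i: "i \<le> Suc n"
    show "projective_module R (?C (Suc i))"
      using assms(1,4) i by (cases i) (auto simp: projective_resolution_def)
    show "?d i \<in> left_module_hom R (?C (Suc i)) (?C i)"
      using assms(2,4) i d0 by (cases i; cases "i - 1") (auto simp: projective_resolution_def)
  next
    fix i assume i: "i < Suc n"
    show "?d (Suc i) ` carrier (?C (Suc (Suc i))) = {x \<in> carrier (?C (Suc i)). ?d i x = \<zero>\<^bsub>?C i\<^esub>}"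
    proof (cases i)
      case 0
      then show ?thesis using im by simp
    next
      case (Suc j)
      then show ?thesis using assms(4) i z[of j] by (simp add: projective_resolution_def)
    qed
  next
    show "{x \<in> carrier (?C (Suc (Suc n))). ?d (Suc n) x = \<zero>\<^bsub>?C (Suc n)\<^esub>} = {\<zero>\<^bsub>?C (Suc (Suc n))\<^esub>}"
      using assms(4) z[of n] by (simp add: projective_resolution_def)
  qed (use assms in simp_all)
qed

lemma bij_betw_left_module_hom:
  assumes "left_module R P" "left_module R M" "f \<in> left_module_hom R P M"
    and "f ` carrier P = carrier M" "\<And>x. x \<in> carrier P \<Longrightarrow> f x = \<zero>\<^bsub>M\<^esub> \<Longrightarrow> x = \<zero>\<^bsub>P\<^esub>"
  shows "bij_betw f (carrier P) (carrier M)"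
proof -
  interpret P: left_module R P by fact
  interpret M: left_module R M by fact
  note f = left_module_homD[OF assms(3)]
  have "inj_on f (carrier P)"
  proof (rule inj_onI)
    fix x y assume xy: "x \<in> carrier P" "y \<in> carrier P" "f x = f y"
    have "f (x \<oplus>\<^bsub>P\<^esub> \<ominus>\<^bsub>P\<^esub> y) = \<zero>\<^bsub>M\<^esub>"
      using xy left_module_hom_minus[OF assms(1-3), of y] f by (simp add: M.M.r_neg)
    then have "x \<oplus>\<^bsub>P\<^esub> \<ominus>\<^bsub>P\<^esub> y = \<zero>\<^bsub>P\<^esub>"
      using xy by (intro assms(5)) simp_all
    then show "x = y" using xy P.M.minus_equality[of x "\<ominus>\<^bsub>P\<^esub> y"] by simp
  qed
  then show ?thesis using assms(4) by (simp add: bij_betw_def)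
qed

text \<open>A resolution with a single projective term is an isomorphism: its last exactness
  condition says that \<open>d 0\<close> has trivial kernel.\<close>

lemma projective_resolution_0D:
  assumes "projective_resolution R M 0 C d" "left_module R M"
  shows "projective_module R (C 1)" "d 0 \<in> left_module_hom R (C 1) M"
    "bij_betw (d 0) (carrier (C 1)) (carrier M)"
proof -
  show P: "projective_module R (C 1)" and d: "d 0 \<in> left_module_hom R (C 1) M"
    using assms by (auto simp: projective_resolution_def)
  show "bij_betw (d 0) (carrier (C 1)) (carrier M)"
    by (rule bij_betw_left_module_hom[OF _ assms(2) d])
      (use P assms in \<open>auto simp: projective_module_def projective_resolution_def carrier_kernel_module\<close>)
qed

text \<open>Inverse to splicing: exactness at \<open>C 1\<close> makes \<open>d 1\<close> a
  surjection onto the kernel of \<open>d 0\<close>, so the tail of the resolution resolves that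
  kernel.\<close>

lemma projective_resolution_SucD:
  assumes "projective_resolution R M (Suc n) C d"
  shows "projective_module R (C 1)" "d 0 \<in> left_module_hom R (C 1) M"
    "d 0 ` carrier (C 1) = carrier M"
    "\<exists>C' d'. projective_resolution R (kernel_module (C 1) M (d 0)) n C' d'"
proof -
  show "projective_module R (C 1)" "d 0 \<in> left_module_hom R (C 1) M" "d 0 ` carrier (C 1) = carrier M"
    using assms by (auto simp: projective_resolution_def)
  let ?K = "kernel_module (C 1) M (d 0)"
  let ?C = "case_nat ?K (\<lambda>i. C (Suc (Suc i)))"
  have im: "d (Suc 0) ` carrier (C (Suc (Suc 0))) = carrier ?K"
    using assms by (auto simp: projective_resolution_def carrier_kernel_module)
  have "d (Suc 0) \<in> left_module_hom R (C (Suc (Suc 0))) (C (Suc 0))"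
    using assms by (auto simp: projective_resolution_def)
  then have d1: "d (Suc 0) \<in> left_module_hom R (C (Suc (Suc 0))) ?K"
    using im by (auto simp: left_module_hom_def)
  have z: "\<zero>\<^bsub>?C i\<^esub> = \<zero>\<^bsub>C (Suc i)\<^esub>" for i by (cases i) simp_all
  have "projective_resolution R ?K n ?C (\<lambda>i. d (Suc i))"
    unfolding projective_resolution_def
  proof (intro conjI allI impI)
    fix i assume i: "i \<le> n"
    show "d (Suc i) \<in> left_module_hom R (?C (Suc i)) (?C i)"
      using d1 i assms by (cases i) (auto simp: projective_resolution_def)
    show "projective_module R (?C (Suc i))" using assms i by (simp add: projective_resolution_def)
  next
    fix i assume "i < n"
    then show "d (Suc (Suc i)) ` carrier (?C (Suc (Suc i))) =
        {x \<in> carrier (?C (Suc i)). d (Suc i) x = \<zero>\<^bsub>?C i\<^esub>}"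
      unfolding z using assms by (simp add: projective_resolution_def)
  next
    show "{x \<in> carrier (?C (Suc n)). d (Suc n) x = \<zero>\<^bsub>?C n\<^esub>} = {\<zero>\<^bsub>?C (Suc n)\<^esub>}"
      unfolding z using assms by (simp add: projective_resolution_def)
  qed (use im in simp_all)
  then show "\<exists>C' d'. projective_resolution R ?K n C' d'" by blast
qed

section \<open>Modules over the incidence algebra\<close>

text \<open>The element k p_y^x. A module carries no separate action of the field, so scalars enter
  through these elements: on \<open>component M x\<close> the scalar \<open>k\<close> acts as
  \<open>monomial k x x\<close>.\<close>

definition monomial :: "'k::field \<Rightarrow> 'a::{finite,order} \<Rightarrow> 'a \<Rightarrow> 'a \<Rightarrow> 'a \<Rightarrow> 'k" where
  "monomial k x y = (\<lambda>u v. if u = x \<and> v = y then k else 0)"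

lemma monomial_carrier: "x \<le> y \<Longrightarrow> monomial k x y \<in> carrier incidence_algebra"
  by (auto simp: monomial_def incidence_algebra_def)

lemma monomial_add:
  "monomial k x y \<oplus>\<^bsub>incidence_algebra\<^esub> monomial l x y = monomial (k + l) x y"
  by (auto simp: monomial_def incidence_algebra_def fun_eq_iff)

lemma monomial_zero: "monomial 0 x y = \<zero>\<^bsub>incidence_algebra\<^esub>"
  by (auto simp: monomial_def incidence_algebra_def fun_eq_iff)

lemma monomial_mult:
  "monomial k x y \<otimes>\<^bsub>incidence_algebra\<^esub> monomial l y' z =
     (if y = y' then monomial (k * l) x z else \<zero>\<^bsub>incidence_algebra\<^esub>)"
proof -
  have "(\<Sum>w\<in>UNIV. monomial k x y u w * monomial l y' z w v) =
        (\<Sum>w\<in>UNIV. if w = y then monomial k x y u y * monomial l y' z y v else 0)" for u v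
    by (rule sum.cong) (auto simp: monomial_def)
  then show ?thesis by (auto simp: incidence_algebra_def monomial_def fun_eq_iff)
qed

locale incidence_module =
  left_module "incidence_algebra :: ('p \<Rightarrow> 'p \<Rightarrow> 'k) ring" M
  for M :: "('p::{finite,order} \<Rightarrow> 'p \<Rightarrow> 'k::field, 'm) module"
begin

lemma monomial_closed [simp]:
  "x \<le> y \<Longrightarrow> m \<in> carrier M \<Longrightarrow> monomial k x y \<odot>\<^bsub>M\<^esub> m \<in> carrier M"
  by (simp add: smult_closed monomial_carrier)

lemma monomial_smult_smult:
  assumes "x \<le> y" "y' \<le> z" "m \<in> carrier M"
  shows "monomial k x y \<odot>\<^bsub>M\<^esub> (monomial l y' z \<odot>\<^bsub>M\<^esub> m) =
    (if y = y' then monomial (k * l) x z \<odot>\<^bsub>M\<^esub> m else \<zero>\<^bsub>M\<^esub>)"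
  using assms by (simp add: monomial_carrier monomial_mult flip: smult_assoc)

lemma monomial_r_distr:
  assumes "x \<le> y" "m \<in> carrier M" "m' \<in> carrier M"
  shows "monomial k x y \<odot>\<^bsub>M\<^esub> (m \<oplus>\<^bsub>M\<^esub> m') = monomial k x y \<odot>\<^bsub>M\<^esub> m \<oplus>\<^bsub>M\<^esub> monomial k x y \<odot>\<^bsub>M\<^esub> m'"
  using assms by (simp add: monomial_carrier smult_r_distr)

lemma monomial_l_distr:
  assumes "x \<le> y" "m \<in> carrier M"
  shows "monomial (k + l) x y \<odot>\<^bsub>M\<^esub> m = monomial k x y \<odot>\<^bsub>M\<^esub> m \<oplus>\<^bsub>M\<^esub> monomial l x y \<odot>\<^bsub>M\<^esub> m"
  using assms by (simp add: monomial_carrier smult_l_distr flip: monomial_add)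

lemma monomial_zero_smult [simp]: "m \<in> carrier M \<Longrightarrow> monomial 0 x y \<odot>\<^bsub>M\<^esub> m = \<zero>\<^bsub>M\<^esub>"
  by (simp add: monomial_zero)

lemma monomial_smult_zero [simp]: "x \<le> y \<Longrightarrow> monomial k x y \<odot>\<^bsub>M\<^esub> \<zero>\<^bsub>M\<^esub> = \<zero>\<^bsub>M\<^esub>"
  by (simp add: monomial_carrier)

lemma monomial_smult_minus:
  "x \<le> y \<Longrightarrow> m \<in> carrier M \<Longrightarrow>
    monomial k x y \<odot>\<^bsub>M\<^esub> (\<ominus>\<^bsub>M\<^esub> m) = \<ominus>\<^bsub>M\<^esub> (monomial k x y \<odot>\<^bsub>M\<^esub> m)"
  by (simp add: monomial_carrier smult_minus_right)

end

text \<open>The value M_x of the functor, cut out by the idempotent p_x^x. For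
  \<open>x \<le> y\<close> the restriction map from M_y to M_x is the action of
  \<open>monomial 1 x y\<close>.\<close>

definition component :: "('a::{finite,order} \<Rightarrow> 'a \<Rightarrow> 'k::field, 'm) module \<Rightarrow> 'a \<Rightarrow> 'm set" where
  "component M x = {m \<in> carrier M. monomial 1 x x \<odot>\<^bsub>M\<^esub> m = m}"

lemma component_carrier: "m \<in> component M x \<Longrightarrow> m \<in> carrier M"
  by (simp add: component_def)

lemma component_kernel_module:
  "component (kernel_module P N f) x = {m \<in> component P x. f m = \<zero>\<^bsub>N\<^esub>}"
  by (auto simp: component_def carrier_kernel_module)

lemma hom_component:
  assumes "h \<in> left_module_hom incidence_algebra M N" "m \<in> component M x"
  shows "h m \<in> component N x"
  using assms left_module_homD(3)[OF assms(1), of "monomial 1 x x" m]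
  by (auto simp: component_def monomial_carrier left_module_homD(1))

context incidence_module
begin

lemma monomial_component: "x \<le> y \<Longrightarrow> m \<in> carrier M \<Longrightarrow> monomial k x y \<odot>\<^bsub>M\<^esub> m \<in> component M x"
  by (simp add: component_def monomial_smult_smult)

lemma component_zero [simp]: "\<zero>\<^bsub>M\<^esub> \<in> component M x"
  by (simp add: component_def)

lemma component_add:
  "m \<in> component M x \<Longrightarrow> m' \<in> component M x \<Longrightarrow> m \<oplus>\<^bsub>M\<^esub> m' \<in> component M x"
  by (simp add: component_def monomial_r_distr)

lemma component_minus: "m \<in> component M x \<Longrightarrow> \<ominus>\<^bsub>M\<^esub> m \<in> component M x"
  by (simp add: component_def monomial_smult_minus)

text \<open>The idempotents p_x^x sum to the unit of the algebra; the partial sums over finite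
  \<open>S\<close> are the diagonal matrices \<open>?e S\<close>.\<close>

lemma component_decomposition:
  assumes m: "m \<in> carrier M"
  shows "(\<Oplus>\<^bsub>M\<^esub>x\<in>UNIV. monomial 1 x x \<odot>\<^bsub>M\<^esub> m) = m"
proof -
  let ?e = "\<lambda>(S :: 'p set) u v. if u = v \<and> u \<in> S then 1 else 0 :: 'k"
  have e: "?e S \<in> carrier incidence_algebra" for S :: "'p set"
    by (auto simp: incidence_algebra_def)
  have "(\<Oplus>\<^bsub>M\<^esub>x\<in>S. monomial 1 x x \<odot>\<^bsub>M\<^esub> m) = ?e S \<odot>\<^bsub>M\<^esub> m" if "finite S" for S
    using that
  proof (induction S rule: finite_induct)
    case empty
    have "?e {} = monomial 0 undefined undefined" by (auto simp: monomial_def fun_eq_iff)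
    then have "?e {} \<odot>\<^bsub>M\<^esub> m = \<zero>\<^bsub>M\<^esub>" using m by (simp only: monomial_zero_smult)
    then show ?case by simp
  next
    case (insert x S)
    have "?e (insert x S) = monomial 1 x x \<oplus>\<^bsub>incidence_algebra\<^esub> ?e S"
      using insert.hyps by (auto simp: monomial_def incidence_algebra_def fun_eq_iff)
    then have "?e (insert x S) \<odot>\<^bsub>M\<^esub> m = monomial 1 x x \<odot>\<^bsub>M\<^esub> m \<oplus>\<^bsub>M\<^esub> ?e S \<odot>\<^bsub>M\<^esub> m"
      using m e by (simp only: smult_l_distr monomial_carrier order.refl)
    then show ?case using insert m by (simp add: M.finsum_insert Pi_iff)
  qed
  moreover have "?e UNIV = \<one>\<^bsub>incidence_algebra\<^esub>"
    by (auto simp: incidence_algebra_def fun_eq_iff)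
  ultimately show ?thesis using m by (simp add: smult_one)
qed

end

text \<open>Every element of the algebra is a finite sum of monomials. The induction adds its
  entries one at a time; entries off the order relation vanish.\<close>

lemma left_module_hom_monomialI:
  assumes "left_module incidence_algebra M" "left_module incidence_algebra N"
    and h: "\<And>x. x \<in> carrier M \<Longrightarrow> h x \<in> carrier N"
      "\<And>x y. x \<in> carrier M \<Longrightarrow> y \<in> carrier M \<Longrightarrow> h (x \<oplus>\<^bsub>M\<^esub> y) = h x \<oplus>\<^bsub>N\<^esub> h y"
      "\<And>k x y m. x \<le> y \<Longrightarrow> m \<in> carrier M \<Longrightarrow>
        h (monomial k x y \<odot>\<^bsub>M\<^esub> m) = monomial k x y \<odot>\<^bsub>N\<^esub> h m"
  shows "h \<in> left_module_hom (incidence_algebra :: ('a::{finite,order} \<Rightarrow> 'a \<Rightarrow> 'k::field) ring) M N"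
proof (rule left_module_homI)
  interpret M: incidence_module M using assms(1) by (rule incidence_module.intro)
  interpret N: incidence_module N using assms(2) by (rule incidence_module.intro)
  fix a :: "'a \<Rightarrow> 'a \<Rightarrow> 'k" and m
  assume a: "a \<in> carrier incidence_algebra" and m: "m \<in> carrier M"
  let ?a = "\<lambda>S u v. if (u, v) \<in> S then a u v else 0"
  have car: "?a S \<in> carrier incidence_algebra" for S using a by (auto simp: incidence_algebra_def)
  have "h (?a S \<odot>\<^bsub>M\<^esub> m) = ?a S \<odot>\<^bsub>N\<^esub> h m" if "finite S" for S
    using that
  proof (induction S rule: finite_induct)
    case empty
    have "?a {} = monomial 0 undefined undefined" by (auto simp: monomial_def fun_eq_iff)
    then have "?a {} \<odot>\<^bsub>M\<^esub> m = \<zero>\<^bsub>M\<^esub>" "?a {} \<odot>\<^bsub>N\<^esub> h m = \<zero>\<^bsub>N\<^esub>"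
      using m h(1) by (simp_all only: M.monomial_zero_smult N.monomial_zero_smult)
    moreover have "h \<zero>\<^bsub>M\<^esub> = \<zero>\<^bsub>N\<^esub>"
      by (rule additive_zero) (use h in \<open>auto intro: M.abelian_group_axioms N.abelian_group_axioms\<close>)
    ultimately show ?case by simp
  next
    case (insert p S)
    obtain u v where p: "p = (u, v)" by (cases p)
    show ?case
    proof (cases "u \<le> v")
      case True
      have "?a (insert p S) = monomial (a u v) u v \<oplus>\<^bsub>incidence_algebra\<^esub> ?a S"
        using insert.hyps by (auto simp: p monomial_def incidence_algebra_def fun_eq_iff)
      then show ?thesis
        using m h car[of S] insert.IH True
        by (simp only: M.smult_l_distr N.smult_l_distr monomial_carrier M.monomial_closed M.smult_closed)
    next
      case False
      then have "?a (insert p S) = ?a S"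
        using a by (auto simp: p incidence_algebra_def fun_eq_iff)
      then show ?thesis using insert.IH by simp
    qed
  qed
  from this[of UNIV] show "h (a \<odot>\<^bsub>M\<^esub> m) = a \<odot>\<^bsub>N\<^esub> h m" by simp
qed (use h in auto)

section \<open>The complex of an upward cube\<close>

text \<open>Joins are accumulated in the base point, so that fixing the first bit leaves a cube over
  \<open>us\<close> again, based at \<open>z\<close> or at \<open>sup z u\<close>. This carries the
  inductions over \<open>us\<close>.\<close>

fun cube_vertex :: "'a::lattice \<Rightarrow> 'a list \<Rightarrow> bool list \<Rightarrow> 'a" where
  "cube_vertex z (u # us) (b # bs) = cube_vertex (if b then sup z u else z) us bs"
| "cube_vertex z _ _ = z"

lemma cube_vertex_sup: "cube_vertex (sup z u) us bs = sup (cube_vertex z us bs) u"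
  by (induction z us bs rule: cube_vertex.induct) (auto simp: sup.assoc sup.commute sup.left_commute)

lemma cube_vertex_mono: "z \<le> z' \<Longrightarrow> cube_vertex z us bs \<le> cube_vertex z' us bs"
  using cube_vertex_sup[of z z' us bs] by (simp add: sup.absorb2)

lemma cube_vertex_ge: "z \<le> cube_vertex z us bs"
  by (induction z us bs rule: cube_vertex.induct) (auto intro: order_trans[OF sup_ge1])

text \<open>A vertex of the cube over \<open>us\<close> is given by the list of bits that says which elements of \<open>us\<close> are
  joined to \<open>z\<close>; its degree is the number of \<open>True\<close>. The complex for \<open>u # us\<close> is the mapping cone of the
  restriction from the complex over \<open>us\<close> based at \<open>sup z u\<close> to the one based at \<open>z\<close>, which accounts for the
  sign in \<open>boundary\<close>.\<close>

definition chains :: "('a::{finite,lattice} \<Rightarrow> 'a \<Rightarrow> 'k::field, 'm) module \<Rightarrow> 'a list \<Rightarrow> 'a \<Rightarrow> nat \<Rightarrow>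
    (bool list \<Rightarrow> 'm) set" where
  "chains M us z j = {c. \<forall>bs. if length bs = length us \<and> count_list bs True = j
     then c bs \<in> component M (cube_vertex z us bs) else c bs = \<zero>\<^bsub>M\<^esub>}"

primrec boundary :: "('a::{finite,lattice} \<Rightarrow> 'a \<Rightarrow> 'k::field, 'm) module \<Rightarrow> 'a list \<Rightarrow> 'a \<Rightarrow>
    (bool list \<Rightarrow> 'm) \<Rightarrow> bool list \<Rightarrow> 'm" where
  "boundary M [] z c = (\<lambda>bs. \<zero>\<^bsub>M\<^esub>)"
| "boundary M (u # us) z c = (\<lambda>bs. case bs of [] \<Rightarrow> \<zero>\<^bsub>M\<^esub>
     | b # bs \<Rightarrow> if b then \<ominus>\<^bsub>M\<^esub> boundary M us (sup z u) (\<lambda>a. c (True # a)) bs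
         else boundary M us z (\<lambda>a. c (False # a)) bs \<oplus>\<^bsub>M\<^esub>
           monomial 1 (cube_vertex z us bs) (cube_vertex (sup z u) us bs) \<odot>\<^bsub>M\<^esub> c (True # bs))"

text \<open>The two parts of the mapping cone: the face with first bit \<open>True\<close> is
  shifted by one degree, hence contributes nothing in degree 0.\<close>

lemma chains_Cons:
  "c \<in> chains M (u # us) z j \<longleftrightarrow>
     c [] = \<zero>\<^bsub>M\<^esub> \<and> (\<lambda>a. c (False # a)) \<in> chains M us z j \<and>
     (case j of 0 \<Rightarrow> \<forall>a. c (True # a) = \<zero>\<^bsub>M\<^esub>
      | Suc i \<Rightarrow> (\<lambda>a. c (True # a)) \<in> chains M us (sup z u) i)"
proof -
  have all: "(\<forall>bs. P bs) \<longleftrightarrow> P [] \<and> (\<forall>a. P (False # a)) \<and> (\<forall>a. P (True # a))" for P :: "bool list \<Rightarrow> bool"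
  proof (intro iffI conjI allI)
    fix bs assume "P [] \<and> (\<forall>a. P (False # a)) \<and> (\<forall>a. P (True # a))"
    then show "P bs" by (cases bs; cases "hd bs") auto
  qed blast+
  show ?thesis
    by (cases j) (subst chains_def, subst mem_Collect_eq, subst all, simp add: chains_def)+
qed

locale lattice_incidence_module =
  incidence_module M for M :: "('p::{finite,lattice} \<Rightarrow> 'p \<Rightarrow> 'k::field, 'm) module"
begin

lemma chains_closed: "c \<in> chains M us z j \<Longrightarrow> c bs \<in> carrier M"
  unfolding chains_def mem_Collect_eq by (metis component_carrier M.zero_closed)

lemma boundary_closed:
  assumes "\<And>bs. c bs \<in> carrier M"
  shows "boundary M us z c bs \<in> carrier M"
  using assms
  by (induction us arbitrary: z c bs)
    (auto split: list.split simp: cube_vertex_mono)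

lemma boundary_zero: "boundary M us z (\<lambda>_. \<zero>\<^bsub>M\<^esub>) bs = \<zero>\<^bsub>M\<^esub>"
  by (induction us arbitrary: z bs) (auto split: list.split simp: cube_vertex_mono)

lemma boundary_add:
  assumes "\<And>bs. c bs \<in> carrier M" "\<And>bs. c' bs \<in> carrier M"
  shows "boundary M us z (\<lambda>bs. c bs \<oplus>\<^bsub>M\<^esub> c' bs) bs = boundary M us z c bs \<oplus>\<^bsub>M\<^esub> boundary M us z c' bs"
  using assms
proof (induction us arbitrary: z c c' bs)
  case (Cons u us)
  note cl = boundary_closed[of "\<lambda>a. c (_ # a)"] boundary_closed[of "\<lambda>a. c' (_ # a)"]
  show ?case
    using Cons cl
    by (auto split: list.split simp: cube_vertex_mono monomial_r_distr M.minus_add M.a_ac)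
qed simp

lemma boundary_minus:
  assumes "\<And>bs. c bs \<in> carrier M"
  shows "boundary M us z (\<lambda>bs. \<ominus>\<^bsub>M\<^esub> c bs) bs = \<ominus>\<^bsub>M\<^esub> boundary M us z c bs"
proof -
  have "boundary M us z (\<lambda>bs. \<ominus>\<^bsub>M\<^esub> c bs) bs \<oplus>\<^bsub>M\<^esub> boundary M us z c bs = \<zero>\<^bsub>M\<^esub>"
    using assms boundary_add[of "\<lambda>bs. \<ominus>\<^bsub>M\<^esub> c bs" c us z bs] boundary_zero
    by (simp add: M.l_neg)
  then show ?thesis using assms by (simp add: M.minus_equality boundary_closed)
qed

text \<open>Restriction from the cube at \<open>z'\<close> to the cube at \<open>z\<close> is a
  chain map, by functoriality of \<open>M\<close>. This is what makes the mapping cone a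
  complex.\<close>

lemma boundary_monomial:
  assumes "\<And>bs. c bs \<in> carrier M" "z \<le> z'"
  shows "boundary M us z (\<lambda>bs. monomial 1 (cube_vertex z us bs) (cube_vertex z' us bs) \<odot>\<^bsub>M\<^esub> c bs) bs =
    monomial 1 (cube_vertex z us bs) (cube_vertex z' us bs) \<odot>\<^bsub>M\<^esub> boundary M us z' c bs"
  using assms
proof (induction us arbitrary: z z' c bs)
  case (Cons u us)
  have "sup z u \<le> sup z' u" using Cons.prems(2) by (simp add: le_supI1)
  then show ?case
    using Cons boundary_closed[of "\<lambda>a. c (_ # a)"]
    by (auto split: list.split simp: cube_vertex_mono monomial_r_distr monomial_smult_smult
        monomial_smult_minus)
qed (simp add: cube_vertex_mono)

text \<open>On the face with first bit \<open>False\<close> two mixed terms remain; they cancel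
  because restriction commutes with the boundary and the cone has a minus sign on the other
  face.\<close>

lemma boundary_boundary:
  assumes "\<And>bs. c bs \<in> carrier M"
  shows "boundary M us z (boundary M us z c) bs = \<zero>\<^bsub>M\<^esub>"
  using assms
proof (induction us arbitrary: z c bs)
  case (Cons u us)
  have c: "boundary M us z (\<lambda>a. c (b # a)) bs \<in> carrier M" for z b bs
    using Cons.prems by (intro boundary_closed)
  have "boundary M us z (\<lambda>bs. monomial 1 (cube_vertex z us bs) (cube_vertex (sup z u) us bs)
      \<odot>\<^bsub>M\<^esub> c (True # bs)) bs =
    monomial 1 (cube_vertex z us bs) (cube_vertex (sup z u) us bs)
      \<odot>\<^bsub>M\<^esub> boundary M us (sup z u) (\<lambda>a. c (True # a)) bs" for bs
    using Cons.prems by (intro boundary_monomial) auto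
  then show ?case
    using Cons c
    by (auto split: list.split simp: cube_vertex_mono boundary_add boundary_minus
        monomial_smult_minus M.r_neg)
qed simp

lemma boundary_chains_0: "c \<in> chains M us z 0 \<Longrightarrow> boundary M us z c bs = \<zero>\<^bsub>M\<^esub>"
  by (induction us arbitrary: z c bs)
    (auto split: list.split simp: chains_Cons cube_vertex_mono boundary_zero)

lemma boundary_chains:
  "c \<in> chains M us z (Suc j) \<Longrightarrow> boundary M us z c \<in> chains M us z j"
proof (induction us arbitrary: z c j)
  case Nil
  then show ?case by (auto simp: chains_def)
next
  case (Cons u us)
  let ?c = "\<lambda>b a. c (b # a)"
  have c: "?c False \<in> chains M us z (Suc j)" "?c True \<in> chains M us (sup z u) j"
    using Cons.prems by (auto simp: chains_Cons)
  have "(\<lambda>a. boundary M (u # us) z c (False # a)) \<in> chains M us z j"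
    unfolding chains_def mem_Collect_eq
  proof
    fix a
    have "boundary M us z (?c False) \<in> chains M us z j" by (rule Cons.IH) (rule c)
    then show "if length a = length us \<and> count_list a True = j
      then boundary M (u # us) z c (False # a) \<in> component M (cube_vertex z us a)
      else boundary M (u # us) z c (False # a) = \<zero>\<^bsub>M\<^esub>"
      using c(2) chains_closed[OF c(2)]
      by (auto simp: chains_def cube_vertex_mono intro!: component_add monomial_component)
  qed
  moreover have "(\<lambda>a. boundary M (u # us) z c (True # a)) \<in> chains M us (sup z u) i" if "j = Suc i" for i
    using Cons.IH[of "?c True" "sup z u" i] c that by (auto simp: chains_def component_minus)
  moreover have "boundary M (u # us) z c (True # a) = \<zero>\<^bsub>M\<^esub>" if "j = 0" for a
    using c that by (simp add: boundary_chains_0)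
  ultimately show ?case by (auto simp: chains_Cons split: nat.split)
qed

lemma chains_add:
  "c \<in> chains M us z j \<Longrightarrow> c' \<in> chains M us z j \<Longrightarrow> (\<lambda>bs. c bs \<oplus>\<^bsub>M\<^esub> c' bs) \<in> chains M us z j"
  by (auto simp: chains_def component_add)

lemma chains_minus: "c \<in> chains M us z j \<Longrightarrow> (\<lambda>bs. \<ominus>\<^bsub>M\<^esub> c bs) \<in> chains M us z j"
  by (auto simp: chains_def component_minus)

text \<open>A vertex selects at most \<open>length us\<close> directions. This is the source of the
  upper bound for the global dimension.\<close>

lemma chains_eq_zero:
  assumes "c \<in> chains M us z j" "length us < j"
  shows "c bs = \<zero>\<^bsub>M\<^esub>"
proof -
  have "count_list bs True \<le> length bs" by (rule count_le_length)
  then have "\<not> (length bs = length us \<and> count_list bs True = j)" using assms(2) by auto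
  then show ?thesis using assms(1) unfolding chains_def mem_Collect_eq by metis
qed

end

lemma lattice_incidence_moduleI:
  "left_module incidence_algebra M \<Longrightarrow> lattice_incidence_module M"
  by (simp add: lattice_incidence_module_def incidence_module_def)

lemma boundary_hom:
  assumes "left_module incidence_algebra M" "left_module incidence_algebra N"
    and "h \<in> left_module_hom incidence_algebra M N" "\<And>bs. c bs \<in> carrier M"
  shows "boundary N us z (\<lambda>bs. h (c bs)) bs = h (boundary M us z c bs)"
proof -
  interpret M: lattice_incidence_module M using assms(1) by (rule lattice_incidence_moduleI)
  interpret N: lattice_incidence_module N using assms(2) by (rule lattice_incidence_moduleI)
  note h = left_module_homD[OF assms(3)] left_module_hom_zero[OF assms(1-3)]
    left_module_hom_minus[OF assms(1-3)]
  show ?thesis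
    using assms(4)
  proof (induction us arbitrary: z c bs)
    case (Cons u us)
    then show ?case
      using M.boundary_closed[of "\<lambda>a. c (_ # a)"]
      by (auto split: list.split simp: h cube_vertex_mono monomial_carrier)
  qed (simp add: h)
qed

lemma chains_hom:
  assumes "left_module incidence_algebra M" "left_module incidence_algebra N"
    and "h \<in> left_module_hom incidence_algebra M N" "c \<in> chains M us z j"
  shows "(\<lambda>bs. h (c bs)) \<in> chains N us z j"
  using assms hom_component[OF assms(3)] left_module_hom_zero[OF assms(1-3)]
  by (auto simp: chains_def)

text \<open>Lifts are chosen vertex by vertex, and as zero outside degree \<open>j\<close>, so that
  the result is again a chain.\<close>

lemma chains_lift:
  assumes "left_module incidence_algebra M" "left_module incidence_algebra N"
    and "h \<in> left_module_hom incidence_algebra M N" "c \<in> chains N us z j"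
    and "\<And>bs. length bs = length us \<Longrightarrow> count_list bs True = j \<Longrightarrow>
      c bs \<in> h ` component M (cube_vertex z us bs)"
  obtains c' where "c' \<in> chains M us z j" "\<And>bs. h (c' bs) = c bs"
proof -
  let ?Q = "\<lambda>bs. length bs = length us \<and> count_list bs True = j"
  let ?P = "\<lambda>bs m. m \<in> component M (cube_vertex z us bs) \<and> h m = c bs"
  define c' where "c' bs = (if ?Q bs then SOME m. ?P bs m else \<zero>\<^bsub>M\<^esub>)" for bs
  have c': "?P bs (c' bs)" if "?Q bs" for bs
  proof -
    have "\<exists>m. ?P bs m" using assms(5)[of bs] that by force
    then show ?thesis unfolding c'_def using that someI_ex[of "?P bs"] by simp
  qed
  have "h (c' bs) = c bs" for bs
  proof (cases "?Q bs")
    case False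
    then have "c bs = \<zero>\<^bsub>N\<^esub>" using assms(4) unfolding chains_def mem_Collect_eq by metis
    moreover have "c' bs = \<zero>\<^bsub>M\<^esub>" unfolding c'_def using False by (rule if_not_P)
    ultimately show ?thesis using left_module_hom_zero[OF assms(1-3)] by simp
  qed (use c' in blast)
  moreover have "c' \<in> chains M us z j"
    unfolding chains_def using c' by (auto simp: c'_def)
  ultimately show ?thesis using that by blast
qed

section \<open>Vanishing of homology and dimension shifting\<close>

definition acyclic_at :: "('a::{finite,lattice} \<Rightarrow> 'a \<Rightarrow> 'k::field, 'm) module \<Rightarrow> 'a list \<Rightarrow> 'a \<Rightarrow> nat \<Rightarrow> bool" where
  "acyclic_at M us z j \<longleftrightarrow>
     (\<forall>c\<in>chains M us z j. (\<forall>bs. boundary M us z c bs = \<zero>\<^bsub>M\<^esub>) \<longrightarrow>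
        (\<exists>b\<in>chains M us z (Suc j). \<forall>bs. boundary M us z b bs = c bs))"

lemma acyclic_atE:
  assumes "acyclic_at M us z j" "c \<in> chains M us z j" "\<And>bs. boundary M us z c bs = \<zero>\<^bsub>M\<^esub>"
  obtains b where "b \<in> chains M us z (Suc j)" "\<And>bs. boundary M us z b bs = c bs"
  using assms unfolding acyclic_at_def by blast

text \<open>Homology is functorial, so that of a retract is a summand: a cycle is pushed to
  \<open>N\<close> by \<open>i\<close>, bounded there, and the bounding chain is brought back by
  \<open>r\<close>.\<close>

lemma acyclic_at_retract:
  assumes M: "left_module incidence_algebra M" and N: "left_module incidence_algebra N"
    and i: "i \<in> left_module_hom incidence_algebra M N"
    and r: "r \<in> left_module_hom incidence_algebra N M" "\<And>x. x \<in> carrier M \<Longrightarrow> r (i x) = x"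
    and ac: "acyclic_at N us z j"
  shows "acyclic_at M us z j"
  unfolding acyclic_at_def
proof (intro ballI impI)
  interpret M: lattice_incidence_module M using M by (rule lattice_incidence_moduleI)
  interpret N: lattice_incidence_module N using N by (rule lattice_incidence_moduleI)
  fix c assume c: "c \<in> chains M us z j" "\<forall>bs. boundary M us z c bs = \<zero>\<^bsub>M\<^esub>"
  note cc = M.chains_closed[OF c(1)]
  have "boundary N us z (\<lambda>bs. i (c bs)) bs = \<zero>\<^bsub>N\<^esub>" for bs
    using boundary_hom[OF M N i cc] c(2) left_module_hom_zero[OF M N i] by simp
  then obtain b where b: "b \<in> chains N us z (Suc j)" "\<And>bs. boundary N us z b bs = i (c bs)"
    using acyclic_atE[OF ac chains_hom[OF M N i c(1)]] by metis
  have "boundary M us z (\<lambda>bs. r (b bs)) bs = c bs" for bs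
    using boundary_hom[OF N M r(1) N.chains_closed[OF b(1)]] b(2) r(2) cc by simp
  then show "\<exists>b\<in>chains M us z (Suc j). \<forall>bs. boundary M us z b bs = c bs"
    using chains_hom[OF N M r(1) b(1)] by blast
qed

text \<open>Any preimage can be moved into the component by the idempotent p_x^x, which commutes
  with \<open>f\<close> and fixes \<open>n\<close>.\<close>

lemma hom_component_surj:
  assumes "left_module incidence_algebra M" "left_module incidence_algebra N"
    and f: "f \<in> left_module_hom incidence_algebra M N"
    and n: "n \<in> component N x" "n \<in> f ` carrier M"
  shows "n \<in> f ` component M x"
proof -
  interpret M: incidence_module M using assms(1) by (rule incidence_module.intro)
  obtain m where m: "m \<in> carrier M" "n = f m" using n(2) by blast
  have "f (monomial 1 x x \<odot>\<^bsub>M\<^esub> m) = monomial 1 x x \<odot>\<^bsub>N\<^esub> n"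
    using m left_module_homD(3)[OF f] by (simp add: monomial_carrier)
  also have "\<dots> = n" using n(1) by (simp add: component_def)
  finally show ?thesis using m by (intro image_eqI[of _ _ "monomial 1 x x \<odot>\<^bsub>M\<^esub> m"]) (auto simp: M.monomial_component)
qed

section \<open>Homology along the short exact sequence of a kernel\<close>

locale lattice_module_hom =
  fixes P :: "('p::{finite,lattice} \<Rightarrow> 'p \<Rightarrow> 'k::field, 'm) module"
    and M :: "('p \<Rightarrow> 'p \<Rightarrow> 'k, 'n) module" and f :: "'m \<Rightarrow> 'n"
  assumes P: "left_module incidence_algebra P" and M: "left_module incidence_algebra M"
    and f: "f \<in> left_module_hom incidence_algebra P M"
begin

sublocale P: lattice_incidence_module P using P by (rule lattice_incidence_moduleI)

sublocale M: lattice_incidence_module M using M by (rule lattice_incidence_moduleI)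

abbreviation "K \<equiv> kernel_module P M f"

lemma K: "left_module incidence_algebra K"
  using P M f by (rule left_module_kernel_module)

sublocale K: lattice_incidence_module K using K by (rule lattice_incidence_moduleI)

lemma chains_kernel_iff:
  "c \<in> chains K us z j \<longleftrightarrow> c \<in> chains P us z j \<and> (\<forall>bs. f (c bs) = \<zero>\<^bsub>M\<^esub>)"
proof
  assume c: "c \<in> chains K us z j"
  then have "f (c bs) = \<zero>\<^bsub>M\<^esub>" for bs
    using K.chains_closed[OF c, of bs] by (simp add: carrier_kernel_module)
  then show "c \<in> chains P us z j \<and> (\<forall>bs. f (c bs) = \<zero>\<^bsub>M\<^esub>)"
    using chains_hom[OF K P kernel_module_incl c] by simp
qed (simp add: chains_def component_kernel_module)

lemma boundary_kernel:
  assumes "c \<in> chains K us z j"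
  shows "boundary K us z c bs = boundary P us z c bs"
  using boundary_hom[OF K P kernel_module_incl K.chains_closed[OF assms]] by simp

lemma boundary_f:
  assumes "c \<in> chains P us z j"
  shows "boundary M us z (\<lambda>bs. f (c bs)) bs = f (boundary P us z c bs)"
  using boundary_hom[OF P M f P.chains_closed[OF assms]] .

lemma surj_chains_lift:
  assumes "f ` carrier P = carrier M" "c \<in> chains M us z j"
  obtains c' where "c' \<in> chains P us z j" "\<And>bs. f (c' bs) = c bs"
proof (rule chains_lift[OF P M f assms(2)])
  fix bs :: "bool list"
  assume bs: "length bs = length us" "count_list bs True = j"
  then have "c bs \<in> component M (cube_vertex z us bs)" using assms(2) by (simp add: chains_def)
  then show "c bs \<in> f ` component P (cube_vertex z us bs)"
    using assms(1) by (intro hom_component_surj[OF P M f]) (auto dest: component_carrier)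
qed (use that in blast)

text \<open>The image of \<open>e\<close> is a cycle in \<open>M\<close>; the boundary of a lifted
  filling of it is subtracted from \<open>e\<close>, which lands in the kernel and still bounds
  \<open>c\<close>. Only the given \<open>c\<close> has to bound in \<open>P\<close>, so the lemma
  also serves degree 0, where \<open>P\<close> may have homology.\<close>

lemma kernel_boundary_lift:
  assumes surj: "f ` carrier P = carrier M" and ac: "acyclic_at M us z (Suc j)"
    and c: "c \<in> chains K us z j"
    and e: "e \<in> chains P us z (Suc j)" "\<And>bs. boundary P us z e bs = c bs"
  shows "\<exists>b\<in>chains K us z (Suc j). \<forall>bs. boundary K us z b bs = c bs"
proof -
  have "boundary M us z (\<lambda>bs. f (e bs)) bs = \<zero>\<^bsub>M\<^esub>" for bs
    using boundary_f[OF e(1)] e(2) c by (simp add: chains_kernel_iff)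
  then obtain g where g: "g \<in> chains M us z (Suc (Suc j))" "\<And>bs. boundary M us z g bs = f (e bs)"
    using acyclic_atE[OF ac chains_hom[OF P M f e(1)]] by metis
  obtain g' where g': "g' \<in> chains P us z (Suc (Suc j))" "\<And>bs. f (g' bs) = g bs"
    using surj_chains_lift[OF surj g(1)] by blast
  let ?d = "boundary P us z g'"
  have d: "?d \<in> chains P us z (Suc j)" using g'(1) by (rule P.boundary_chains)
  have fd: "f (?d bs) = f (e bs)" for bs
    using boundary_f[OF g'(1), of bs] g'(2) g(2) by simp
  define b where "b bs = e bs \<oplus>\<^bsub>P\<^esub> \<ominus>\<^bsub>P\<^esub> ?d bs" for bs
  have bP: "b \<in> chains P us z (Suc j)"
    unfolding b_def using e(1) d by (intro P.chains_add P.chains_minus)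
  note ec = P.chains_closed[OF e(1)] and dc = P.chains_closed[OF d]
  have "f (b bs) = \<zero>\<^bsub>M\<^esub>" for bs
    unfolding b_def using ec dc fd left_module_homD[OF f] left_module_hom_minus[OF P M f]
    by (simp add: M.M.r_neg)
  then have bK: "b \<in> chains K us z (Suc j)" using bP by (simp add: chains_kernel_iff)
  have "boundary P us z b bs = c bs" for bs
  proof -
    have "boundary P us z ?d bs = \<zero>\<^bsub>P\<^esub>" using P.chains_closed[OF g'(1)] by (rule P.boundary_boundary)
    then show ?thesis
      unfolding b_def using ec dc e(2)
        P.chains_closed[of c us z j] c
      by (simp add: P.boundary_add P.boundary_minus P.boundary_closed P.M.add.inv_one chains_kernel_iff)
  qed
  then show ?thesis using bK boundary_kernel[OF bK] by auto
qed

text \<open>Exactness of H_(j+1)(M) -> H_j(K) -> H_j(P).\<close>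

lemma acyclic_at_kernel:
  assumes surj: "f ` carrier P = carrier M"
    and P: "acyclic_at P us z j" and M: "acyclic_at M us z (Suc j)"
  shows "acyclic_at K us z j"
  unfolding acyclic_at_def
proof (intro ballI impI)
  fix c assume c: "c \<in> chains K us z j" "\<forall>bs. boundary K us z c bs = \<zero>\<^bsub>K\<^esub>"
  then have "c \<in> chains P us z j" "boundary P us z c bs = \<zero>\<^bsub>P\<^esub>" for bs
    using boundary_kernel[OF c(1)] by (auto simp: chains_kernel_iff)
  then obtain e where "e \<in> chains P us z (Suc j)" "\<And>bs. boundary P us z e bs = c bs"
    using acyclic_atE[OF P] by metis
  then show "\<exists>b\<in>chains K us z (Suc j). \<forall>bs. boundary K us z b bs = c bs"
    using kernel_boundary_lift[OF surj M c(1)] by blast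
qed

text \<open>Exactness of H_(j+1)(P) -> H_(j+1)(M) -> H_j(K): the boundary of a lifted cycle lies in
  the kernel, is filled there, and the filling corrects the lift to a cycle of
  \<open>P\<close>.\<close>

lemma acyclic_at_image:
  assumes surj: "f ` carrier P = carrier M"
    and acP: "acyclic_at P us z (Suc j)" and acK: "acyclic_at K us z j"
  shows "acyclic_at M us z (Suc j)"
  unfolding acyclic_at_def
proof (intro ballI impI)
  fix c assume c: "c \<in> chains M us z (Suc j)" "\<forall>bs. boundary M us z c bs = \<zero>\<^bsub>M\<^esub>"
  obtain c' where c': "c' \<in> chains P us z (Suc j)" "\<And>bs. f (c' bs) = c bs"
    using surj_chains_lift[OF surj c(1)] by blast
  let ?d = "boundary P us z c'"
  have "f (?d bs) = \<zero>\<^bsub>M\<^esub>" for bs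
    using boundary_f[OF c'(1), of bs] c'(2) c(2) by simp
  then have dK: "?d \<in> chains K us z j"
    using P.boundary_chains[OF c'(1)] by (simp add: chains_kernel_iff)
  have "boundary K us z ?d bs = \<zero>\<^bsub>K\<^esub>" for bs
    using boundary_kernel[OF dK] P.boundary_boundary P.chains_closed[OF c'(1)] by simp
  then obtain b where b: "b \<in> chains K us z (Suc j)" "\<And>bs. boundary K us z b bs = ?d bs"
    using acyclic_atE[OF acK dK] by metis
  have bP: "b \<in> chains P us z (Suc j)" and fb: "\<And>bs. f (b bs) = \<zero>\<^bsub>M\<^esub>"
    using b(1) by (auto simp: chains_kernel_iff)
  note bc = P.chains_closed[OF bP] and cc = P.chains_closed[OF c'(1)]
  define e where "e bs = c' bs \<oplus>\<^bsub>P\<^esub> \<ominus>\<^bsub>P\<^esub> b bs" for bs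
  have e: "e \<in> chains P us z (Suc j)"
    unfolding e_def using bP c'(1) by (intro P.chains_add P.chains_minus)
  have "boundary P us z e bs = \<zero>\<^bsub>P\<^esub>" for bs
    unfolding e_def using bc cc b(2) boundary_kernel[OF b(1)]
    by (simp add: P.boundary_add P.boundary_minus P.boundary_closed P.M.r_neg)
  then obtain g where g: "g \<in> chains P us z (Suc (Suc j))" "\<And>bs. boundary P us z g bs = e bs"
    using acyclic_atE[OF acP e] by metis
  have "boundary M us z (\<lambda>bs. f (g bs)) bs = c bs" for bs
    using boundary_f[OF g(1)] g(2) bc cc fb c'(2) left_module_homD[OF f]
      left_module_hom_minus[OF P M f] M.chains_closed[OF c(1)]
    by (simp add: e_def)
  then show "\<exists>b\<in>chains M us z (Suc (Suc j)). \<forall>bs. boundary M us z b bs = c bs"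
    using chains_hom[OF P M f g(1)] by blast
qed

end

text \<open>The next two lemmas say that the projective dimension of \<open>M\<close> is at most \<open>n\<close> if and only if
  the homology of \<open>chains M (us x) x\<close> vanishes above degree \<open>n\<close> for all \<open>x\<close>.\<close>

lemma projective_resolution_imp_acyclic_at:
  fixes M :: "('p::{finite,lattice} \<Rightarrow> 'p \<Rightarrow> 'k::field, 'm) module"
  assumes proj: "\<And>(P :: ('p \<Rightarrow> 'p \<Rightarrow> 'k, 'm) module) j.
      projective_module incidence_algebra P \<Longrightarrow> 0 < j \<Longrightarrow> acyclic_at P us z j"
    and "left_module incidence_algebra M" "projective_resolution incidence_algebra M n C d" "n < j"
  shows "acyclic_at M us z j"
  using assms(2-)
proof (induction n arbitrary: M C d j)
  case 0
  note res = projective_resolution_0D[OF "0.prems"(2,1)]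
  have C: "left_module incidence_algebra (C 1)" using res(1) by (simp add: projective_module_def)
  \<comment> \<open>Here \<open>M\<close> is isomorphic to the projective module \<open>C 1\<close>,
    in particular a retract of it.\<close>
  let ?i = "inv_into (carrier (C 1)) (d 0)"
  have "?i \<in> left_module_hom incidence_algebra M (C 1)"
    using res(2,3) C by (rule left_module_hom_inverse)
  moreover have "d 0 (?i x) = x" if "x \<in> carrier M" for x
    using res(3) that by (simp add: bij_betw_inv_into_right)
  ultimately show ?case
    using acyclic_at_retract[OF "0.prems"(1) C] res(2) proj[OF res(1)] "0.prems"(3) by blast
next
  case (Suc n)
  note res = projective_resolution_SucD[OF Suc.prems(2)]
  have C: "left_module incidence_algebra (C 1)" using res(1) by (simp add: projective_module_def)
  interpret h: lattice_module_hom "C 1" M "d 0"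
    using C Suc.prems(1) res(2) by (rule lattice_module_hom.intro)
  obtain i where i: "j = Suc i" "n < i" using Suc.prems(3) by (cases j) auto
  have "acyclic_at h.K us z i" using Suc.IH[OF h.K _ i(2)] res(4) by blast
  then show ?case using h.acyclic_at_image[OF res(3)] proj[OF res(1)] i(1) by blast
qed

lemma acyclic_at_imp_projective_resolution:
  fixes M :: "('p::{finite,lattice} \<Rightarrow> 'p \<Rightarrow> 'k::field, 'm) module"
  assumes proj: "\<And>(P :: ('p \<Rightarrow> 'p \<Rightarrow> 'k, 'm) module) x j.
      projective_module incidence_algebra P \<Longrightarrow> 0 < j \<Longrightarrow> acyclic_at P (us x) x j"
    and cover: "\<And>M :: ('p \<Rightarrow> 'p \<Rightarrow> 'k, 'm) module. left_module incidence_algebra M \<Longrightarrow>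
      \<exists>(P :: ('p \<Rightarrow> 'p \<Rightarrow> 'k, 'm) module) f.
        projective_module incidence_algebra P \<and> f \<in> left_module_hom incidence_algebra P M \<and>
        f ` carrier P = carrier M \<and>
        ((\<forall>x. acyclic_at M (us x) x 1) \<longrightarrow> (\<forall>p\<in>carrier P. f p = \<zero>\<^bsub>M\<^esub> \<longrightarrow> p = \<zero>\<^bsub>P\<^esub>))"
    and "left_module incidence_algebra M" "\<And>x j. n < j \<Longrightarrow> acyclic_at M (us x) x j"
  shows "\<exists>C d. projective_resolution incidence_algebra M n C d"
  using assms(3-)
proof (induction n arbitrary: M)
  case 0
  \<comment> \<open>Degree 1 already lies above 0, so the homology hypothesis makes the cover
    injective.\<close>
  obtain P :: "('p \<Rightarrow> 'p \<Rightarrow> 'k, 'm) module" and f where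
    P: "projective_module incidence_algebra P" "f \<in> left_module_hom incidence_algebra P M"
      "f ` carrier P = carrier M" "\<And>p. p \<in> carrier P \<Longrightarrow> f p = \<zero>\<^bsub>M\<^esub> \<Longrightarrow> p = \<zero>\<^bsub>P\<^esub>"
    using cover[OF "0.prems"(1)] "0.prems"(2) by (metis zero_less_one)
  have "bij_betw f (carrier P) (carrier M)"
    using P "0.prems"(1) by (intro bij_betw_left_module_hom) (auto simp: projective_module_def)
  then show ?case using P "0.prems"(1) by (intro projective_resolution_of_projective)
next
  case (Suc n)
  obtain P :: "('p \<Rightarrow> 'p \<Rightarrow> 'k, 'm) module" and f where
    P: "projective_module incidence_algebra P" "f \<in> left_module_hom incidence_algebra P M"
      "f ` carrier P = carrier M"
    using cover[OF Suc.prems(1)] by blast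
  interpret h: lattice_module_hom P M f
    using P Suc.prems(1) by (intro lattice_module_hom.intro) (auto simp: projective_module_def)
  \<comment> \<open>Passing to the kernel lowers the degree by one: \<open>M\<close> is acyclic in
    degree \<open>Suc j\<close>, which exceeds \<open>Suc n\<close>, and \<open>P\<close> in degree
    \<open>j\<close>, which is positive.\<close>
  have "acyclic_at h.K (us x) x j" if "n < j" for x j
    using h.acyclic_at_kernel[OF P(3)] proj[OF P(1)] Suc.prems(2)[of "Suc j"] that by simp
  then have "\<exists>C d. projective_resolution incidence_algebra h.K n C d" using Suc.IH[OF h.K] by blast
  then show ?case using projective_resolution_Suc[OF P] by blast
qed

section \<open>Subspaces of the components\<close>

definition subspace_at :: "('a::{finite,order} \<Rightarrow> 'a \<Rightarrow> 'k::field, 'm) module \<Rightarrow> 'a \<Rightarrow> 'm set \<Rightarrow> bool" where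
  "subspace_at M x W \<longleftrightarrow> W \<subseteq> component M x \<and> \<zero>\<^bsub>M\<^esub> \<in> W \<and>
     (\<forall>v\<in>W. \<forall>w\<in>W. v \<oplus>\<^bsub>M\<^esub> w \<in> W) \<and> (\<forall>k. \<forall>w\<in>W. monomial k x x \<odot>\<^bsub>M\<^esub> w \<in> W)"

definition linear_at :: "('a::{finite,order} \<Rightarrow> 'a \<Rightarrow> 'k::field, 'm) module \<Rightarrow> 'm set \<Rightarrow>
    ('a \<Rightarrow> 'a \<Rightarrow> 'k, 'n) module \<Rightarrow> 'a \<Rightarrow> ('m \<Rightarrow> 'n) \<Rightarrow> bool" where
  "linear_at M W N x g \<longleftrightarrow> (\<forall>v\<in>W. g v \<in> component N x) \<and>
     (\<forall>v\<in>W. \<forall>w\<in>W. g (v \<oplus>\<^bsub>M\<^esub> w) = g v \<oplus>\<^bsub>N\<^esub> g w) \<and>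
     (\<forall>k. \<forall>v\<in>W. g (monomial k x x \<odot>\<^bsub>M\<^esub> v) = monomial k x x \<odot>\<^bsub>N\<^esub> g v)"

lemma subspace_atD:
  assumes "subspace_at M x W"
  shows "v \<in> W \<Longrightarrow> v \<in> component M x" "v \<in> W \<Longrightarrow> v \<in> carrier M" "\<zero>\<^bsub>M\<^esub> \<in> W"
    "v \<in> W \<Longrightarrow> w \<in> W \<Longrightarrow> v \<oplus>\<^bsub>M\<^esub> w \<in> W" "v \<in> W \<Longrightarrow> monomial k x x \<odot>\<^bsub>M\<^esub> v \<in> W"
  using assms by (auto simp: subspace_at_def dest: component_carrier)

lemma linear_atD:
  assumes "linear_at M W N x g"
  shows "v \<in> W \<Longrightarrow> g v \<in> component N x" "v \<in> W \<Longrightarrow> g v \<in> carrier N"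
    "v \<in> W \<Longrightarrow> w \<in> W \<Longrightarrow> g (v \<oplus>\<^bsub>M\<^esub> w) = g v \<oplus>\<^bsub>N\<^esub> g w"
    "v \<in> W \<Longrightarrow> g (monomial k x x \<odot>\<^bsub>M\<^esub> v) = monomial k x x \<odot>\<^bsub>N\<^esub> g v"
  using assms by (auto simp: linear_at_def dest: component_carrier)

context incidence_module
begin

lemma component_smult_one: "m \<in> component M x \<Longrightarrow> monomial 1 x x \<odot>\<^bsub>M\<^esub> m = m"
  by (simp add: component_def)

lemma component_minus_eq:
  assumes m: "m \<in> component M x"
  shows "monomial (- 1) x x \<odot>\<^bsub>M\<^esub> m = \<ominus>\<^bsub>M\<^esub> m"
proof -
  have mc: "m \<in> carrier M" using m by (rule component_carrier)
  have "monomial (- 1) x x \<odot>\<^bsub>M\<^esub> m \<oplus>\<^bsub>M\<^esub> m = \<zero>\<^bsub>M\<^esub>"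
    using monomial_l_distr[of x x m "- 1" 1] m mc by (simp add: component_smult_one)
  then show ?thesis using mc by (simp add: M.minus_equality)
qed

lemma subspace_at_minus: "subspace_at M x W \<Longrightarrow> w \<in> W \<Longrightarrow> \<ominus>\<^bsub>M\<^esub> w \<in> W"
  by (metis component_minus_eq subspace_atD(1,5))

lemma subspace_at_finsum:
  assumes W: "subspace_at M x W" and "finite I" "\<And>i. i \<in> I \<Longrightarrow> g i \<in> W"
  shows "(\<Oplus>\<^bsub>M\<^esub>i\<in>I. g i) \<in> W"
  using assms(2,3)
proof (induction I rule: finite_induct)
  case (insert i I)
  then have "(\<Oplus>\<^bsub>M\<^esub>j\<in>insert i I. g j) = g i \<oplus>\<^bsub>M\<^esub> (\<Oplus>\<^bsub>M\<^esub>j\<in>I. g j)"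
    using subspace_atD(2)[OF W] by (intro M.finsum_insert) auto
  then show ?case using insert subspace_atD(4)[OF W] by simp
qed (simp add: subspace_atD(3)[OF W])

text \<open>Zorn's lemma for the subspaces that meet \<open>R\<close> trivially, as the components
  may have infinite dimension.\<close>

lemma subspace_at_complement:
  assumes R: "subspace_at M x R"
  obtains V where "subspace_at M x V" "V \<inter> R = {\<zero>\<^bsub>M\<^esub>}"
    "\<And>m. m \<in> component M x \<Longrightarrow> \<exists>v\<in>V. \<exists>r\<in>R. m = v \<oplus>\<^bsub>M\<^esub> r"
proof -
  define \<S> where "\<S> = {V. subspace_at M x V \<and> V \<inter> R \<subseteq> {\<zero>\<^bsub>M\<^esub>}}"
  have "{\<zero>\<^bsub>M\<^esub>} \<in> \<S>" by (auto simp: \<S>_def subspace_at_def)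
  then have "\<S> \<noteq> {}" by blast
  moreover have "\<Union>\<C> \<in> \<S>" if C: "\<C> \<noteq> {}" "subset.chain \<S> \<C>" for \<C>
  proof -
    have mem: "subspace_at M x V" "V \<inter> R \<subseteq> {\<zero>\<^bsub>M\<^esub>}" if "V \<in> \<C>" for V
      using C(2) that by (auto simp: subset.chain_def \<S>_def)
    have add: "v \<oplus>\<^bsub>M\<^esub> w \<in> \<Union>\<C>" if "v \<in> V" "V \<in> \<C>" "w \<in> W" "W \<in> \<C>" for v V w W
    proof -
      have "V \<subseteq> W \<or> W \<subseteq> V" using C(2) that by (auto simp: subset.chain_def)
      then show ?thesis
        using that subspace_atD(4)[OF mem(1)] by blast
    qed
    have "subspace_at M x (\<Union>\<C>)"
      unfolding subspace_at_def
    proof (intro conjI ballI allI)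
      show "\<Union>\<C> \<subseteq> component M x" using subspace_atD(1)[OF mem(1)] by blast
      show "\<zero>\<^bsub>M\<^esub> \<in> \<Union>\<C>" using C(1) subspace_atD(3)[OF mem(1)] by blast
      show "v \<oplus>\<^bsub>M\<^esub> w \<in> \<Union>\<C>" if "v \<in> \<Union>\<C>" "w \<in> \<Union>\<C>" for v w using that add by blast
      show "monomial k x x \<odot>\<^bsub>M\<^esub> w \<in> \<Union>\<C>" if "w \<in> \<Union>\<C>" for k w
        using that subspace_atD(5)[OF mem(1)] by blast
    qed
    moreover have "\<Union>\<C> \<inter> R \<subseteq> {\<zero>\<^bsub>M\<^esub>}" using mem(2) by blast
    ultimately show ?thesis by (simp add: \<S>_def)
  qed
  ultimately obtain V where V: "V \<in> \<S>" and Vmax: "\<And>W. W \<in> \<S> \<Longrightarrow> V \<subseteq> W \<Longrightarrow> W = V"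
    using subset_Zorn_nonempty[of \<S>] by blast
  have Vs: "subspace_at M x V" and VR: "V \<inter> R \<subseteq> {\<zero>\<^bsub>M\<^esub>}" using V by (auto simp: \<S>_def)
  note sV = subspace_atD[OF Vs] and sR = subspace_atD[OF R]
  let ?s = "\<lambda>k m. monomial k x x \<odot>\<^bsub>M\<^esub> m"
  have "\<exists>v\<in>V. \<exists>r\<in>R. m = v \<oplus>\<^bsub>M\<^esub> r" if m: "m \<in> component M x" for m
  proof (rule ccontr)
    assume no: "\<not> ?thesis"
    have mc: "m \<in> carrier M" using m by (rule component_carrier)
    \<comment> \<open>The span of \<open>V\<close> and \<open>m\<close>. In an element of
      \<open>R\<close>, a nonzero coefficient of \<open>m\<close> could be inverted, which would
      write \<open>m\<close> as a sum from \<open>V\<close> and \<open>R\<close>.\<close>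
    define W where "W = {v \<oplus>\<^bsub>M\<^esub> ?s k m |v k. v \<in> V}"
    have "subspace_at M x W"
      unfolding subspace_at_def
    proof (intro conjI ballI allI)
      show "W \<subseteq> component M x"
        unfolding W_def using sV(1) mc by (auto intro!: component_add monomial_component)
      show "\<zero>\<^bsub>M\<^esub> \<in> W"
        unfolding W_def using sV(3) mc by (intro CollectI exI[of _ "\<zero>\<^bsub>M\<^esub>"] exI[of _ 0]) simp
      show "w \<oplus>\<^bsub>M\<^esub> w' \<in> W" if ww': "w \<in> W" "w' \<in> W" for w w'
      proof -
        obtain v k v' k' where w: "w = v \<oplus>\<^bsub>M\<^esub> ?s k m" "w' = v' \<oplus>\<^bsub>M\<^esub> ?s k' m" "v \<in> V" "v' \<in> V"
          using ww' unfolding W_def by blast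
        then have "w \<oplus>\<^bsub>M\<^esub> w' = (v \<oplus>\<^bsub>M\<^esub> v') \<oplus>\<^bsub>M\<^esub> ?s (k + k') m"
          using sV(2) mc by (simp add: monomial_l_distr M.a_ac)
        then show ?thesis unfolding W_def using sV(4) w by blast
      qed
      show "?s l w \<in> W" if wW: "w \<in> W" for l w
      proof -
        obtain v k where w: "w = v \<oplus>\<^bsub>M\<^esub> ?s k m" "v \<in> V" using wW unfolding W_def by blast
        then have "?s l w = ?s l v \<oplus>\<^bsub>M\<^esub> ?s (l * k) m"
          using sV(2) mc by (simp add: monomial_r_distr monomial_smult_smult)
        then show ?thesis unfolding W_def using sV(5) w by blast
      qed
    qed
    moreover have "W \<inter> R \<subseteq> {\<zero>\<^bsub>M\<^esub>}"
    proof
      fix r assume "r \<in> W \<inter> R"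
      then obtain v k where r: "r \<in> R" "r = v \<oplus>\<^bsub>M\<^esub> ?s k m" "v \<in> V" by (auto simp: W_def)
      show "r \<in> {\<zero>\<^bsub>M\<^esub>}"
      proof (cases "k = 0")
        case True
        then have "r = v" using r sV(2) mc by simp
        then show ?thesis using r VR by blast
      next
        case False
        have "?s (inverse k) r = ?s (inverse k) v \<oplus>\<^bsub>M\<^esub> m"
          using False r sV(2) mc m
          by (simp add: monomial_r_distr monomial_smult_smult component_smult_one)
        then have "m = (\<ominus>\<^bsub>M\<^esub> ?s (inverse k) v) \<oplus>\<^bsub>M\<^esub> ?s (inverse k) r"
          using r sV(2) mc by (simp add: M.l_neg flip: M.a_assoc)
        then show ?thesis
          using no r sV(5) sR(5) subspace_at_minus[OF Vs] by blast
      qed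
    qed
    ultimately have "W \<in> \<S>" by (simp add: \<S>_def)
    moreover have "V \<subseteq> W"
    proof
      fix v assume "v \<in> V"
      then show "v \<in> W"
        unfolding W_def using sV(2) mc by (intro CollectI exI[of _ v] exI[of _ 0]) simp
    qed
    ultimately have "W = V" by (rule Vmax)
    moreover have "m \<in> W"
      unfolding W_def using sV(3) mc m
      by (intro CollectI exI[of _ "\<zero>\<^bsub>M\<^esub>"] exI[of _ 1]) (simp add: component_smult_one)
    ultimately show False using no sR(3) mc by (metis M.r_zero)
  qed
  moreover have "V \<inter> R = {\<zero>\<^bsub>M\<^esub>}" using VR sV(3) sR(3) by blast
  ultimately show ?thesis using that Vs by blast
qed

end

text \<open>On a complement \<open>U\<close> of the kernel, \<open>f\<close> is a bijection onto the
  component of \<open>Y\<close>; the lift is \<open>g\<close> followed by its inverse.\<close>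

lemma linear_at_lift:
  assumes X: "left_module incidence_algebra X" and Y: "left_module incidence_algebra Y"
    and f: "f \<in> left_module_hom incidence_algebra X Y" "f ` carrier X = carrier Y"
    and W: "subspace_at M x W" and g: "linear_at M W Y x g"
  obtains g' where "linear_at M W X x g'" "\<And>v. v \<in> W \<Longrightarrow> f (g' v) = g v"
proof -
  interpret X: incidence_module X using X by (rule incidence_module.intro)
  interpret Y: incidence_module Y using Y by (rule incidence_module.intro)
  note hf = left_module_homD[OF f(1)] and sW = subspace_atD[OF W] and lg = linear_atD[OF g]
  have fmono: "f (monomial k x x \<odot>\<^bsub>X\<^esub> m) = monomial k x x \<odot>\<^bsub>Y\<^esub> f m" if "m \<in> carrier X" for k m
    using that by (simp add: hf(3) monomial_carrier)
  define N where "N = {m \<in> component X x. f m = \<zero>\<^bsub>Y\<^esub>}"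
  have "subspace_at X x N"
    unfolding subspace_at_def N_def
    using left_module_hom_zero[OF X Y f(1)]
    by (auto simp: X.component_add hf component_carrier X.monomial_component fmono)
  then obtain U where U: "subspace_at X x U" "U \<inter> N = {\<zero>\<^bsub>X\<^esub>}"
    "\<And>m. m \<in> component X x \<Longrightarrow> \<exists>u\<in>U. \<exists>n\<in>N. m = u \<oplus>\<^bsub>X\<^esub> n"
    by (rule X.subspace_at_complement) (rule that)
  note sU = subspace_atD[OF U(1)]
  have "\<exists>u\<in>U. f u = y" if y: "y \<in> component Y x" for y
  proof -
    have "y \<in> f ` component X x"
      using hom_component_surj[OF X Y f(1) y] f(2) component_carrier[OF y] by simp
    then obtain m where m: "m \<in> component X x" "y = f m" by blast
    then obtain u n where un: "u \<in> U" "n \<in> N" "m = u \<oplus>\<^bsub>X\<^esub> n" using U(3) by blast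
    then have "n \<in> carrier X" "f n = \<zero>\<^bsub>Y\<^esub>" by (auto simp: N_def dest: component_carrier)
    then have "f m = f u" using un sU(2) hf by simp
    then show ?thesis using m un by metis
  qed
  then obtain h where h: "\<And>y. y \<in> component Y x \<Longrightarrow> h y \<in> U" "\<And>y. y \<in> component Y x \<Longrightarrow> f (h y) = y"
    by metis
  have eqI: "u = u'" if u: "u \<in> U" "u' \<in> U" "f u = f u'" for u u'
  proof -
    have uc: "u \<in> carrier X" "u' \<in> carrier X" using u sU by auto
    have in_U: "u \<oplus>\<^bsub>X\<^esub> \<ominus>\<^bsub>X\<^esub> u' \<in> U" using u sU(4) X.subspace_at_minus[OF U(1)] by blast
    have "f (u \<oplus>\<^bsub>X\<^esub> \<ominus>\<^bsub>X\<^esub> u') = \<zero>\<^bsub>Y\<^esub>"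
      using u uc hf left_module_hom_minus[OF X Y f(1)] by (simp add: Y.M.r_neg)
    then have "u \<oplus>\<^bsub>X\<^esub> \<ominus>\<^bsub>X\<^esub> u' \<in> U \<inter> N" using in_U sU(1) by (simp add: N_def)
    then have "u \<oplus>\<^bsub>X\<^esub> \<ominus>\<^bsub>X\<^esub> u' = \<zero>\<^bsub>X\<^esub>" using U(2) by blast
    then show ?thesis using uc X.M.minus_equality[of u "\<ominus>\<^bsub>X\<^esub> u'"] by simp
  qed
  have "linear_at M W X x (\<lambda>v. h (g v))"
    unfolding linear_at_def
  proof (intro conjI ballI allI)
    show "h (g v) \<in> component X x" if "v \<in> W" for v using that h(1) lg(1) sU(1) by blast
    show "h (g (v \<oplus>\<^bsub>M\<^esub> w)) = h (g v) \<oplus>\<^bsub>X\<^esub> h (g w)" if "v \<in> W" "w \<in> W" for v w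
      using that h lg sU sW hf(2) by (intro eqI) (auto simp: Y.component_add)
    show "h (g (monomial k x x \<odot>\<^bsub>M\<^esub> v)) = monomial k x x \<odot>\<^bsub>X\<^esub> h (g v)" if "v \<in> W" for k v
      using that h lg sU sW by (intro eqI) (auto simp: fmono Y.monomial_component)
  qed
  then show ?thesis using that h(2) lg(1) by blast
qed

section \<open>Modules induced from vector spaces\<close>

text \<open>\<open>induced_module M V\<close> is $\bigoplus_y A p_y^y \otimes_K V_y$: the entry \<open>\<phi> x y\<close> is the coefficient in
  $V_y$ of the basis element $p_y^x$.\<close>

definition induced_module :: "('a::{finite,order} \<Rightarrow> 'a \<Rightarrow> 'k::field, 'm) module \<Rightarrow> ('a \<Rightarrow> 'm set) \<Rightarrow>
    ('a \<Rightarrow> 'a \<Rightarrow> 'k, 'a \<Rightarrow> 'a \<Rightarrow> 'm) module" where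
  "induced_module M V =
     \<lparr>carrier = {\<phi>. \<forall>x y. if x \<le> y then \<phi> x y \<in> V y else \<phi> x y = \<zero>\<^bsub>M\<^esub>},
      mult = undefined, one = undefined, zero = (\<lambda>x y. \<zero>\<^bsub>M\<^esub>),
      add = (\<lambda>\<phi> \<psi> x y. \<phi> x y \<oplus>\<^bsub>M\<^esub> \<psi> x y),
      smult = (\<lambda>a \<phi> x y. \<Oplus>\<^bsub>M\<^esub>z\<in>UNIV. monomial (a x z) y y \<odot>\<^bsub>M\<^esub> \<phi> z y)\<rparr>"

locale component_subspaces =
  incidence_module M
  for M :: "('p::{finite,order} \<Rightarrow> 'p \<Rightarrow> 'k::field, 'm) module" +
  fixes V :: "'p \<Rightarrow> 'm set"
  assumes V: "\<And>y. subspace_at M y (V y)"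
begin

abbreviation "Q \<equiv> induced_module M V"

lemma carrier_Q: "\<phi> \<in> carrier Q \<longleftrightarrow> (\<forall>x y. if x \<le> y then \<phi> x y \<in> V y else \<phi> x y = \<zero>\<^bsub>M\<^esub>)"
  by (simp add: induced_module_def)

lemma Q_simps [simp]:
  "\<zero>\<^bsub>Q\<^esub> = (\<lambda>x y. \<zero>\<^bsub>M\<^esub>)"
  "\<phi> \<oplus>\<^bsub>Q\<^esub> \<psi> = (\<lambda>x y. \<phi> x y \<oplus>\<^bsub>M\<^esub> \<psi> x y)"
  by (simp_all add: induced_module_def)

lemma smult_Q: "a \<odot>\<^bsub>Q\<^esub> \<phi> = (\<lambda>x y. \<Oplus>\<^bsub>M\<^esub>z\<in>UNIV. monomial (a x z) y y \<odot>\<^bsub>M\<^esub> \<phi> z y)"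
  by (simp add: induced_module_def)

lemma entry:
  assumes "\<phi> \<in> carrier Q"
  shows "\<phi> x y \<in> V y" "\<phi> x y \<in> carrier M" "\<phi> x y \<in> component M y" "\<not> x \<le> y \<Longrightarrow> \<phi> x y = \<zero>\<^bsub>M\<^esub>"
proof -
  show V_entry: "\<phi> x y \<in> V y"
    using assms subspace_atD(3)[OF V] by (cases "x \<le> y") (simp_all add: carrier_Q)
  then show "\<phi> x y \<in> carrier M" "\<phi> x y \<in> component M y"
    using subspace_atD[OF V] by blast+
  show "\<not> x \<le> y \<Longrightarrow> \<phi> x y = \<zero>\<^bsub>M\<^esub>" using assms by (auto simp: carrier_Q split: if_splits)
qed

lemma carrier_QI:
  "(\<And>x y. x \<le> y \<Longrightarrow> \<phi> x y \<in> V y) \<Longrightarrow> (\<And>x y. \<not> x \<le> y \<Longrightarrow> \<phi> x y = \<zero>\<^bsub>M\<^esub>) \<Longrightarrow> \<phi> \<in> carrier Q"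
  by (simp add: carrier_Q)

lemma monomial_sum:
  assumes "m \<in> component M y" "finite I"
  shows "monomial (\<Sum>i\<in>I. k i) y y \<odot>\<^bsub>M\<^esub> m = (\<Oplus>\<^bsub>M\<^esub>i\<in>I. monomial (k i) y y \<odot>\<^bsub>M\<^esub> m)"
  using assms(2)
proof (induction I rule: finite_induct)
  case empty
  then show ?case using component_carrier[OF assms(1)] by simp
next
  case (insert i I)
  then show ?case
    using component_carrier[OF assms(1)] by (simp add: monomial_l_distr M.finsum_insert Pi_iff)
qed

lemma left_module_Q: "left_module incidence_algebra Q"
proof (rule left_moduleI)
  show "abelian_group Q"
  proof (rule abelian_groupI)
    fix \<phi> assume \<phi>: "\<phi> \<in> carrier Q"
    show "\<exists>\<psi>\<in>carrier Q. \<psi> \<oplus>\<^bsub>Q\<^esub> \<phi> = \<zero>\<^bsub>Q\<^esub>"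
    proof (rule bexI[of _ "\<lambda>x y. \<ominus>\<^bsub>M\<^esub> \<phi> x y"])
      show "(\<lambda>x y. \<ominus>\<^bsub>M\<^esub> \<phi> x y) \<in> carrier Q"
        using entry[OF \<phi>] subspace_at_minus[OF V] by (intro carrier_QI) auto
    qed (simp add: entry[OF \<phi>] M.l_neg)
  next
    fix \<phi> \<psi> assume \<phi>: "\<phi> \<in> carrier Q" and \<psi>: "\<psi> \<in> carrier Q"
    show "\<phi> \<oplus>\<^bsub>Q\<^esub> \<psi> \<in> carrier Q"
      using entry[OF \<phi>] entry[OF \<psi>] subspace_atD(4)[OF V] by (intro carrier_QI) auto
  qed (auto simp: entry M.a_ac intro!: carrier_QI subspace_atD(3)[OF V])
  show "ring (incidence_algebra :: ('p \<Rightarrow> 'p \<Rightarrow> 'k) ring)" by (rule ring_incidence_algebra)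
  show "\<one>\<^bsub>incidence_algebra\<^esub> \<odot>\<^bsub>Q\<^esub> \<phi> = \<phi>" if \<phi>: "\<phi> \<in> carrier Q" for \<phi>
  proof (intro ext)
    fix x y
    note e = entry[OF \<phi>]
    have "(\<Oplus>\<^bsub>M\<^esub>z\<in>UNIV. monomial (if x = z then 1 else 0) y y \<odot>\<^bsub>M\<^esub> \<phi> z y) =
      (\<Oplus>\<^bsub>M\<^esub>z\<in>UNIV. if z = x then \<phi> z y else \<zero>\<^bsub>M\<^esub>)"
      using e by (intro M.finsum_cong') (auto simp: component_smult_one)
    then show "(\<one>\<^bsub>incidence_algebra\<^esub> \<odot>\<^bsub>Q\<^esub> \<phi>) x y = \<phi> x y"
      using e(2) M.finsum_delta[of "\<lambda>z. \<phi> z y" x] by (simp add: smult_Q incidence_algebra_def)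
  qed
  fix a :: "'p \<Rightarrow> 'p \<Rightarrow> 'k" and \<phi>
  assume a: "a \<in> carrier incidence_algebra" and \<phi>: "\<phi> \<in> carrier Q"
  note e = entry[OF \<phi>]
  have a0: "a x y = 0" if "\<not> x \<le> y" for x y using a that by (simp add: incidence_algebra_def)
  show "a \<odot>\<^bsub>Q\<^esub> \<phi> \<in> carrier Q"
  proof (rule carrier_QI)
    fix x y :: 'p
    show "(a \<odot>\<^bsub>Q\<^esub> \<phi>) x y \<in> V y"
      unfolding smult_Q using e(1) by (intro subspace_at_finsum[OF V] subspace_atD(5)[OF V]) auto
    assume "\<not> x \<le> y"
    then have "monomial (a x z) y y \<odot>\<^bsub>M\<^esub> \<phi> z y = \<zero>\<^bsub>M\<^esub>" for z
      using a0[of x z] e(2,4)[of z y] by (cases "x \<le> z") (auto dest: order_trans)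
    then show "(a \<odot>\<^bsub>Q\<^esub> \<phi>) x y = \<zero>\<^bsub>M\<^esub>" by (simp add: smult_Q)
  qed
  show "a \<odot>\<^bsub>Q\<^esub> (\<phi> \<oplus>\<^bsub>Q\<^esub> \<psi>) = a \<odot>\<^bsub>Q\<^esub> \<phi> \<oplus>\<^bsub>Q\<^esub> a \<odot>\<^bsub>Q\<^esub> \<psi>" if \<psi>: "\<psi> \<in> carrier Q" for \<psi>
    using e entry[OF \<psi>] by (simp add: smult_Q monomial_r_distr M.finsum_addf Pi_iff)
  fix b :: "'p \<Rightarrow> 'p \<Rightarrow> 'k" assume b: "b \<in> carrier incidence_algebra"
  show "(a \<oplus>\<^bsub>incidence_algebra\<^esub> b) \<odot>\<^bsub>Q\<^esub> \<phi> = a \<odot>\<^bsub>Q\<^esub> \<phi> \<oplus>\<^bsub>Q\<^esub> b \<odot>\<^bsub>Q\<^esub> \<phi>"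
    using e by (simp add: smult_Q incidence_algebra_def monomial_l_distr M.finsum_addf Pi_iff)
  show "(a \<otimes>\<^bsub>incidence_algebra\<^esub> b) \<odot>\<^bsub>Q\<^esub> \<phi> = a \<odot>\<^bsub>Q\<^esub> (b \<odot>\<^bsub>Q\<^esub> \<phi>)"
  proof (intro ext)
    fix x y
    have "((a \<otimes>\<^bsub>incidence_algebra\<^esub> b) \<odot>\<^bsub>Q\<^esub> \<phi>) x y =
      (\<Oplus>\<^bsub>M\<^esub>z\<in>UNIV. \<Oplus>\<^bsub>M\<^esub>w\<in>UNIV. monomial (a x w * b w z) y y \<odot>\<^bsub>M\<^esub> \<phi> z y)"
      using e by (simp add: smult_Q incidence_algebra_def monomial_sum)
    also have "\<dots> = (\<Oplus>\<^bsub>M\<^esub>w\<in>UNIV. \<Oplus>\<^bsub>M\<^esub>z\<in>UNIV. monomial (a x w * b w z) y y \<odot>\<^bsub>M\<^esub> \<phi> z y)"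
      using e by (intro M.finsum_swap) auto
    also have "\<dots> = (\<Oplus>\<^bsub>M\<^esub>w\<in>UNIV. monomial (a x w) y y \<odot>\<^bsub>M\<^esub>
        (\<Oplus>\<^bsub>M\<^esub>z\<in>UNIV. monomial (b w z) y y \<odot>\<^bsub>M\<^esub> \<phi> z y))"
    proof (intro M.finsum_cong')
      fix w
      have "monomial (a x w) y y \<odot>\<^bsub>M\<^esub> (\<Oplus>\<^bsub>M\<^esub>z\<in>UNIV. monomial (b w z) y y \<odot>\<^bsub>M\<^esub> \<phi> z y) =
        (\<Oplus>\<^bsub>M\<^esub>z\<in>UNIV. monomial (a x w) y y \<odot>\<^bsub>M\<^esub> (monomial (b w z) y y \<odot>\<^bsub>M\<^esub> \<phi> z y))"
        using e by (intro additive_finsum) (auto simp: monomial_r_distr M.abelian_group_axioms)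
      then show "(\<Oplus>\<^bsub>M\<^esub>z\<in>UNIV. monomial (a x w * b w z) y y \<odot>\<^bsub>M\<^esub> \<phi> z y) =
        monomial (a x w) y y \<odot>\<^bsub>M\<^esub> (\<Oplus>\<^bsub>M\<^esub>z\<in>UNIV. monomial (b w z) y y \<odot>\<^bsub>M\<^esub> \<phi> z y)"
        using e by (simp add: monomial_smult_smult)
    qed (use e in \<open>auto intro!: M.finsum_closed\<close>)
    finally show "((a \<otimes>\<^bsub>incidence_algebra\<^esub> b) \<odot>\<^bsub>Q\<^esub> \<phi>) x y = (a \<odot>\<^bsub>Q\<^esub> (b \<odot>\<^bsub>Q\<^esub> \<phi>)) x y"
      by (simp add: smult_Q)
  qed
qed

sublocale Q: incidence_module Q
  using left_module_Q by (rule incidence_module.intro)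

lemma monomial_Q:
  assumes \<phi>: "\<phi> \<in> carrier Q"
  shows "monomial k a b \<odot>\<^bsub>Q\<^esub> \<phi> = (\<lambda>x y. if x = a then monomial k y y \<odot>\<^bsub>M\<^esub> \<phi> b y else \<zero>\<^bsub>M\<^esub>)"
proof (intro ext)
  fix x y
  note e = entry[OF \<phi>]
  have "(monomial k a b \<odot>\<^bsub>Q\<^esub> \<phi>) x y =
    (\<Oplus>\<^bsub>M\<^esub>z\<in>UNIV. if z = b then (if x = a then monomial k y y \<odot>\<^bsub>M\<^esub> \<phi> z y else \<zero>\<^bsub>M\<^esub>) else \<zero>\<^bsub>M\<^esub>)"
    unfolding smult_Q using e by (intro M.finsum_cong') (auto simp: monomial_def[of k a b])
  then show "(monomial k a b \<odot>\<^bsub>Q\<^esub> \<phi>) x y = (if x = a then monomial k y y \<odot>\<^bsub>M\<^esub> \<phi> b y else \<zero>\<^bsub>M\<^esub>)"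
    using e M.finsum_delta[of "\<lambda>z. if x = a then monomial k y y \<odot>\<^bsub>M\<^esub> \<phi> z y else \<zero>\<^bsub>M\<^esub>" b] by simp
qed

text \<open>By \<open>monomial_Q\<close>, the element p_b^a moves row \<open>b\<close> to row
  \<open>a\<close> and deletes all others; so the idempotent at \<open>x\<close> selects row
  \<open>x\<close>.\<close>

lemma component_Q: "\<phi> \<in> component Q x \<longleftrightarrow> \<phi> \<in> carrier Q \<and> (\<forall>x' y. x' \<noteq> x \<longrightarrow> \<phi> x' y = \<zero>\<^bsub>M\<^esub>)"
proof -
  have "monomial 1 x x \<odot>\<^bsub>Q\<^esub> \<phi> = (\<lambda>x' y. if x' = x then \<phi> x y else \<zero>\<^bsub>M\<^esub>)" if "\<phi> \<in> carrier Q"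
    using that entry[OF that] by (simp add: monomial_Q component_smult_one fun_eq_iff)
  then show ?thesis by (auto simp: component_def fun_eq_iff)
qed

section \<open>Homomorphisms out of induced modules\<close>

definition generator :: "'p \<Rightarrow> 'm \<Rightarrow> 'p \<Rightarrow> 'p \<Rightarrow> 'm" where
  "generator y v = (\<lambda>a b. if a = y \<and> b = y then v else \<zero>\<^bsub>M\<^esub>)"

lemma generator_component: "v \<in> V y \<Longrightarrow> generator y v \<in> component Q y"
  unfolding component_Q using subspace_atD(3)[OF V]
  by (auto simp: generator_def intro!: carrier_QI)

lemma generator_carrier: "v \<in> V y \<Longrightarrow> generator y v \<in> carrier Q"
  by (rule component_carrier) (rule generator_component)

text \<open>A matrix is the sum of its entries, and the part with a single entry at (x, y) is p_y^x
  applied to a generator; the induction adds entries one at a time.\<close>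

lemma hom_eq_on_generators:
  assumes N: "left_module incidence_algebra N"
    and g: "g \<in> left_module_hom incidence_algebra Q N" and h: "h \<in> left_module_hom incidence_algebra Q N"
    and eq: "\<And>y v. v \<in> V y \<Longrightarrow> g (generator y v) = h (generator y v)"
    and \<phi>: "\<phi> \<in> carrier Q"
  shows "g \<phi> = h \<phi>"
proof -
  let ?\<phi> = "\<lambda>S x y. if (x, y) \<in> S then \<phi> x y else \<zero>\<^bsub>M\<^esub>"
  note e = entry[OF \<phi>]
  have car: "?\<phi> S \<in> carrier Q" for S
    using e subspace_atD(3)[OF V] by (intro carrier_QI) auto
  have "g (?\<phi> S) = h (?\<phi> S)" if "finite S" for S
    using that
  proof (induction S rule: finite_induct)
    case empty
    then show ?case
      using left_module_hom_zero[OF left_module_Q N g] left_module_hom_zero[OF left_module_Q N h] by simp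
  next
    case (insert p S)
    obtain x y where p: "p = (x, y)" by (cases p)
    show ?case
    proof (cases "x \<le> y")
      case True
      let ?m = "monomial 1 x y \<odot>\<^bsub>Q\<^esub> generator y (\<phi> x y)"
      have gen: "generator y (\<phi> x y) \<in> carrier Q" using e by (intro generator_carrier)
      have "?\<phi> (insert p S) = ?m \<oplus>\<^bsub>Q\<^esub> ?\<phi> S"
        using insert.hyps e gen by (auto simp: p monomial_Q generator_def component_smult_one fun_eq_iff)
      moreover have "g ?m = h ?m"
        using gen e True by (simp add: left_module_homD(3)[OF g] left_module_homD(3)[OF h] monomial_carrier eq)
      moreover have "?m \<in> carrier Q" using gen True by simp
      ultimately show ?thesis
        using insert.IH car[of S] by (simp only: left_module_homD(2)[OF g] left_module_homD(2)[OF h])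
    next
      case False
      then have "?\<phi> (insert p S) = ?\<phi> S" using e by (auto simp: p fun_eq_iff)
      then show ?thesis using insert.IH by metis
    qed
  qed
  from this[of UNIV] show ?thesis by simp
qed

text \<open>The homomorphism induced by linear maps \<open>l y\<close> from V_y to N_y: it sends
  p_y^x tensor v to p_y^x applied to \<open>l y v\<close>.\<close>

definition extension :: "('p \<Rightarrow> 'p \<Rightarrow> 'k, 'n) module \<Rightarrow> ('p \<Rightarrow> 'm \<Rightarrow> 'n) \<Rightarrow> ('p \<Rightarrow> 'p \<Rightarrow> 'm) \<Rightarrow> 'n" where
  "extension N l \<phi> = (\<Oplus>\<^bsub>N\<^esub>y\<in>UNIV. \<Oplus>\<^bsub>N\<^esub>x\<in>UNIV. if x \<le> y then monomial 1 x y \<odot>\<^bsub>N\<^esub> l y (\<phi> x y) else \<zero>\<^bsub>N\<^esub>)"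

end

locale component_maps =
  component_subspaces M V + N: incidence_module N
  for M :: "('p::{finite,order} \<Rightarrow> 'p \<Rightarrow> 'k::field, 'm) module" and V
    and N :: "('p \<Rightarrow> 'p \<Rightarrow> 'k, 'n) module" +
  fixes l :: "'p \<Rightarrow> 'm \<Rightarrow> 'n"
  assumes l: "\<And>y. linear_at M (V y) N y (l y)"
begin

lemma l_zero: "l y \<zero>\<^bsub>M\<^esub> = \<zero>\<^bsub>N\<^esub>"
proof -
  have "l y \<zero>\<^bsub>M\<^esub> \<oplus>\<^bsub>N\<^esub> l y \<zero>\<^bsub>M\<^esub> = l y \<zero>\<^bsub>M\<^esub>"
    using linear_atD(3)[OF l subspace_atD(3)[OF V] subspace_atD(3)[OF V], of y] by simp
  then show ?thesis
    using linear_atD(2)[OF l subspace_atD(3)[OF V], of y] N.M.add.r_cancel_one by simp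
qed

lemma extension_hom: "extension N l \<in> left_module_hom incidence_algebra Q N"
proof (rule left_module_hom_monomialI[OF left_module_Q N.left_module_axioms])
  let ?T = "\<lambda>\<phi> y x. if x \<le> y then monomial 1 x y \<odot>\<^bsub>N\<^esub> l y (\<phi> x y) else \<zero>\<^bsub>N\<^esub>"
  fix \<phi> assume \<phi>: "\<phi> \<in> carrier Q"
  note le = linear_atD(1,2)[OF l entry(1)[OF \<phi>]]
  show "extension N l \<phi> \<in> carrier N"
    unfolding extension_def using le by (intro N.M.finsum_closed) auto
  show "extension N l (\<phi> \<oplus>\<^bsub>Q\<^esub> \<psi>) = extension N l \<phi> \<oplus>\<^bsub>N\<^esub> extension N l \<psi>" if \<psi>: "\<psi> \<in> carrier Q" for \<psi>
  proof -
    note le' = linear_atD(1,2)[OF l entry(1)[OF \<psi>]]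
    have T: "?T (\<phi> \<oplus>\<^bsub>Q\<^esub> \<psi>) y x = ?T \<phi> y x \<oplus>\<^bsub>N\<^esub> ?T \<psi> y x" for x y
      using le le' linear_atD(3)[OF l entry(1)[OF \<phi>] entry(1)[OF \<psi>]] by (simp add: N.monomial_r_distr)
    show ?thesis
      unfolding extension_def T using le le'
      by (simp add: N.M.finsum_addf N.M.finsum_closed Pi_iff)
  qed
  fix k and a b :: 'p assume ab: "a \<le> b"
  \<comment> \<open>The common contribution of column \<open>y\<close> to both sides: only row
    \<open>b\<close> of \<open>\<phi>\<close> survives multiplication by
    \<open>monomial k a b\<close>, and it ends up in row \<open>a\<close>.\<close>
  let ?v = "\<lambda>y. if b \<le> y then monomial k a y \<odot>\<^bsub>N\<^esub> l y (\<phi> b y) else \<zero>\<^bsub>N\<^esub>"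
  have v: "?v y \<in> carrier N" for y using le ab by (auto dest: order_trans)
  have 1: "?T (monomial k a b \<odot>\<^bsub>Q\<^esub> \<phi>) y x = (if x = a then ?v y else \<zero>\<^bsub>N\<^esub>)" for x y
  proof (cases "x = a")
    case True
    have lk: "l y (monomial k y y \<odot>\<^bsub>M\<^esub> \<phi> b y) = monomial k y y \<odot>\<^bsub>N\<^esub> l y (\<phi> b y)"
      using linear_atD(4)[OF l entry(1)[OF \<phi>]] .
    have "\<phi> b y = \<zero>\<^bsub>M\<^esub>" if "\<not> b \<le> y" using entry(4)[OF \<phi> that] .
    then show ?thesis
      using True le ab lk by (auto simp: monomial_Q[OF \<phi>] N.monomial_smult_smult l_zero dest: order_trans)
  next
    case False
    then show ?thesis using l_zero by (simp add: monomial_Q[OF \<phi>])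
  qed
  have lhs: "extension N l (monomial k a b \<odot>\<^bsub>Q\<^esub> \<phi>) = (\<Oplus>\<^bsub>N\<^esub>y\<in>UNIV. ?v y)"
    unfolding extension_def 1 using N.M.finsum_delta[of "\<lambda>_. ?v _" a] v by simp
  have 2: "monomial k a b \<odot>\<^bsub>N\<^esub> ?T \<phi> y x = (if x = b then ?v y else \<zero>\<^bsub>N\<^esub>)" for x y
    using le ab by (simp add: N.monomial_smult_smult)
  have push: "monomial k a b \<odot>\<^bsub>N\<^esub> (\<Oplus>\<^bsub>N\<^esub>i\<in>(UNIV :: 'p set). g i) = (\<Oplus>\<^bsub>N\<^esub>i\<in>UNIV. monomial k a b \<odot>\<^bsub>N\<^esub> g i)"
    if "\<And>i. g i \<in> carrier N" for g
    using that ab by (intro additive_finsum) (auto simp: N.monomial_r_distr N.abelian_group_axioms)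
  have Tc: "?T \<phi> y x \<in> carrier N" for x y using le by simp
  have "monomial k a b \<odot>\<^bsub>N\<^esub> extension N l \<phi> =
      (\<Oplus>\<^bsub>N\<^esub>y\<in>UNIV. monomial k a b \<odot>\<^bsub>N\<^esub> (\<Oplus>\<^bsub>N\<^esub>x\<in>UNIV. ?T \<phi> y x))"
    unfolding extension_def using Tc by (intro push N.M.finsum_closed) auto
  also have "\<dots> = (\<Oplus>\<^bsub>N\<^esub>y\<in>UNIV. \<Oplus>\<^bsub>N\<^esub>x\<in>UNIV. if x = b then ?v y else \<zero>\<^bsub>N\<^esub>)"
    using Tc by (simp only: push 2)
  also have "\<dots> = (\<Oplus>\<^bsub>N\<^esub>y\<in>UNIV. ?v y)"
    using N.M.finsum_delta[of "\<lambda>_. ?v _" b] v by simp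
  finally show "extension N l (monomial k a b \<odot>\<^bsub>Q\<^esub> \<phi>) = monomial k a b \<odot>\<^bsub>N\<^esub> extension N l \<phi>"
    unfolding lhs by simp
qed

lemma extension_generator:
  assumes v: "v \<in> V y"
  shows "extension N l (generator y v) = l y v"
proof -
  have lv: "l y v \<in> carrier N" "l y v \<in> component N y" using linear_atD[OF l v] by auto
  have "(if x \<le> w then monomial 1 x w \<odot>\<^bsub>N\<^esub> l w (generator y v x w) else \<zero>\<^bsub>N\<^esub>) =
    (if x = y then (if w = y then l y v else \<zero>\<^bsub>N\<^esub>) else \<zero>\<^bsub>N\<^esub>)" for x w
    using lv by (auto simp: generator_def l_zero N.component_smult_one)
  then show ?thesis
    unfolding extension_def
    using N.M.finsum_delta[of "\<lambda>_. if _ = y then l y v else \<zero>\<^bsub>N\<^esub>" y] N.M.finsum_delta[of "\<lambda>_. l y v" y] lv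
    by simp
qed

end

text \<open>Homomorphisms out of \<open>Q\<close> amount to linear maps on the spaces
  \<open>V y\<close>, and these lift through surjections. The element types of \<open>X\<close> and
  \<open>Y\<close> are independent of that of \<open>Q\<close>, so the lemma applies before
  \<open>Q\<close> is copied into \<open>'m\<close>.\<close>

lemma (in component_subspaces) projective_lift:
  assumes X: "left_module incidence_algebra X" and Y: "left_module incidence_algebra Y"
    and f: "f \<in> left_module_hom incidence_algebra X Y" "f ` carrier X = carrier Y"
    and g: "g \<in> left_module_hom incidence_algebra Q Y"
  obtains h where "h \<in> left_module_hom incidence_algebra Q X" "\<And>\<phi>. \<phi> \<in> carrier Q \<Longrightarrow> f (h \<phi>) = g \<phi>"
proof -
  have "linear_at M (V y) Y y (\<lambda>v. g (generator y v))" for y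
    unfolding linear_at_def
  proof (intro conjI ballI allI)
    fix v assume v: "v \<in> V y"
    show "g (generator y v) \<in> component Y y" using hom_component[OF g generator_component[OF v]] .
    show "g (generator y (v \<oplus>\<^bsub>M\<^esub> w)) = g (generator y v) \<oplus>\<^bsub>Y\<^esub> g (generator y w)" if w: "w \<in> V y" for w
    proof -
      have "generator y (v \<oplus>\<^bsub>M\<^esub> w) = generator y v \<oplus>\<^bsub>Q\<^esub> generator y w" by (auto simp: generator_def fun_eq_iff)
      then show ?thesis using left_module_homD(2)[OF g generator_carrier[OF v] generator_carrier[OF w]] by metis
    qed
    show "g (generator y (monomial k y y \<odot>\<^bsub>M\<^esub> v)) = monomial k y y \<odot>\<^bsub>Y\<^esub> g (generator y v)" for k
    proof -
      have "generator y (monomial k y y \<odot>\<^bsub>M\<^esub> v) = monomial k y y \<odot>\<^bsub>Q\<^esub> generator y v"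
        unfolding monomial_Q[OF generator_carrier[OF v]] by (auto simp: generator_def fun_eq_iff)
      then show ?thesis using left_module_homD(3)[OF g _ generator_carrier[OF v]] by (simp add: monomial_carrier)
    qed
  qed
  then have "\<exists>l. linear_at M (V y) X y l \<and> (\<forall>v\<in>V y. f (l v) = g (generator y v))" for y
    using linear_at_lift[OF X Y f V] by metis
  then obtain l where l: "\<And>y. linear_at M (V y) X y (l y)"
    "\<And>y v. v \<in> V y \<Longrightarrow> f (l y v) = g (generator y v)"
    by metis
  interpret X: incidence_module X using X by (rule incidence_module.intro)
  interpret E: component_maps M V X l by unfold_locales (rule l(1))
  have "f (extension X l \<phi>) = g \<phi>" if "\<phi> \<in> carrier Q" for \<phi>
    using hom_eq_on_generators[OF Y left_module_hom_comp[OF E.extension_hom f(1)] g _ that]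
    by (simp add: E.extension_generator l(2))
  then show ?thesis using that E.extension_hom by blast
qed

section \<open>Acyclicity of induced modules\<close>

lemma cube_vertex_replicate_False: "cube_vertex z us (replicate n False) = z"
proof (induction us arbitrary: n)
  case (Cons u us)
  then show ?case by (cases n) simp_all
qed simp

lemma count_list_True_eq_0: "count_list bs True = 0 \<longleftrightarrow> bs = replicate (length bs) False"
  by (induction bs) auto

lemma cube_vertex_ge_selected:
  "length bs = length us \<Longrightarrow> 0 < count_list bs True \<Longrightarrow> \<exists>u\<in>set us. u \<le> cube_vertex z us bs"
proof (induction us arbitrary: z bs)
  case (Cons u us)
  then obtain b as where bs: "bs = b # as" by (cases bs) auto
  show ?case
  proof (cases b)
    case True
    have "u \<le> cube_vertex (sup z u) us as" using cube_vertex_ge[of "sup z u" us as] by simp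
    then show ?thesis using bs True by simp
  next
    case False
    then show ?thesis using Cons.IH[of as z] Cons.prems bs by auto
  qed
qed simp

lemma chains_component:
  assumes "left_module incidence_algebra M" "c \<in> chains M us z j"
  shows "c bs \<in> component M (cube_vertex z us bs)"
proof -
  interpret M: incidence_module M using assms(1) by (rule incidence_module.intro)
  show ?thesis using assms(2) M.component_zero unfolding chains_def mem_Collect_eq by metis
qed

lemma chains_zero:
  assumes "left_module incidence_algebra M"
  shows "(\<lambda>_. \<zero>\<^bsub>M\<^esub>) \<in> chains M us z j"
proof -
  interpret M: incidence_module M using assms(1) by (rule incidence_module.intro)
  show ?thesis by (simp add: chains_def)
qed

locale lattice_component_subspaces = component_subspaces M V
  for M :: "('p::{finite,lattice} \<Rightarrow> 'p \<Rightarrow> 'k::field, 'm) module" and V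
begin

sublocale Q: lattice_incidence_module Q
  using left_module_Q by (rule lattice_incidence_moduleI)

text \<open>The action does not mix columns: column \<open>y\<close> is the summand A p_y^y tensor
  V_y, and this is the projection onto the summands indexed by \<open>S\<close>.\<close>

definition column_projection :: "'p set \<Rightarrow> ('p \<Rightarrow> 'p \<Rightarrow> 'm) \<Rightarrow> 'p \<Rightarrow> 'p \<Rightarrow> 'm" where
  "column_projection S \<phi> = (\<lambda>x y. if y \<in> S then \<phi> x y else \<zero>\<^bsub>M\<^esub>)"

lemma column_projection_carrier: "\<phi> \<in> carrier Q \<Longrightarrow> column_projection S \<phi> \<in> carrier Q"
  using entry subspace_atD(3)[OF V] by (intro carrier_QI) (auto simp: column_projection_def)

lemma column_projection_hom: "column_projection S \<in> left_module_hom incidence_algebra Q Q"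
proof (rule left_module_hom_monomialI[OF left_module_Q left_module_Q])
  fix k and x y :: 'p and \<phi> assume "x \<le> y" and \<phi>: "\<phi> \<in> carrier Q"
  show "column_projection S (monomial k x y \<odot>\<^bsub>Q\<^esub> \<phi>) = monomial k x y \<odot>\<^bsub>Q\<^esub> column_projection S \<phi>"
    unfolding monomial_Q[OF \<phi>] monomial_Q[OF column_projection_carrier[OF \<phi>]]
    by (auto simp: column_projection_def fun_eq_iff)
qed (auto simp: column_projection_carrier, auto simp: column_projection_def fun_eq_iff)

text \<open>In column \<open>w\<close> the restriction map along an edge \<open>u \<le> w\<close> of the cube is bijective, so the cone
  over it is contractible; if \<open>\<not> u \<le> w\<close>, the opposite face of the cube vanishes.\<close>

lemma column_cycle_is_boundary:
  assumes "c \<in> chains Q us z j" "\<And>bs. boundary Q us z c bs = \<zero>\<^bsub>Q\<^esub>"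
    and "\<And>bs x y. y \<noteq> w \<Longrightarrow> c bs x y = \<zero>\<^bsub>M\<^esub>"
    and "0 < j \<or> (\<exists>u\<in>set us. u \<le> w)"
  shows "\<exists>b\<in>chains Q us z (Suc j). \<forall>bs. boundary Q us z b bs = c bs"
  using assms
proof (induction us arbitrary: z c j)
  case Nil
  \<comment> \<open>With no direction left, the last hypothesis reduces to \<open>0 < j\<close>, and
    a cube with one vertex has only zero chains in positive degree.\<close>
  then have "c bs = \<zero>\<^bsub>Q\<^esub>" for bs using Q.chains_eq_zero[OF Nil.prems(1)] by auto
  then show ?case using chains_zero[OF left_module_Q] by (intro bexI[of _ "\<lambda>_. \<zero>\<^bsub>Q\<^esub>"]) simp_all
next
  case (Cons u us)
  let ?X = "\<lambda>bs. cube_vertex z us bs" and ?X' = "\<lambda>bs. cube_vertex (sup z u) us bs"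
  let ?c0 = "\<lambda>bs. c (False # bs)" and ?c1 = "\<lambda>bs. c (True # bs)"
  let ?res = "\<lambda>bs \<phi>. monomial 1 (?X bs) (?X' bs) \<odot>\<^bsub>Q\<^esub> \<phi>"
  have le: "?X bs \<le> ?X' bs" "u \<le> ?X' bs" for bs
    by (simp_all add: cube_vertex_sup)
  note cc = Q.chains_closed[OF Cons.prems(1)]
  have c: "c [] = \<zero>\<^bsub>Q\<^esub>" "?c0 \<in> chains Q us z j" using Cons.prems(1) unfolding chains_Cons by auto
  have c0: "?c0 bs \<in> component Q (?X bs)" for bs
    using chains_component[OF left_module_Q c(2), of bs] by simp
  have c1: "?c1 bs \<in> component Q (?X' bs)" for bs
    using chains_component[OF left_module_Q Cons.prems(1), of "True # bs"] by simp
  have cyc0: "boundary Q us z ?c0 bs \<oplus>\<^bsub>Q\<^esub> ?res bs (?c1 bs) = \<zero>\<^bsub>Q\<^esub>" for bs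
    using Cons.prems(2)[of "False # bs"] by simp
  show ?case
  proof (cases "u \<le> w")
    case True
    \<comment> \<open>The preimage of \<open>?c0\<close> under restriction: entries of row
      \<open>?X bs\<close> are moved to row \<open>?X' bs\<close>. In column \<open>w\<close> this
      is allowed, since \<open>u \<le> w\<close> makes \<open>?X bs \<le> w\<close> imply
      \<open>?X' bs \<le> w\<close>.\<close>
    define b1 where "b1 bs x y = (if x = ?X' bs then c (False # bs) (?X bs) y else \<zero>\<^bsub>M\<^esub>)" for bs x y
    have b1: "b1 bs \<in> component Q (?X' bs)" for bs
      unfolding component_Q
    proof (intro conjI carrier_QI allI impI)
      note e = entry[OF cc[of "False # bs"]]
      show "b1 bs x y \<in> V y" if "x \<le> y" for x y
        using e(1) subspace_atD(3)[OF V] by (auto simp: b1_def)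
      show "b1 bs x y = \<zero>\<^bsub>M\<^esub>" if "\<not> x \<le> y" for x y
      proof (cases "y = w")
        case True
        then have "?X bs \<le> y \<Longrightarrow> ?X' bs \<le> y" using \<open>u \<le> w\<close> by (simp add: cube_vertex_sup)
        then show ?thesis using that e(4)[of "?X bs" y] by (auto simp: b1_def)
      next
        case False
        then show ?thesis using Cons.prems(3) by (simp add: b1_def)
      qed
      show "b1 bs x y = \<zero>\<^bsub>M\<^esub>" if "x \<noteq> ?X' bs" for x y using that by (simp add: b1_def)
    qed
    have b1c: "b1 bs \<in> carrier Q" for bs using b1 by (rule component_carrier)
    have res_b1: "?res bs (b1 bs) = ?c0 bs" for bs
    proof (intro ext)
      fix x y
      show "(?res bs (b1 bs)) x y = ?c0 bs x y"
        using c0[of bs] entry(3)[OF cc[of "False # bs"]]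
        unfolding monomial_Q[OF b1c] by (auto simp: b1_def component_Q component_smult_one)
    qed
    have chain1: "b1 \<in> chains Q us (sup z u) j"
      unfolding chains_def mem_Collect_eq
    proof
      fix bs
      have "b1 bs = \<zero>\<^bsub>Q\<^esub>" if "\<not> (length bs = length us \<and> count_list bs True = j)"
      proof -
        have "?c0 bs = \<zero>\<^bsub>Q\<^esub>" using c(2) that unfolding chains_def mem_Collect_eq by metis
        then show ?thesis by (auto simp: b1_def fun_eq_iff)
      qed
      then show "if length bs = length us \<and> count_list bs True = j
        then b1 bs \<in> component Q (cube_vertex (sup z u) us bs) else b1 bs = \<zero>\<^bsub>Q\<^esub>"
        using b1 by (metis (full_types))
    qed
    \<comment> \<open>The filling lives on the face with first bit \<open>True\<close>. On the other
      face its boundary is \<open>?c0\<close> by the choice of \<open>b1\<close>; on its own face it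
      is \<open>?c1\<close>, because \<open>c\<close> is a cycle and restriction is injective on row
      \<open>?X' bs\<close>.\<close>
    define b where "b bs = (case bs of [] \<Rightarrow> \<zero>\<^bsub>Q\<^esub> | v # vs \<Rightarrow> if v then b1 vs else \<zero>\<^bsub>Q\<^esub>)" for bs
    have b_simps: "b [] = \<zero>\<^bsub>Q\<^esub>" "(\<lambda>a. b (True # a)) = b1" "(\<lambda>a. b (False # a)) = (\<lambda>_. \<zero>\<^bsub>Q\<^esub>)"
      by (auto simp: b_def)
    have "b \<in> chains Q (u # us) z (Suc j)"
      unfolding chains_Cons b_simps using chain1 chains_zero[OF left_module_Q] by simp
    moreover have "boundary Q (u # us) z b bs = c bs" for bs
    proof (cases bs)
      case Nil
      then show ?thesis using c(1) by simp
    next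
      case (Cons v vs)
      show ?thesis
      proof (cases v)
        case False
        have "boundary Q us z (\<lambda>a. b (False # a)) vs = \<zero>\<^bsub>Q\<^esub>"
          unfolding b_simps by (rule Q.boundary_zero)
        moreover have "b (True # vs) = b1 vs" by (simp add: b_def)
        ultimately show ?thesis
          using Cons False res_b1[of vs] cc[of bs] Q.M.l_zero by (simp del: Q_simps)
      next
        case True
        let ?d = "boundary Q us (sup z u) b1 vs"
        have dc: "?d \<in> carrier Q" using b1c by (rule Q.boundary_closed)
        have "(\<lambda>bs. ?res bs (b1 bs)) = ?c0" using res_b1 by blast
        then have "?res vs ?d = boundary Q us z ?c0 vs"
          using Q.boundary_monomial[of b1 z "sup z u" us vs] b1c by simp
        then have "?res vs (\<ominus>\<^bsub>Q\<^esub> ?d) = \<ominus>\<^bsub>Q\<^esub> boundary Q us z ?c0 vs"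
          using dc le by (simp add: Q.monomial_smult_minus del: Q_simps)
        also have "\<dots> = ?res vs (?c1 vs)"
        proof -
          have "boundary Q us z ?c0 vs \<in> carrier Q" using cc by (intro Q.boundary_closed)
          moreover have "?res vs (?c1 vs) \<in> carrier Q" using cc le by (intro Q.monomial_closed)
          moreover have "?res vs (?c1 vs) \<oplus>\<^bsub>Q\<^esub> boundary Q us z ?c0 vs = \<zero>\<^bsub>Q\<^esub>"
            using cyc0[of vs] calculation by (simp only: Q.M.a_comm)
          ultimately show ?thesis by (simp only: Q.M.minus_equality)
        qed
        finally have eq: "?res vs (\<ominus>\<^bsub>Q\<^esub> ?d) = ?res vs (?c1 vs)" .
        have d: "\<ominus>\<^bsub>Q\<^esub> ?d \<in> component Q (?X' vs)"
        proof (cases j)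
          case 0
          then have "?d = \<zero>\<^bsub>Q\<^esub>" using chain1 by (intro Q.boundary_chains_0) simp
          then show ?thesis by (simp only: Q.component_minus Q.component_zero)
        next
          case (Suc i)
          then have "boundary Q us (sup z u) b1 \<in> chains Q us (sup z u) i"
            using chain1 by (intro Q.boundary_chains) simp
          then show ?thesis by (intro Q.component_minus chains_component[OF left_module_Q])
        qed
        have "\<ominus>\<^bsub>Q\<^esub> ?d = ?c1 vs"
        proof (intro ext)
          fix x y
          note ed = entry[OF component_carrier[OF d]] and e1 = entry[OF cc[of "True # vs"]]
          have "(\<ominus>\<^bsub>Q\<^esub> ?d) (?X' vs) y = ?c1 vs (?X' vs) y"
            using fun_cong[OF fun_cong[OF eq], of "?X vs" y] ed(3) e1(3)
            unfolding monomial_Q[OF component_carrier[OF d]] monomial_Q[OF cc]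
            by (simp add: component_smult_one)
          then show "(\<ominus>\<^bsub>Q\<^esub> ?d) x y = ?c1 vs x y"
            using d c1[of vs] by (cases "x = ?X' vs") (auto simp: component_Q)
        qed
        then show ?thesis using Cons True by (simp add: b_simps)
      qed
    qed
    ultimately show ?thesis by blast
  next
    case False
    \<comment> \<open>All vertices of this face lie above \<open>u\<close>, hence not below
      \<open>w\<close>, where column \<open>w\<close> of an induced module is zero; only the cube
      over \<open>us\<close> based at \<open>z\<close> remains.\<close>
    have c1_zero: "?c1 bs = \<zero>\<^bsub>Q\<^esub>" for bs
    proof -
      have "?c1 bs x y = \<zero>\<^bsub>M\<^esub>" for x y
      proof (cases "x = ?X' bs \<and> y = w")
        case True
        then have "\<not> x \<le> y" using False le(2)[of bs] order_trans by blast
        then show ?thesis using entry(4)[OF cc] by blast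
      next
        case False
        then show ?thesis using c1[of bs] Cons.prems(3) by (auto simp: component_Q)
      qed
      then show ?thesis by (auto simp: fun_eq_iff)
    qed
    have "boundary Q us z ?c0 bs = \<zero>\<^bsub>Q\<^esub>" for bs
    proof -
      have "?res bs (?c1 bs) = \<zero>\<^bsub>Q\<^esub>" unfolding c1_zero using le(1) by (rule Q.monomial_smult_zero)
      moreover have "boundary Q us z ?c0 bs \<in> carrier Q" using cc by (intro Q.boundary_closed)
      ultimately show ?thesis using cyc0[of bs] by (metis Q.M.r_zero)
    qed
    moreover have "0 < j \<or> (\<exists>u\<in>set us. u \<le> w)" using Cons.prems(4) False by auto
    ultimately obtain b0 where b0: "b0 \<in> chains Q us z (Suc j)" "\<And>bs. boundary Q us z b0 bs = ?c0 bs"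
      using Cons.IH[OF c(2)] Cons.prems(3) by blast
    define b where "b bs = (case bs of [] \<Rightarrow> \<zero>\<^bsub>Q\<^esub> | v # vs \<Rightarrow> if v then \<zero>\<^bsub>Q\<^esub> else b0 vs)" for bs
    have b_simps: "b [] = \<zero>\<^bsub>Q\<^esub>" "(\<lambda>a. b (True # a)) = (\<lambda>_. \<zero>\<^bsub>Q\<^esub>)" "(\<lambda>a. b (False # a)) = b0"
      "\<And>a. b (True # a) = \<zero>\<^bsub>Q\<^esub>"
      by (auto simp: b_def)
    have "b \<in> chains Q (u # us) z (Suc j)"
      unfolding chains_Cons b_simps using b0(1) chains_zero[OF left_module_Q] by simp
    moreover have "boundary Q (u # us) z b bs = c bs" for bs
    proof (cases bs)
      case Nil
      then show ?thesis using c(1) by simp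
    next
      case (Cons v vs)
      show ?thesis
      proof (cases v)
        case True
        have "boundary Q (u # us) z b (True # vs) = \<ominus>\<^bsub>Q\<^esub> boundary Q us (sup z u) (\<lambda>_. \<zero>\<^bsub>Q\<^esub>) vs"
          by (simp add: b_simps)
        also have "\<dots> = \<zero>\<^bsub>Q\<^esub>" unfolding Q.boundary_zero
          by (rule Q.M.minus_equality) (simp_all only: Q.M.l_zero Q.M.zero_closed)
        finally show ?thesis using Cons True c1_zero by simp
      next
        case False
        have "boundary Q (u # us) z b (False # vs) = boundary Q us z b0 vs \<oplus>\<^bsub>Q\<^esub> ?res vs \<zero>\<^bsub>Q\<^esub>"
          by (simp add: b_simps)
        also have "\<dots> = c (False # vs)"
          unfolding Q.monomial_smult_zero[OF le(1)] b0(2) using cc by (rule Q.M.r_zero)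
        finally show ?thesis using Cons False by simp
      qed
    qed
    ultimately show ?thesis by blast
  qed
qed

text \<open>The cycle is split into its columns. The last condition concerns only columns in
  \<open>W\<close>, so the lemma also covers degree 0 for cycles whose columns all lie above some
  element of \<open>us\<close>.\<close>

lemma cycle_is_boundary:
  assumes "finite W" "c \<in> chains Q us z j" "\<And>bs. boundary Q us z c bs = \<zero>\<^bsub>Q\<^esub>"
    and "\<And>bs x y. y \<notin> W \<Longrightarrow> c bs x y = \<zero>\<^bsub>M\<^esub>"
    and "\<And>w. w \<in> W \<Longrightarrow> 0 < j \<or> (\<exists>u\<in>set us. u \<le> w)"
  shows "\<exists>b\<in>chains Q us z (Suc j). \<forall>bs. boundary Q us z b bs = c bs"
  using assms
proof (induction W arbitrary: c rule: finite_induct)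
  case empty
  then have "c bs = \<zero>\<^bsub>Q\<^esub>" for bs by (auto simp: fun_eq_iff)
  moreover have "boundary Q us z (\<lambda>_. \<zero>\<^bsub>Q\<^esub>) bs = \<zero>\<^bsub>Q\<^esub>" for bs by (rule Q.boundary_zero)
  ultimately show ?case using chains_zero[OF left_module_Q] by metis
next
  case (insert w W)
  let ?p = "\<lambda>S bs. column_projection S (c bs)"
  note cc = Q.chains_closed[OF insert.prems(1)]
  have p: "?p S \<in> chains Q us z j" for S
    by (rule chains_hom[OF left_module_Q left_module_Q column_projection_hom insert.prems(1)])
  have cyc: "boundary Q us z (?p S) bs = \<zero>\<^bsub>Q\<^esub>" for S bs
  proof -
    have "boundary Q us z (?p S) bs = column_projection S (boundary Q us z c bs)"
      by (rule boundary_hom[OF left_module_Q left_module_Q column_projection_hom cc])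
    also have "\<dots> = \<zero>\<^bsub>Q\<^esub>"
      unfolding insert.prems(2) by (rule left_module_hom_zero[OF left_module_Q left_module_Q column_projection_hom])
    finally show ?thesis .
  qed
  obtain b1 where b1: "b1 \<in> chains Q us z (Suc j)" "\<And>bs. boundary Q us z b1 bs = ?p {w} bs"
    using column_cycle_is_boundary[OF p[of "{w}"] cyc, of w] insert.prems(4)[of w]
    by (auto simp: column_projection_def)
  obtain b2 where b2: "b2 \<in> chains Q us z (Suc j)" "\<And>bs. boundary Q us z b2 bs = ?p W bs"
    using insert.IH[OF p[of W] cyc] insert.prems(4) by (auto simp: column_projection_def)
  have "boundary Q us z (\<lambda>bs. b1 bs \<oplus>\<^bsub>Q\<^esub> b2 bs) bs = c bs" for bs
  proof -
    have "boundary Q us z (\<lambda>bs. b1 bs \<oplus>\<^bsub>Q\<^esub> b2 bs) bs = ?p {w} bs \<oplus>\<^bsub>Q\<^esub> ?p W bs"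
      by (simp only: Q.boundary_add[OF Q.chains_closed[OF b1(1)] Q.chains_closed[OF b2(1)]] b1(2) b2(2))
    also have "\<dots> = c bs"
      using insert.hyps insert.prems(3)[of _ bs] entry(2)[OF cc[of bs]]
      by (auto simp: column_projection_def fun_eq_iff)
    finally show ?thesis .
  qed
  then show ?case using Q.chains_add[OF b1(1) b2(1)] by blast
qed

lemma acyclic_at_Q: "0 < j \<Longrightarrow> acyclic_at Q us z j"
  unfolding acyclic_at_def by (intro ballI impI, rule cycle_is_boundary[of UNIV]) auto

end

section \<open>Projective covers\<close>

text \<open>Identifies an element of M_z with a chain of degree 0, since the vertex that selects
  nothing is the only one of that degree.\<close>

definition point_chain :: "('a::{finite,lattice} \<Rightarrow> 'a \<Rightarrow> 'k::field, 'm) module \<Rightarrow> 'a list \<Rightarrow> 'm \<Rightarrow> bool list \<Rightarrow> 'm" where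
  "point_chain M us m bs = (if bs = replicate (length us) False then m else \<zero>\<^bsub>M\<^esub>)"

lemma point_chain_chains: "m \<in> component M z \<Longrightarrow> point_chain M us m \<in> chains M us z 0"
  by (auto simp: chains_def point_chain_def count_list_True_eq_0 cube_vertex_replicate_False)

lemma chains_0_point_chain:
  assumes "c \<in> chains M us z 0"
  shows "c = point_chain M us (c (replicate (length us) False))"
  using assms by (auto simp: chains_def point_chain_def count_list_True_eq_0 fun_eq_iff)

text \<open>The part of \<open>component M z\<close> that comes from the vertices \<open>us\<close>; when these are the upper covers
  of \<open>z\<close>, it is the component of the radical of \<open>M\<close>.\<close>

definition radical_at :: "('a::{finite,lattice} \<Rightarrow> 'a \<Rightarrow> 'k::field, 'm) module \<Rightarrow> 'a list \<Rightarrow> 'a \<Rightarrow> 'm set" where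
  "radical_at M us z =
     {m \<in> component M z. \<exists>b\<in>chains M us z 1. \<forall>bs. boundary M us z b bs = point_chain M us m bs}"

lemma radical_atI:
  assumes "left_module incidence_algebra M" "b \<in> chains M us z 1"
  shows "boundary M us z b (replicate (length us) False) \<in> radical_at M us z"
proof -
  interpret M: lattice_incidence_module M using assms(1) by (rule lattice_incidence_moduleI)
  have "boundary M us z b \<in> chains M us z 0" using assms(2) by (intro M.boundary_chains) simp
  then show ?thesis
    using chains_0_point_chain[of "boundary M us z b" M us z] assms(2)
      chains_component[OF assms(1), of "boundary M us z b" us z 0 "replicate (length us) False"]
    by (auto simp: radical_at_def cube_vertex_replicate_False)
qed

lemma radical_at_hom:
  assumes M: "left_module incidence_algebra M" and N: "left_module incidence_algebra N"
    and h: "h \<in> left_module_hom incidence_algebra M N" and m: "m \<in> radical_at M us z"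
  shows "h m \<in> radical_at N us z"
proof -
  interpret M: lattice_incidence_module M using M by (rule lattice_incidence_moduleI)
  obtain b where b: "b \<in> chains M us z 1" "\<And>bs. boundary M us z b bs = point_chain M us m bs"
    using m by (auto simp: radical_at_def)
  have "boundary N us z (\<lambda>bs. h (b bs)) (replicate (length us) False) = h m"
    using boundary_hom[OF M N h M.chains_closed[OF b(1)]] b(2) by (simp add: point_chain_def)
  then show ?thesis using radical_atI[OF N chains_hom[OF M N h b(1)]] by simp
qed

lemma subspace_at_radical_at:
  fixes M :: "('p::{finite,lattice} \<Rightarrow> 'p \<Rightarrow> 'k::field, 'm) module"
  assumes M: "left_module incidence_algebra M"
  shows "subspace_at M z (radical_at M us z)"
proof -
  interpret M: lattice_incidence_module M using M by (rule lattice_incidence_moduleI)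
  let ?F = "replicate (length us) False"
  have rad: "\<exists>b\<in>chains M us z 1. boundary M us z b ?F = m" if "m \<in> radical_at M us z" for m
  proof -
    obtain b where "b \<in> chains M us z 1" "\<And>bs. boundary M us z b bs = point_chain M us m bs"
      using \<open>m \<in> radical_at M us z\<close> by (auto simp: radical_at_def)
    then show ?thesis by (intro bexI[of _ b]) (simp_all add: point_chain_def)
  qed
  show ?thesis
    unfolding subspace_at_def
  proof (intro conjI ballI allI)
    show "radical_at M us z \<subseteq> component M z" by (auto simp: radical_at_def)
    show "\<zero>\<^bsub>M\<^esub> \<in> radical_at M us z"
      using radical_atI[OF M chains_zero[OF M], of us z] by (simp add: M.boundary_zero)
    fix m assume m: "m \<in> radical_at M us z"
    then obtain b where b: "b \<in> chains M us z 1" "boundary M us z b ?F = m" using rad by blast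
    show "m \<oplus>\<^bsub>M\<^esub> n \<in> radical_at M us z" if n: "n \<in> radical_at M us z" for n
    proof -
      obtain b' where b': "b' \<in> chains M us z 1" "boundary M us z b' ?F = n" using rad[OF n] by blast
      then show ?thesis
        using radical_atI[OF M M.chains_add[OF b(1) b'(1)]] b
        by (simp add: M.boundary_add M.chains_closed[OF b(1)] M.chains_closed[OF b'(1)])
    qed
    fix k :: 'k
    \<comment> \<open>Multiplication by \<open>monomial k z z\<close> is in general no endomorphism
      of \<open>M\<close>; the scalar matrix \<open>?k\<close> is central, hence acts by an
      endomorphism, and agrees with it on \<open>component M z\<close>.\<close>
    let ?k = "\<lambda>u v :: 'p. if u = v then k else 0"
    have k: "?k \<in> carrier incidence_algebra" by (auto simp: incidence_algebra_def)
    have diag_left: "(\<Sum>z\<in>UNIV. (if x = z then k else 0) * b z) = k * b x" for x and b :: "'p \<Rightarrow> 'k"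
    proof -
      have "(\<Sum>z\<in>UNIV. (if x = z then k else 0) * b z) = (\<Sum>z\<in>UNIV. if z = x then k * b x else 0)"
        by (rule sum.cong) auto
      then show ?thesis by simp
    qed
    have diag_right: "(\<Sum>z\<in>UNIV. b z * (if z = y then k else 0)) = k * b y" for y and b :: "'p \<Rightarrow> 'k"
      using diag_left[of y b] by (simp add: mult.commute eq_commute)
    have central: "?k \<otimes>\<^bsub>incidence_algebra\<^esub> a = a \<otimes>\<^bsub>incidence_algebra\<^esub> ?k" for a
      by (simp add: incidence_algebra_def diag_left diag_right)
    have "(\<lambda>m. ?k \<odot>\<^bsub>M\<^esub> m) \<in> left_module_hom incidence_algebra M M"
      by (rule left_module_homI)
        (use k in \<open>simp_all add: M.smult_closed M.smult_r_distr central flip: M.smult_assoc\<close>)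
    then have "?k \<odot>\<^bsub>M\<^esub> m \<in> radical_at M us z" using radical_at_hom[OF M M _ m] by blast
    moreover have "?k \<odot>\<^bsub>M\<^esub> m = monomial k z z \<odot>\<^bsub>M\<^esub> m"
    proof -
      have mz: "m \<in> component M z" using m by (simp add: radical_at_def)
      have "?k \<otimes>\<^bsub>incidence_algebra\<^esub> monomial 1 z z = monomial k z z"
        by (auto simp: incidence_algebra_def monomial_def fun_eq_iff diag_left)
      moreover have "?k \<odot>\<^bsub>M\<^esub> m = ?k \<odot>\<^bsub>M\<^esub> (monomial 1 z z \<odot>\<^bsub>M\<^esub> m)"
        using mz by (simp add: component_def)
      ultimately show ?thesis
        using k component_carrier[OF mz] by (simp add: monomial_carrier flip: M.smult_assoc)
    qed
    ultimately show "monomial k z z \<odot>\<^bsub>M\<^esub> m \<in> radical_at M us z" by simp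
  qed
qed

lemma upper_covers_below:
  fixes x y :: "'a::{finite,order}"
  assumes "x < y"
  obtains u where "u \<in> upper_covers x" "u \<le> y"
proof -
  have "y \<in> {z. x < z \<and> z \<le> y}" using assms by simp
  then obtain u where u: "x < u" "u \<le> y" "\<And>z. x < z \<Longrightarrow> z \<le> y \<Longrightarrow> z \<le> u \<Longrightarrow> z = u"
    using finite_has_minimal[of "{z. x < z \<and> z \<le> y}"] by (metis (lifting) empty_iff finite mem_Collect_eq)
  then show ?thesis using that[of u] by (auto simp: upper_covers_def)
qed

lemma downward_induct [case_names less]:
  fixes x :: "'a::{finite,order}"
  assumes "\<And>x. (\<And>y. x < y \<Longrightarrow> P y) \<Longrightarrow> P x"
  shows "P x"
proof (induction "card {y. x < y}" arbitrary: x rule: less_induct)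
  case less
  show ?case
  proof (rule assms)
    fix y assume "x < y"
    then have "{z. y < z} \<subset> {z. x < z}" by (auto intro: less_trans)
    then have "card {z. y < z} < card {z. x < z}" by (simp add: psubset_card_mono)
    then show "P y" by (rule less)
  qed
qed

lemma chain_1_vertex:
  assumes "set us = upper_covers x" "length bs = length us" "count_list bs True = 1"
  shows "x < cube_vertex x us bs"
proof -
  obtain u where "u \<in> upper_covers x" "u \<le> cube_vertex x us bs"
    using cube_vertex_ge_selected[of bs us x] assms by auto
  then show ?thesis by (auto simp: upper_covers_def)
qed

text \<open>Since \<open>V x\<close> complements the radical at \<open>x\<close>, the map from the
  induced module to \<open>M\<close> is bijective modulo radicals; surjectivity, and injectivity
  under vanishing homology in degree 1, are then Nakayama arguments. The acyclicity clause is
  recorded so that it can be passed on to all projective modules.\<close>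

lemma projective_cover:
  fixes M :: "('p::{finite,lattice} \<Rightarrow> 'p \<Rightarrow> 'k::field, 'm) module" and us :: "'p \<Rightarrow> 'p list"
    and \<iota> :: "('p \<Rightarrow> 'p \<Rightarrow> 'm) \<Rightarrow> 'm"
  assumes M: "left_module incidence_algebra M" and \<iota>: "inj \<iota>"
    and us: "\<And>x. set (us x) = upper_covers x"
  shows "\<exists>(P :: ('p \<Rightarrow> 'p \<Rightarrow> 'k, 'm) module) f.
    projective_module incidence_algebra P \<and> f \<in> left_module_hom incidence_algebra P M \<and>
    f ` carrier P = carrier M \<and>
    ((\<forall>x. acyclic_at M (us x) x 1) \<longrightarrow> (\<forall>p\<in>carrier P. f p = \<zero>\<^bsub>M\<^esub> \<longrightarrow> p = \<zero>\<^bsub>P\<^esub>)) \<and>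
    (\<forall>us z j. 0 < j \<longrightarrow> acyclic_at P us z j)"
proof -
  interpret M: lattice_incidence_module M using M by (rule lattice_incidence_moduleI)
  let ?R = "\<lambda>x. radical_at M (us x) x"
  have "\<exists>V. subspace_at M x V \<and> V \<inter> ?R x = {\<zero>\<^bsub>M\<^esub>} \<and>
      (\<forall>m\<in>component M x. \<exists>v\<in>V. \<exists>r\<in>?R x. m = v \<oplus>\<^bsub>M\<^esub> r)" for x
    using M.subspace_at_complement[OF subspace_at_radical_at[OF M, of x "us x"]] by metis
  then obtain V where VR: "\<And>x. subspace_at M x (V x)" "\<And>x. V x \<inter> ?R x = {\<zero>\<^bsub>M\<^esub>}"
    "\<And>x m. m \<in> component M x \<Longrightarrow> \<exists>v\<in>V x. \<exists>r\<in>?R x. m = v \<oplus>\<^bsub>M\<^esub> r"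
    by metis
  interpret lattice_component_subspaces M V by unfold_locales (rule VR(1))
  interpret E: component_maps M V M "\<lambda>_ v. v"
    by unfold_locales (use subspace_atD(1)[OF VR(1)] in \<open>auto simp: linear_at_def\<close>)
  define \<theta> where "\<theta> = extension M (\<lambda>_ v. v)"
  have \<theta>: "\<theta> \<in> left_module_hom incidence_algebra Q M"
    unfolding \<theta>_def by (rule E.extension_hom)
  have \<theta>_gen: "\<theta> (generator x v) = v" if "v \<in> V x" for x v
    unfolding \<theta>_def using that by (rule E.extension_generator)
  interpret h: lattice_module_hom Q M \<theta>
    using left_module_Q M \<theta> by (rule lattice_module_hom.intro)
  note h\<theta> = left_module_homD[OF \<theta>]
  \<comment> \<open>Radical elements at \<open>x\<close> come from components at vertices strictly
    above \<open>x\<close>, which lie in the image by induction.\<close>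
  have component_image: "component M x \<subseteq> \<theta> ` carrier Q" for x
  proof (induction x rule: downward_induct)
    case (less x)
    show ?case
    proof
      fix m assume "m \<in> component M x"
      then obtain v r where vr: "v \<in> V x" "r \<in> ?R x" "m = v \<oplus>\<^bsub>M\<^esub> r" using VR(3) by blast
      then obtain b where b: "b \<in> chains M (us x) x 1"
        "\<And>bs. boundary M (us x) x b bs = point_chain M (us x) r bs"
        by (auto simp: radical_at_def)
      have "b bs \<in> \<theta> ` component Q (cube_vertex x (us x) bs)"
        if "length bs = length (us x)" "count_list bs True = 1" for bs
      proof -
        have "b bs \<in> component M (cube_vertex x (us x) bs)" using chains_component[OF M b(1)] .
        moreover have "x < cube_vertex x (us x) bs" using chain_1_vertex[OF us that] .
        ultimately show ?thesis
          using less hom_component_surj[OF left_module_Q M \<theta>] by blast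
      qed
      then obtain b' where b': "b' \<in> chains Q (us x) x 1" "\<And>bs. \<theta> (b' bs) = b bs"
        using chains_lift[OF left_module_Q M \<theta> b(1)] by metis
      let ?q = "boundary Q (us x) x b' (replicate (length (us x)) False)"
      have q: "?q \<in> carrier Q" using Q.chains_closed[OF b'(1)] by (rule Q.boundary_closed)
      have "\<theta> ?q = r"
        using h.boundary_f[OF b'(1), of "replicate (length (us x)) False"] b'(2) b(2)
        by (simp add: point_chain_def)
      then have "\<theta> (generator x v \<oplus>\<^bsub>Q\<^esub> ?q) = m"
        using vr \<theta>_gen h\<theta>(2)[OF generator_carrier[OF vr(1)] q] by simp
      then show "m \<in> \<theta> ` carrier Q"
        using Q.M.a_closed[OF generator_carrier[OF vr(1)] q] by blast
    qed
  qed
  have surj: "\<theta> ` carrier Q = carrier M"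
  proof
    show "\<theta> ` carrier Q \<subseteq> carrier M" using h\<theta>(1) by blast
    show "carrier M \<subseteq> \<theta> ` carrier Q"
    proof
      fix m assume m: "m \<in> carrier M"
      have "monomial 1 x x \<odot>\<^bsub>M\<^esub> m \<in> \<theta> ` carrier Q" for x
        using component_image[of x] M.monomial_component[OF order.refl m] by blast
      then have "\<forall>x. \<exists>q. q \<in> carrier Q \<and> \<theta> q = monomial 1 x x \<odot>\<^bsub>M\<^esub> m" by (metis imageE)
      then obtain q where q: "\<And>x. q x \<in> carrier Q" "\<And>x. \<theta> (q x) = monomial 1 x x \<odot>\<^bsub>M\<^esub> m" by metis
      have "\<theta> (\<Oplus>\<^bsub>Q\<^esub>x\<in>UNIV. q x) = (\<Oplus>\<^bsub>M\<^esub>x\<in>UNIV. \<theta> (q x))"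
        using q(1) h\<theta>(1,2)
        by (intro additive_finsum[where h = \<theta>, OF Q.abelian_group_axioms M.abelian_group_axioms]) auto
      also have "\<dots> = m" unfolding q(2) using m by (rule M.component_decomposition)
      finally show "m \<in> \<theta> ` carrier Q"
        using Q.M.finsum_closed[of q UNIV] q(1) by blast
    qed
  qed
  \<comment> \<open>Nakayama for the kernel: its component at \<open>x\<close> is shown to come from
    its components strictly above \<open>x\<close>, which vanish by induction.\<close>
  have kernel_zero: "\<phi> = \<zero>\<^bsub>Q\<^esub>" if ac: "\<And>x. acyclic_at M (us x) x 1" and \<phi>: "\<phi> \<in> carrier h.K" for \<phi>
  proof -
    have "component h.K x \<subseteq> {\<zero>\<^bsub>Q\<^esub>}" for x
    proof (induction x rule: downward_induct)
      case (less x)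
      show ?case
      proof
        fix \<omega> assume \<omega>K: "\<omega> \<in> component h.K x"
        then have \<omega>: "\<omega> \<in> component Q x" "\<theta> \<omega> = \<zero>\<^bsub>M\<^esub>" by (auto simp: component_kernel_module)
        have \<omega>c: "\<omega> \<in> carrier Q" using \<omega>(1) by (rule component_carrier)
        \<comment> \<open>The diagonal entry is the part of \<open>\<omega>\<close> in
          \<open>V x\<close>. The other nonzero columns lie strictly above \<open>x\<close>, hence
          above an upper cover of \<open>x\<close>, so they form a radical element of
          \<open>Q\<close>.\<close>
        let ?v = "\<omega> x x" and ?\<omega>' = "column_projection (- {x}) \<omega>"
        have v: "?v \<in> V x" using entry[OF \<omega>c] by blast
        have \<omega>': "?\<omega>' \<in> component Q x" using hom_component[OF column_projection_hom \<omega>(1)] .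
        have split: "\<omega> = generator x ?v \<oplus>\<^bsub>Q\<^esub> ?\<omega>'"
          using \<omega>(1) entry(2)[OF \<omega>c] by (auto simp: component_Q generator_def column_projection_def fun_eq_iff)
        have "\<exists>b\<in>chains Q (us x) x (Suc 0). \<forall>bs. boundary Q (us x) x b bs = point_chain Q (us x) ?\<omega>' bs"
        proof (rule cycle_is_boundary[of "{y. x < y}"])
          show "point_chain Q (us x) ?\<omega>' \<in> chains Q (us x) x 0" using \<omega>' by (rule point_chain_chains)
          then show "boundary Q (us x) x (point_chain Q (us x) ?\<omega>') bs = \<zero>\<^bsub>Q\<^esub>" for bs
            by (rule Q.boundary_chains_0)
          show "point_chain Q (us x) ?\<omega>' bs a y = \<zero>\<^bsub>M\<^esub>" if "y \<notin> {y. x < y}" for bs a y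
          proof (cases "a = x")
            case True
            have "y = x \<or> \<not> x \<le> y" using that by (auto simp: less_le)
            then show ?thesis using True entry(4)[OF \<omega>c] by (auto simp: point_chain_def column_projection_def)
          next
            case False
            then show ?thesis using \<omega>' by (auto simp: point_chain_def component_Q)
          qed
          show "0 < (0 :: nat) \<or> (\<exists>u\<in>set (us x). u \<le> y)" if "y \<in> {y. x < y}" for y
            using that upper_covers_below[of x y] us[of x] by auto
        qed simp
        then have \<omega>'rad: "?\<omega>' \<in> radical_at Q (us x) x" using \<omega>' by (auto simp: radical_at_def)
        \<comment> \<open>As \<open>\<theta> \<omega>\<close> is zero, \<open>?v\<close> lies both
          in \<open>V x\<close> and in the radical of \<open>M\<close>; so it vanishes, and
          \<open>\<omega>\<close> itself is radical in \<open>Q\<close>.\<close>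
        then have r: "\<theta> ?\<omega>' \<in> ?R x" using radical_at_hom[OF left_module_Q M \<theta>] by blast
        have "\<zero>\<^bsub>M\<^esub> = \<theta> (generator x ?v \<oplus>\<^bsub>Q\<^esub> ?\<omega>')" using \<omega>(2) split by simp
        also have "\<dots> = ?v \<oplus>\<^bsub>M\<^esub> \<theta> ?\<omega>'"
          using h\<theta>(2)[OF generator_carrier[OF v] component_carrier[OF \<omega>']] \<theta>_gen[OF v] by simp
        finally have "?v = \<ominus>\<^bsub>M\<^esub> \<theta> ?\<omega>'"
          using entry(2)[OF \<omega>c] h\<theta>(1)[OF component_carrier[OF \<omega>']] by (metis M.M.minus_equality)
        then have "?v \<in> ?R x" using M.subspace_at_minus[OF subspace_at_radical_at[OF M] r] by simp
        then have "?v = \<zero>\<^bsub>M\<^esub>" using v VR(2) by blast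
        have "?\<omega>' = \<omega>"
        proof (intro ext)
          fix a y
          show "?\<omega>' a y = \<omega> a y"
            using \<omega>(1) \<open>?v = \<zero>\<^bsub>M\<^esub>\<close>
            by (cases "a = x") (auto simp: column_projection_def component_Q)
        qed
        then obtain e where e: "e \<in> chains Q (us x) x (Suc 0)"
          "\<And>bs. boundary Q (us x) x e bs = point_chain h.K (us x) \<omega> bs"
          using \<omega>'rad by (auto simp: radical_at_def point_chain_def)
        \<comment> \<open>Vanishing homology of \<open>M\<close> in degree 1 allows the filling to
          be moved from \<open>Q\<close> into the kernel.\<close>
        have "\<exists>b\<in>chains h.K (us x) x (Suc 0).
            \<forall>bs. boundary h.K (us x) x b bs = point_chain h.K (us x) \<omega> bs"
          using h.kernel_boundary_lift[OF surj _ point_chain_chains[OF \<omega>K] e] ac[of x] by simp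
        then obtain b where b: "b \<in> chains h.K (us x) x 1"
          "\<And>bs. boundary h.K (us x) x b bs = point_chain h.K (us x) \<omega> bs"
          by auto
        have "b bs = \<zero>\<^bsub>h.K\<^esub>" for bs
        proof (cases "length bs = length (us x) \<and> count_list bs True = 1")
          case True
          then have "x < cube_vertex x (us x) bs" using chain_1_vertex[OF us] by blast
          then have "b bs \<in> {\<zero>\<^bsub>Q\<^esub>}" using less chains_component[OF h.K b(1), of bs] by blast
          then show ?thesis by simp
        next
          case False
          then show ?thesis using b(1) unfolding chains_def mem_Collect_eq by metis
        qed
        then have "b = (\<lambda>_. \<zero>\<^bsub>h.K\<^esub>)" by blast
        then have "\<omega> = \<zero>\<^bsub>h.K\<^esub>"
          using b(2)[of "replicate (length (us x)) False"] h.K.boundary_zero by (simp add: point_chain_def)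
        then show "\<omega> \<in> {\<zero>\<^bsub>Q\<^esub>}" by simp
      qed
    qed
    then have "monomial 1 x x \<odot>\<^bsub>h.K\<^esub> \<phi> = \<zero>\<^bsub>h.K\<^esub>" for x
      using h.K.monomial_component[OF order.refl \<phi>, of 1 x] by auto
    then have "\<phi> = (\<Oplus>\<^bsub>h.K\<^esub>x\<in>(UNIV :: 'p set). \<zero>\<^bsub>h.K\<^esub>)"
      using h.K.component_decomposition[OF \<phi>] by simp
    also have "\<dots> = \<zero>\<^bsub>h.K\<^esub>" by (rule h.K.M.finsum_zero)
    finally show ?thesis by simp
  qed
  \<comment> \<open>The matrices are encoded in \<open>'m\<close>, because a resolution of
    \<open>M\<close> has all its terms in the element type of \<open>M\<close>.\<close>
  define P where "P = transport_module \<iota> Q"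
  have inj: "inj_on \<iota> (carrier Q)" using \<iota> by (rule inj_on_subset) simp
  note tr = transport_module[OF left_module_Q inj, folded P_def]
  let ?i = "inv_into (carrier Q) \<iota>"
  have i: "?i \<in> left_module_hom incidence_algebra P Q"
    using tr(2,3) left_module_Q by (rule left_module_hom_inverse)
  have i_bij: "bij_betw ?i (carrier P) (carrier Q)" using tr(3) by (rule bij_betw_inv_into)
  have i\<iota>: "\<iota> (?i p) = p" if "p \<in> carrier P" for p
    using tr(3) that by (simp add: bij_betw_inv_into_right)
  have "projective_module incidence_algebra P"
    unfolding projective_module_def
  proof (intro conjI allI impI)
    show "left_module incidence_algebra P" by (rule tr(1))
    fix X Y :: "('p \<Rightarrow> 'p \<Rightarrow> 'k, 'm) module" and f g
    assume XY: "left_module incidence_algebra X" "left_module incidence_algebra Y"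
      "f \<in> left_module_hom incidence_algebra X Y" "f ` carrier X = carrier Y"
      and g: "g \<in> left_module_hom incidence_algebra P Y"
    obtain l where l: "l \<in> left_module_hom incidence_algebra Q X"
      "\<And>\<phi>. \<phi> \<in> carrier Q \<Longrightarrow> f (l \<phi>) = g (\<iota> \<phi>)"
      using projective_lift[OF XY left_module_hom_comp[OF tr(2) g]] by blast
    have "f (l (?i p)) = g p" if "p \<in> carrier P" for p
      using l(2)[OF left_module_homD(1)[OF i that]] i\<iota>[OF that] by simp
    then show "\<exists>l\<in>left_module_hom incidence_algebra P X. \<forall>p\<in>carrier P. f (l p) = g p"
      by (intro bexI[of _ "\<lambda>p. l (?i p)"] ballI left_module_hom_comp[OF i l(1)])
  qed
  moreover have "(\<lambda>p. \<theta> (?i p)) \<in> left_module_hom incidence_algebra P M"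
    using i \<theta> by (rule left_module_hom_comp)
  moreover have "(\<lambda>p. \<theta> (?i p)) ` carrier P = carrier M"
    using i_bij surj by (simp add: bij_betw_def flip: image_image)
  moreover have "p = \<zero>\<^bsub>P\<^esub>"
    if "\<forall>x. acyclic_at M (us x) x 1" "p \<in> carrier P" "\<theta> (?i p) = \<zero>\<^bsub>M\<^esub>" for p
  proof -
    have "?i p = \<zero>\<^bsub>Q\<^esub>"
      using that kernel_zero left_module_homD(1)[OF i] by (simp add: carrier_kernel_module)
    then show ?thesis
      using i\<iota>[OF that(2)] left_module_hom_zero[OF left_module_Q tr(1,2)] by simp
  qed
  moreover have "acyclic_at P ws z j" if "0 < j" for ws z j
    using acyclic_at_retract[OF tr(1) left_module_Q i tr(2) i\<iota> acyclic_at_Q[OF that]] .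
  ultimately show ?thesis by (intro exI[of _ P] exI[of _ "\<lambda>p. \<theta> (?i p)"]) simp
qed

text \<open>Lifting the identity of \<open>P\<close> through the cover \<open>L\<close> makes
  \<open>P\<close> a retract of an acyclic module. The injection \<open>\<iota>\<close> puts
  \<open>L\<close> into the range of the lifting property.\<close>

lemma projective_acyclic_at:
  fixes P :: "('p::{finite,lattice} \<Rightarrow> 'p \<Rightarrow> 'k::field, 'm) module"
    and \<iota> :: "('p \<Rightarrow> 'p \<Rightarrow> 'm) \<Rightarrow> 'm"
  assumes P: "projective_module incidence_algebra P" and \<iota>: "inj \<iota>" and "0 < j"
  shows "acyclic_at P us z j"
proof -
  have "\<exists>ws. set ws = upper_covers x" for x :: 'p by (rule finite_list) simp
  then obtain ws where ws: "\<And>x :: 'p. set (ws x) = upper_covers x" by metis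
  have Pm: "left_module incidence_algebra P" using P by (simp add: projective_module_def)
  obtain L :: "('p \<Rightarrow> 'p \<Rightarrow> 'k, 'm) module" and f where
    L: "projective_module incidence_algebra L" "f \<in> left_module_hom incidence_algebra L P"
      "f ` carrier L = carrier P" "\<And>us z j. 0 < j \<Longrightarrow> acyclic_at L us z j"
    using projective_cover[OF Pm \<iota> ws] by blast
  have Lm: "left_module incidence_algebra L" using L(1) by (simp add: projective_module_def)
  obtain s where "s \<in> left_module_hom incidence_algebra P L" "\<And>x. x \<in> carrier P \<Longrightarrow> f (s x) = x"
    using P[unfolded projective_module_def] Lm Pm L(2,3) left_module_hom_id by metis
  then show ?thesis using acyclic_at_retract[OF Pm Lm _ L(2)] L(4)[OF \<open>0 < j\<close>] by blast
qed

section \<open>Simple modules\<close>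

text \<open>The functor with the field at \<open>y\<close> and zero elsewhere. The diagonal entry
  \<open>a y y\<close> is multiplicative in \<open>a\<close>, because a path from \<open>y\<close>
  to \<open>y\<close> cannot leave \<open>y\<close>.\<close>

definition simple_module :: "'a::{finite,order} \<Rightarrow> ('a \<Rightarrow> 'a \<Rightarrow> 'k::field, 'k) module" where
  "simple_module y = \<lparr>carrier = UNIV, mult = undefined, one = undefined, zero = 0, add = (+),
     smult = (\<lambda>a v. a y y * v)\<rparr>"

lemma left_module_simple_module:
  "left_module incidence_algebra (simple_module y :: ('a::{finite,order} \<Rightarrow> 'a \<Rightarrow> 'k::field, 'k) module)"
proof (rule left_moduleI)
  show "abelian_group (simple_module y :: ('a \<Rightarrow> 'a \<Rightarrow> 'k, 'k) module)"
  proof (rule abelian_groupI)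
    fix v :: 'k
    show "\<exists>w\<in>carrier (simple_module y :: ('a \<Rightarrow> 'a \<Rightarrow> 'k, 'k) module).
        w \<oplus>\<^bsub>simple_module y :: ('a \<Rightarrow> 'a \<Rightarrow> 'k, 'k) module\<^esub> v = \<zero>\<^bsub>simple_module y :: ('a \<Rightarrow> 'a \<Rightarrow> 'k, 'k) module\<^esub>"
      by (rule bexI[of _ "- v"]) (simp_all add: simple_module_def)
  qed (simp_all add: simple_module_def add_ac)
  show "ring (incidence_algebra :: ('a \<Rightarrow> 'a \<Rightarrow> 'k) ring)" by (rule ring_incidence_algebra)
  fix a b :: "'a \<Rightarrow> 'a \<Rightarrow> 'k"
  assume ab: "a \<in> carrier incidence_algebra" "b \<in> carrier incidence_algebra"
  have "(\<Sum>z\<in>UNIV. a y z * b z y) = (\<Sum>z\<in>UNIV. if z = y then a y y * b y y else 0)"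
  proof (rule sum.cong)
    fix z
    have "a y z * b z y = 0" if "z \<noteq> y"
    proof (cases "y \<le> z")
      case True
      then have "\<not> z \<le> y" using that by auto
      then show ?thesis using ab by (simp add: incidence_algebra_def)
    qed (use ab in \<open>simp add: incidence_algebra_def\<close>)
    then show "a y z * b z y = (if z = y then a y y * b y y else 0)" by simp
  qed simp
  then show "(a \<otimes>\<^bsub>incidence_algebra\<^esub> b) \<odot>\<^bsub>simple_module y\<^esub> v = a \<odot>\<^bsub>simple_module y\<^esub> (b \<odot>\<^bsub>simple_module y\<^esub> v)"
    for v by (simp add: simple_module_def incidence_algebra_def)
qed (simp_all add: simple_module_def incidence_algebra_def algebra_simps)

lemma component_simple_module:
  "component (simple_module y) x = (if x = y then UNIV else {0 :: 'k::field})"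
  by (auto simp: component_def simple_module_def monomial_def)

lemma count_list_True_eq_length: "count_list bs True = length bs \<longleftrightarrow> bs = replicate (length bs) True"
proof (induction bs)
  case (Cons b bs)
  have "count_list bs True \<le> length bs" by (rule count_le_length)
  then show ?case using Cons by (cases b) auto
qed simp

text \<open>If \<open>y\<close> is the vertex of the full selection only, the complex of the simple
  module is the field in degree \<open>length us\<close> and zero elsewhere, so its top class cannot
  bound.\<close>

lemma not_acyclic_at_simple_module:
  fixes x y :: "'p::{finite,lattice}"
  assumes y: "y = cube_vertex x us (replicate (length us) True)"
    and top: "\<And>bs. length bs = length us \<Longrightarrow> cube_vertex x us bs = y \<Longrightarrow> bs = replicate (length us) True"
  shows "\<not> acyclic_at (simple_module y :: ('p \<Rightarrow> 'p \<Rightarrow> 'k::field, 'k) module) us x (length us)"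
proof
  let ?S = "simple_module y :: ('p \<Rightarrow> 'p \<Rightarrow> 'k, 'k) module" and ?T = "replicate (length us) True"
  assume ac: "acyclic_at ?S us x (length us)"
  interpret S: lattice_incidence_module ?S
    using left_module_simple_module by (rule lattice_incidence_moduleI)
  have zero: "\<zero>\<^bsub>?S\<^esub> = 0" by (simp add: simple_module_def)
  define c :: "bool list \<Rightarrow> 'k" where "c bs = (if bs = ?T then 1 else 0)" for bs
  have sel: "length bs = length us \<and> count_list bs True = length us \<longleftrightarrow> bs = ?T" for bs
    using count_list_True_eq_length[of bs] by auto
  have c: "c \<in> chains ?S us x (length us)"
    unfolding chains_def mem_Collect_eq sel zero component_simple_module using y by (auto simp: c_def)
  have "boundary ?S us x c bs = \<zero>\<^bsub>?S\<^esub>" for bs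
  proof (cases "length us")
    case 0
    then show ?thesis using c S.boundary_chains_0 by simp
  next
    case (Suc i)
    then have d: "boundary ?S us x c \<in> chains ?S us x i" using c by (intro S.boundary_chains) simp
    show ?thesis
    proof (cases "length bs = length us \<and> count_list bs True = i")
      case True
      then have "cube_vertex x us bs \<noteq> y" using top[of bs] sel[of bs] Suc by auto
      then show ?thesis
        using chains_component[OF left_module_simple_module d, of bs]
        by (simp add: component_simple_module zero)
    next
      case False
      then show ?thesis using d unfolding chains_def mem_Collect_eq by metis
    qed
  qed
  then obtain b where b: "b \<in> chains ?S us x (Suc (length us))" "\<And>bs. boundary ?S us x b bs = c bs"
    using acyclic_atE[OF ac c] by metis
  have "b = (\<lambda>_. \<zero>\<^bsub>?S\<^esub>)" using S.chains_eq_zero[OF b(1)] by auto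
  then have "c ?T = \<zero>\<^bsub>?S\<^esub>" using b(2)[of ?T] S.boundary_zero[of us x ?T] by simp
  then show False by (simp add: c_def zero)
qed

lemma cube_vertex_replicate_True_ge: "u \<in> set us \<Longrightarrow> u \<le> cube_vertex z us (replicate (length us) True)"
proof (induction us arbitrary: z)
  case (Cons v us)
  have "v \<le> cube_vertex (sup z v) us (replicate (length us) True)"
    using cube_vertex_ge[of "sup z v" us] by simp
  then show ?case using Cons by auto
qed simp

lemma inf_cube_vertex_le:
  fixes u :: "'a::distrib_lattice"
  assumes "inf u z \<le> x" "\<And>i. i < length us \<Longrightarrow> i < length bs \<Longrightarrow> bs ! i \<Longrightarrow> inf u (us ! i) \<le> x"
  shows "inf u (cube_vertex z us bs) \<le> x"
  using assms
proof (induction z us bs rule: cube_vertex.induct)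
  case (1 z v us b bs)
  have "inf u (if b then sup z v else z) \<le> x"
    using "1.prems"(1) "1.prems"(2)[of 0] by (simp add: inf_sup_distrib1)
  moreover have "inf u (us ! i) \<le> x" if "i < length us" "i < length bs" "bs ! i" for i
    using "1.prems"(2)[of "Suc i"] that by simp
  ultimately show ?case using "1.IH" by simp
qed simp_all

text \<open>The only use of distributivity on the algebra side.\<close>

lemma cube_vertex_upper_covers_top:
  fixes x :: "'a::distrib_lattice"
  assumes us: "set us = upper_covers x" "distinct us" and bs: "length bs = length us"
    and top: "cube_vertex x us bs = cube_vertex x us (replicate (length us) True)"
  shows "bs = replicate (length us) True"
proof (rule ccontr)
  assume "bs \<noteq> replicate (length us) True"
  then obtain i where i: "i < length us" "\<not> bs ! i"
    using bs by (metis length_replicate nth_equalityI nth_replicate)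
  let ?u = "us ! i"
  have u: "?u \<in> upper_covers x" using us(1) i(1) nth_mem by blast
  \<comment> \<open>By distributivity the unselected \<open>?u\<close> meets the vertex only in
    \<open>x\<close>, although it lies below the join of all upper covers.\<close>
  have "inf ?u (cube_vertex x us bs) \<le> x"
  proof (rule inf_cube_vertex_le)
    fix j assume j: "j < length us" "j < length bs" "bs ! j"
    then have "us ! j \<in> upper_covers x" "?u \<noteq> us ! j"
      using us i nth_mem by (blast, metis nth_eq_iff_index_eq)
    then show "inf ?u (us ! j) \<le> x" using upper_covers_inf[OF u] by simp
  qed simp
  moreover have "?u \<le> cube_vertex x us bs"
    unfolding top using i(1) by (intro cube_vertex_replicate_True_ge) simp
  ultimately have "?u \<le> x" by (simp add: inf.absorb1)
  then show False using u by (auto simp: upper_covers_def)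
qed

section \<open>Global dimension and order dimension\<close>

text \<open>An injective pairing on \<open>'m\<close> is iterated over \<open>I\<close>. Values
  outside \<open>I\<close> are not encoded, so injectivity is stated on \<open>I\<close>.\<close>

lemma inj_finite_functions:
  assumes "infinite (UNIV :: 'm set)" "finite I"
  shows "\<exists>g :: ('i \<Rightarrow> 'm) \<Rightarrow> 'm. \<forall>\<phi> \<psi>. g \<phi> = g \<psi> \<longrightarrow> (\<forall>i\<in>I. \<phi> i = \<psi> i)"
proof -
  have "\<exists>p :: 'm \<times> 'm \<Rightarrow> 'm. inj_on p (UNIV \<times> UNIV) \<and> p ` (UNIV \<times> UNIV) \<subseteq> UNIV"
    unfolding card_of_ordLeq by (rule ordIso_imp_ordLeq) (rule card_of_Times_same_infinite[OF assms(1)])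
  then obtain p :: "'m \<times> 'm \<Rightarrow> 'm" where p: "inj p" by auto
  from assms(2) show ?thesis
  proof (induction I rule: finite_induct)
    case (insert i I)
    then obtain g :: "('i \<Rightarrow> 'm) \<Rightarrow> 'm" where "\<forall>\<phi> \<psi>. g \<phi> = g \<psi> \<longrightarrow> (\<forall>i\<in>I. \<phi> i = \<psi> i)" by blast
    then show ?case by (intro exI[of _ "\<lambda>\<phi>. p (\<phi> i, g \<phi>)"]) (auto dest: injD[OF p])
  qed simp
qed

lemma inj_matrices:
  assumes "infinite (UNIV :: 'm set)"
  obtains \<iota> :: "('a::finite \<Rightarrow> 'a \<Rightarrow> 'm) \<Rightarrow> 'm" where "inj \<iota>"
proof -
  obtain g :: "('a \<times> 'a \<Rightarrow> 'm) \<Rightarrow> 'm" where g: "\<And>\<phi> \<psi>. g \<phi> = g \<psi> \<Longrightarrow> \<forall>i\<in>UNIV. \<phi> i = \<psi> i"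
    using inj_finite_functions[OF assms finite_UNIV] by blast
  have "inj (\<lambda>\<phi>. g (case_prod \<phi>))"
  proof (rule injI)
    fix \<phi> \<psi> :: "'a \<Rightarrow> 'a \<Rightarrow> 'm" assume "g (case_prod \<phi>) = g (case_prod \<psi>)"
    then have "case_prod \<phi> (x, y) = case_prod \<psi> (x, y)" for x y using g by blast
    then show "\<phi> = \<psi>" by (auto simp: fun_eq_iff)
  qed
  then show ?thesis by (rule that)
qed

lemma global_dimension_upper_covers:
  fixes emb :: "'k::field \<Rightarrow> 'm"
  assumes "infinite (UNIV :: 'm set)" "inj emb"
    and n: "\<And>x :: 'a::{finite,distrib_lattice}. card (upper_covers x) \<le> n"
    and n_attained: "\<exists>x :: 'a. card (upper_covers x) = n"
  shows "global_dimension TYPE('m) (incidence_algebra :: ('a \<Rightarrow> 'a \<Rightarrow> 'k) ring) = enat n"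
proof (rule antisym)
  obtain \<iota> :: "('a \<Rightarrow> 'a \<Rightarrow> 'm) \<Rightarrow> 'm" where \<iota>: "inj \<iota>" using inj_matrices[OF assms(1)] .
  have "\<exists>us. set us = upper_covers x \<and> distinct us" for x :: 'a by (rule finite_distinct_list) simp
  then obtain us where us: "\<And>x :: 'a. set (us x) = upper_covers x" "\<And>x. distinct (us x)" by metis
  have length_us: "length (us x) = card (upper_covers x)" for x
    using us distinct_card by metis
  note proj = projective_acyclic_at[OF _ \<iota>]
  show "global_dimension TYPE('m) (incidence_algebra :: ('a \<Rightarrow> 'a \<Rightarrow> 'k) ring) \<le> enat n"
    unfolding global_dimension_def
  proof (rule Sup_least, clarify)
    fix M :: "('a \<Rightarrow> 'a \<Rightarrow> 'k, 'm) module" assume M: "left_module incidence_algebra M"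
    interpret M: lattice_incidence_module M using M by (rule lattice_incidence_moduleI)
    have "acyclic_at M (us x) x j" if "n < j" for x j
      unfolding acyclic_at_def
    proof (intro ballI impI)
      fix c assume c: "c \<in> chains M (us x) x j"
      have "length (us x) < j" using length_us[of x] n[of x] that by simp
      then have "c bs = \<zero>\<^bsub>M\<^esub>" for bs by (rule M.chains_eq_zero[OF c])
      then show "\<exists>b\<in>chains M (us x) x (Suc j). \<forall>bs. boundary M (us x) x b bs = c bs"
        using chains_zero[OF M] M.boundary_zero by (intro bexI[of _ "\<lambda>_. \<zero>\<^bsub>M\<^esub>"]) simp_all
    qed
    moreover have "\<exists>(P :: ('a \<Rightarrow> 'a \<Rightarrow> 'k, 'm) module) f.
        projective_module incidence_algebra P \<and> f \<in> left_module_hom incidence_algebra P N \<and>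
        f ` carrier P = carrier N \<and>
        ((\<forall>x. acyclic_at N (us x) x 1) \<longrightarrow> (\<forall>p\<in>carrier P. f p = \<zero>\<^bsub>N\<^esub> \<longrightarrow> p = \<zero>\<^bsub>P\<^esub>))"
      if "left_module incidence_algebra N" for N :: "('a \<Rightarrow> 'a \<Rightarrow> 'k, 'm) module"
      using projective_cover[OF that \<iota> us(1)] by (elim exE conjE) (intro exI conjI)
    ultimately have "\<exists>C d. projective_resolution incidence_algebra M n C d"
      using M by (intro acyclic_at_imp_projective_resolution[of us M n]) (auto intro: proj)
    then show "projective_dimension incidence_algebra M \<le> enat n"
      unfolding projective_dimension_def by (intro Inf_lower) blast
  qed
  obtain x :: 'a where x: "card (upper_covers x) = n" using n_attained by blast
  \<comment> \<open>The join of all upper covers of \<open>x\<close>, which by distributivity is the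
    vertex of no smaller selection.\<close>
  define y where "y = cube_vertex x (us x) (replicate (length (us x)) True)"
  let ?S = "simple_module y :: ('a \<Rightarrow> 'a \<Rightarrow> 'k, 'k) module"
  define M where "M = transport_module emb ?S"
  have inj: "inj_on emb (carrier ?S)" using assms(2) by (rule inj_on_subset) simp
  note tr = transport_module[OF left_module_simple_module inj, folded M_def]
  have not_ac: "\<not> acyclic_at M (us x) x n"
  proof
    assume "acyclic_at M (us x) x n"
    then have "acyclic_at ?S (us x) x n"
      using left_module_hom_inverse[OF tr(2,3) left_module_simple_module] inj
      by (intro acyclic_at_retract[OF left_module_simple_module tr(1,2)]) auto
    moreover have "\<not> acyclic_at ?S (us x) x (length (us x))"
      using cube_vertex_upper_covers_top[OF us(1,2)]
      by (intro not_acyclic_at_simple_module) (auto simp: y_def)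
    ultimately show False using x length_us by simp
  qed
  have "enat n \<le> projective_dimension incidence_algebra M"
    unfolding projective_dimension_def
  proof (rule Inf_greatest, clarify)
    fix m C d assume "projective_resolution incidence_algebra M m C d"
    then have "\<not> m < n"
      using projective_resolution_imp_acyclic_at[where z = x and us = "us x" and M = M and n = m and j = n] proj tr(1) not_ac by blast
    then show "enat n \<le> enat m" by simp
  qed
  also have "\<dots> \<le> global_dimension TYPE('m) (incidence_algebra :: ('a \<Rightarrow> 'a \<Rightarrow> 'k) ring)"
    unfolding global_dimension_def using tr(1) by (intro Sup_upper) blast
  finally show "enat n \<le> global_dimension TYPE('m) (incidence_algebra :: ('a \<Rightarrow> 'a \<Rightarrow> 'k) ring)" .
qed

text \<open>The assumptions on \<open>'m\<close> make it a sufficient universe: the lattice is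
  finite and the field embeds, so the whole algebra injects into the infinite type
  \<open>'m\<close>, and \<open>global_dimension TYPE('m)\<close> is the usual left global
  dimension.\<close>

theorem theorem3p9:
  fixes emb :: "'k::field \<Rightarrow> 'm"
  assumes "card (UNIV :: 'a::{finite,distrib_lattice} set) \<ge> 2"
    and "infinite (UNIV :: 'm set)"
    and "inj emb"
  shows "global_dimension TYPE('m) (incidence_algebra :: ('a \<Rightarrow> 'a \<Rightarrow> 'k) ring) =
    enat (order_dimension UNIV {(x, y :: 'a). x \<le> y})"
proof -
  define n where "n = Max (range (\<lambda>x :: 'a. card (upper_covers x)))"
  have n: "card (upper_covers x) \<le> n" for x :: 'a by (simp add: n_def)
  have "n \<in> range (\<lambda>x :: 'a. card (upper_covers x))" unfolding n_def by (rule Max_in) auto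
  then have n_attained: "\<exists>x :: 'a. card (upper_covers x) = n" by auto
  show ?thesis
    using global_dimension_upper_covers[OF assms(2,3) n n_attained]
      order_dimension_upper_covers[OF n n_attained]
    by simp
qed

end
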